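(* Let $(\Omega,\mu)$ be a finite measure space with $\mu(\Omega)=1$. Let $E$ be an r.i. space, $\mathrm b\in SV(0,1)$, $1<p<\infty$, $\frac1p+\frac1{p'}=1$, and $\alpha,\beta>0$. For $0\le\eta\le1$ and $u\in(0,1)$ define $$B_\eta(u)=\ell^{-\frac{\alpha(1-\eta)}{p}+\frac{\beta\eta}{p'}}(u)\;\mathrm b\big(\ell^{\frac{\beta-\alpha}{p}-\beta}(u)\big),\qquad \phi(u)=\ell^{\frac{\beta-\alpha}{p}-\beta}(u).$$ Then the following hold for the grand and small Lebesgue spaces $L^{p),\alpha}=L^{p),\alpha}(\Omega)$ and $L^{(p,\beta}=L^{(p,\beta}(\Omega)$. a) If $0<\eta<\frac{\alpha}{\alpha-\beta+p\beta}$, then $\big(L^{p),\alpha},L^{(p,\beta}\big)_{\eta,\mathrm b,E}=L^{\mathcal R}_{p,B_\eta,\widehat E,1,L_p}$. b) If $\frac{\alpha}{\alpha-\beta+p\beta}<\eta<1$, then $\big(L^{p),\alpha},L^{(p,\beta}\big)_{\eta,\mathrm b,E}=L^{\mathcal L}_{p,B_\eta,\widehat E,1,L_p}$. c) If $\eta=\frac{\alpha}{\alpha-\beta+p\beta}$, then $\big(L^{p),\alpha},L^{(p,\beta}\big)_{\eta,\mathrm b,E}=L^{\mathcal L}_{p,B_\eta^{\#},\widehat E,\ell^{-\alpha/p}(u),L_p}$, where $B_\eta^{\#}(u)=\ell^{\eta(\frac{\alpha-\beta}{p}+\beta)}(u)\,\mathrm b\big(\ell^{\frac{\beta-\alpha}{p}-\beta}(u)\big)$,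 $u\in(0,1)$. d) If $\eta=0$, then $\big(L^{p),\alpha},L^{(p,\beta}\big)_{0,\mathrm b,E}=L^{\mathcal R}_{p,B_0,\widehat E,1,L_p}\cap L^{\mathcal R,\mathcal L}_{p,\mathrm b\circ\phi,\widehat E,\ell^{-\alpha/p}(u),L_\infty,1,L_p}$, where $B_0$ is $B_\eta$ with $\eta=0$. e) If $\eta=1$ and $\|\mathrm b\|_{\widetilde E(0,1)}<\infty$, then $\big(L^{p),\alpha},L^{(p,\beta}\big)_{1,\mathrm b,E}=L^{\mathcal L}_{p,B_1,\widehat E,1,L_p}\cap L^{\mathcal L,\mathcal R}_{p,\mathrm b\circ\phi,\widehat E,\ell^{\beta/p'-1}(u),L_1,1,L_p}$, where $B_1$ is $B_\eta$ with $\eta=1$.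
   Context: Notation. $\ell(t)=1+|\log t|$ and $\ell^{\sigma}(t)=(\ell(t))^{\sigma}$. $f\sim g$ means $C^{-1}g\le f\le Cg$ for some constant $C>0$; a function is almost increasing (decreasing) if it is equivalent to a non-decreasing (non-increasing) function. Equality of (quasi-)Banach spaces means equality as sets with equivalent (quasi-)norms. $\mathcal M(\Omega,\mu)$ is the set of measurable functions on $\Omega$ and $f^*$ is the non-increasing rearrangement of $f$. r.i. spaces. An r.i. space $E$ is a rearrangement invariant Banach function space (in the sense of Bennett and Sharpley, with the Fatou property) on $((0,\infty),dt)$. For measurable $f$ on $(0,1)$, $\|f\|_{\widetilde E(0,1)}=\|f(e^{-u})\|_E$ and $\|f\|_{\widehat E(0,1)}=\|f(e^{1-e^u})\|_E$ (as functions of $u>0$); these are the versions of $E$ on $(0,1)$ for the measures $\frac{dt}{t}$ and $\frac{dt}{t\ell(t)}$. For a subinterval $(c,d)\subset(0,1)$, $\|f\|_{\widetilde E(c,d)}=\|f\chi_{(c,d)}\|_{\widetilde E(0,1)}$. In particular $\|f\|_{\widetilde L_p(c,d)}=(\int_c^d|f(s)|^p\frac{ds}{s})^{1/p}$ and $\widetilde L_\infty=L_\infty$. Slowly varying functions. $\mathrm b\in SV(0,1)$ means that $\mathrm b$ is a positive Lebesgue measurable function such that for each $\varepsilon>0$ the function $t^{\varepsilon}\mathrm b(t)$ is almost increasing and $t^{-\varepsilon}\mathrm b(t)$ is almost decreasing on $(0,1)$. Real interpolation for ordered couples. For a couple $(Y_0,Y_1)$ of (quasi-)Banach spaces with $Y_1\hookrightarrow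 Y_0$, $K(t,f;Y_0,Y_1)=\inf\{\|f_0\|_{Y_0}+t\|f_1\|_{Y_1}:f=f_0+f_1,\ f_i\in Y_i\}$, and $(Y_0,Y_1)_{\eta,\mathrm b,E}$ is the space of all $f\in Y_0$ with $\|t^{-\eta}\mathrm b(t)K(t,f;Y_0,Y_1)\|_{\widetilde E(0,1)}<\infty$. Grand and small Lebesgue spaces. For $1<p<\infty$, $\alpha>0$: $L^{p),\alpha}$ is the set of $f\in\mathcal M(\Omega,\mu)$ with $$\|f\|_{p),\alpha}=\Big\|\ell^{-\frac{\alpha}{p}}(t)\|s^{1/p}f^*(s)\|_{\widetilde L_p(t,1)}\Big\|_{L_\infty(0,1)}<\infty,$$ and $L^{(p,\alpha}$ is the set of $f\in\mathcal M(\Omega,\mu)$ with $$\|f\|_{(p,\alpha}=\Big\|\ell^{\frac{\alpha}{p'}-1}(t)\|s^{1/p}f^*(s)\|_{\widetilde L_p(0,t)}\Big\|_{\widetilde L_1(0,1)}<\infty .$$ The couple $(L^{p),\alpha},L^{(p,\beta})$ is ordered: $L^{(p,\beta}\hookrightarrow L^{p),\alpha}$. The target spaces. For r.i. spaces $E,F,G$ and slowly varying functions $a,\mathrm b,c$ on $(0,1)$, the following are the sets of $f\in\mathcal M(\Omega,\mu)$ with finite indicated norm: - $L^{\mathcal R}_{p,\mathrm b,\widehat E,a,F}$: $\big\|\mathrm b(t)\|s^{1/p}a(s)f^*(s)\|_{\widetilde F(t,1)}\big\|_{\widehat E(0,1)}$; - $L^{\mathcal L}_{p,\mathrm b,\widehat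 E,a,F}$: $\big\|\mathrm b(t)\|s^{1/p}a(s)f^*(s)\|_{\widetilde F(0,t)}\big\|_{\widehat E(0,1)}$; - $L^{\mathcal R,\mathcal L}_{p,c,\widehat E,\mathrm b,F,a,G}$: $\Big\|c(u)\big\|\mathrm b(t)\|s^{1/p}a(s)f^*(s)\|_{\widetilde G(t,u)}\big\|_{\widetilde F(0,u)}\Big\|_{\widehat E(0,1)}$; - $L^{\mathcal L,\mathcal R}_{p,c,\widehat E,\mathrm b,F,a,G}$: $\Big\|c(u)\big\|\mathrm b(t)\|s^{1/p}a(s)f^*(s)\|_{\widetilde G(u,t)}\big\|_{\widetilde F(u,1)}\Big\|_{\widehat E(0,1)}$ (norms taken in $s$, $t$ and, where present, $u$, from inside out). In the claim, "$1$" denotes the constant function $1$, and a function such as $\ell^{-\alpha/p}(u)$ in a subscript denotes the function $u\mapsto\ell^{-\alpha/p}(u)$. *)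

theory Defs
  imports "HOL-Analysis.Analysis" "HOL-Probability.Essential_Supremum"
    "HOL-Probability.Probability_Measure"
begin

section \<open>Rearrangement invariant function norms on the half-line\<close>

abbreviation half_line :: "real measure" where
  "half_line \<equiv> lebesgue_on {0<..}"

text \<open>
  An r.i. space is represented by its function norm on nonnegative extended-valued functions,
  as in Bennett and Sharpley; the space itself consists of the measurable \<open>f\<close> with
  \<open>\<rho> \<bar>f\<bar> < \<infinity>\<close>. The fifth assumption is the Fatou property.
\<close>

locale banach_function_norm =
  fixes \<rho> :: "(real \<Rightarrow> ennreal) \<Rightarrow> ennreal"
  assumes norm_eq_0_iff:
    "f \<in> borel_measurable half_line \<Longrightarrow> \<rho> f = 0 \<longleftrightarrow> (AE u in half_line. f u = 0)"
  and norm_scale: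
    "f \<in> borel_measurable half_line \<Longrightarrow> (r::real) \<ge> 0 \<Longrightarrow>
      \<rho> (\<lambda>u. ennreal r * f u) = ennreal r * \<rho> f"
  and norm_triangle:
    "f \<in> borel_measurable half_line \<Longrightarrow> g \<in> borel_measurable half_line \<Longrightarrow>
      \<rho> (\<lambda>u. f u + g u) \<le> \<rho> f + \<rho> g"
  and norm_mono:
    "f \<in> borel_measurable half_line \<Longrightarrow> g \<in> borel_measurable half_line \<Longrightarrow>
      AE u in half_line. g u \<le> f u \<Longrightarrow> \<rho> g \<le> \<rho> f"
  and norm_Fatou:
    "(\<And>n::nat. F n \<in> borel_measurable half_line) \<Longrightarrow> f \<in> borel_measurable half_line \<Longrightarrow>
      (AE u in half_line. incseq (\<lambda>n. F n u) \<and> f u = (SUP n. F n u)) \<Longrightarrow>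
      \<rho> f = (SUP n. \<rho> (F n))"
  and norm_indicator_finite:
    "A \<in> sets half_line \<Longrightarrow> emeasure half_line A < \<infinity> \<Longrightarrow> \<rho> (indicator A) < \<infinity>"
  and norm_integral_bound:
    "A \<in> sets half_line \<Longrightarrow> emeasure half_line A < \<infinity> \<Longrightarrow>
      \<exists>C::real. C > 0 \<and> (\<forall>f \<in> borel_measurable half_line.
        (\<integral>\<^sup>+u. f u * indicator A u \<partial>half_line) \<le> ennreal C * \<rho> f)"

locale ri_function_norm = banach_function_norm +
  assumes rearrangement_invariant:
    "f \<in> borel_measurable half_line \<Longrightarrow> g \<in> borel_measurable half_line \<Longrightarrow>
      AE u in half_line. f u < \<infinity> \<Longrightarrow> AE u in half_line. g u < \<infinity> \<Longrightarrow>
      (\<And>r::real. r \<ge> 0 \<Longrightarrow>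
        emeasure half_line {u \<in> space half_line. f u > ennreal r} =
        emeasure half_line {u \<in> space half_line. g u > ennreal r}) \<Longrightarrow>
      \<rho> f = \<rho> g"

definition ennreal_powr :: "ennreal \<Rightarrow> real \<Rightarrow> ennreal" where
  "ennreal_powr x r = (if x = \<infinity> then \<infinity> else ennreal (enn2real x powr r))"

definition Lp_norm :: "real \<Rightarrow> (real \<Rightarrow> ennreal) \<Rightarrow> ennreal" where
  "Lp_norm p g = ennreal_powr (\<integral>\<^sup>+u. ennreal_powr (g u) p \<partial>half_line) (1 / p)"

definition Linf_norm :: "(real \<Rightarrow> ennreal) \<Rightarrow> ennreal" where
  "Linf_norm g = esssup half_line g"

text \<open>
  The versions of \<open>\<rho>\<close> on \<open>(0,1)\<close> for \<open>dt/t\<close> (restricted to a subinterval \<open>(c,d)\<close>)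
  and for \<open>dt/(t \<ell>(t))\<close>.
\<close>

definition tilde_norm ::
    "((real \<Rightarrow> ennreal) \<Rightarrow> ennreal) \<Rightarrow> real \<Rightarrow> real \<Rightarrow> (real \<Rightarrow> ennreal) \<Rightarrow> ennreal" where
  "tilde_norm \<rho> c d f = \<rho> (\<lambda>u. indicator {c<..<d} (exp (- u)) * f (exp (- u)))"

definition hat_norm :: "((real \<Rightarrow> ennreal) \<Rightarrow> ennreal) \<Rightarrow> (real \<Rightarrow> ennreal) \<Rightarrow> ennreal" where
  "hat_norm \<rho> f = \<rho> (\<lambda>u. f (exp (1 - exp u)))"

section \<open>Slowly varying functions\<close>

definition ell :: "real \<Rightarrow> real" where
  "ell t = 1 + \<bar>ln t\<bar>"

definition equivalent_on :: "real set \<Rightarrow> (real \<Rightarrow> real) \<Rightarrow> (real \<Rightarrow> real) \<Rightarrow> bool" where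
  "equivalent_on S f g \<longleftrightarrow> (\<exists>C>0. \<forall>t\<in>S. inverse C * g t \<le> f t \<and> f t \<le> C * g t)"

definition almost_increasing_on :: "real set \<Rightarrow> (real \<Rightarrow> real) \<Rightarrow> bool" where
  "almost_increasing_on S f \<longleftrightarrow> (\<exists>g. mono_on S g \<and> equivalent_on S f g)"

definition almost_decreasing_on :: "real set \<Rightarrow> (real \<Rightarrow> real) \<Rightarrow> bool" where
  "almost_decreasing_on S f \<longleftrightarrow> (\<exists>g. antimono_on S g \<and> equivalent_on S f g)"

definition slowly_varying :: "(real \<Rightarrow> real) \<Rightarrow> bool" where
  "slowly_varying b \<longleftrightarrow>
     (\<forall>t\<in>{0<..<1}. b t > 0) \<and> b \<in> borel_measurable (lebesgue_on {0<..<1}) \<and>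
     (\<forall>\<epsilon>>0. almost_increasing_on {0<..<1} (\<lambda>t. t powr \<epsilon> * b t) \<and>
            almost_decreasing_on {0<..<1} (\<lambda>t. t powr (- \<epsilon>) * b t))"

section \<open>Quasi-normed spaces of measurable functions and real interpolation\<close>

text \<open>
  A space of scalar-valued measurable functions on \<open>M\<close> is represented by an extended
  quasi-norm \<open>N\<close>; it consists of the measurable functions at which \<open>N\<close> is finite. The scalar
  type may be any \<^class>\<open>real_normed_field\<close>, so both real and complex scalars are covered.
  Functions are not quotiented by equality almost everywhere.
\<close>

definition fun_space ::
    "'a measure \<Rightarrow> (('a \<Rightarrow> 'k) \<Rightarrow> ennreal) \<Rightarrow> ('a \<Rightarrow> 'k::{real_normed_field, second_countable_topology}) set"
  where
  "fun_space M N = {f \<in> borel_measurable M. N f < \<infinity>}"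

definition same_space ::
    "'a measure \<Rightarrow> (('a \<Rightarrow> 'k::{real_normed_field, second_countable_topology}) \<Rightarrow> ennreal) \<Rightarrow>
      (('a \<Rightarrow> 'k) \<Rightarrow> ennreal) \<Rightarrow> bool"
  where
  "same_space M N1 N2 \<longleftrightarrow> fun_space M N1 = fun_space M N2 \<and>
     (\<exists>C::real. C > 0 \<and> (\<forall>f\<in>fun_space M N1. N1 f \<le> ennreal C * N2 f \<and> N2 f \<le> ennreal C * N1 f))"

definition inter_norm :: "('f \<Rightarrow> ennreal) \<Rightarrow> ('f \<Rightarrow> ennreal) \<Rightarrow> 'f \<Rightarrow> ennreal" where
  "inter_norm N1 N2 f = max (N1 f) (N2 f)"

lemma fun_space_inter_norm: "fun_space M (inter_norm N1 N2) = fun_space M N1 \<inter> fun_space M N2"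
  by (auto simp: fun_space_def inter_norm_def)

definition K_functional ::
    "'a measure \<Rightarrow> (('a \<Rightarrow> 'k::{real_normed_field, second_countable_topology}) \<Rightarrow> ennreal) \<Rightarrow>
      (('a \<Rightarrow> 'k) \<Rightarrow> ennreal) \<Rightarrow> real \<Rightarrow> ('a \<Rightarrow> 'k) \<Rightarrow> ennreal"
  where
  "K_functional M N0 N1 t f =
     Inf {N0 f0 + ennreal t * N1 f1 | f0 f1.
       f0 \<in> fun_space M N0 \<and> f1 \<in> fun_space M N1 \<and> (AE x in M. f x = f0 x + f1 x)}"

text \<open>The value \<open>\<infinity>\<close> off the larger space of the couple restricts the space to subsets of it.\<close>

definition interpolation_norm ::
    "'a measure \<Rightarrow> (('a \<Rightarrow> 'k::{real_normed_field, second_countable_topology}) \<Rightarrow> ennreal) \<Rightarrow>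
      (('a \<Rightarrow> 'k) \<Rightarrow> ennreal) \<Rightarrow> real \<Rightarrow> (real \<Rightarrow> real) \<Rightarrow> ((real \<Rightarrow> ennreal) \<Rightarrow> ennreal) \<Rightarrow>
      ('a \<Rightarrow> 'k) \<Rightarrow> ennreal"
  where
  "interpolation_norm M N0 N1 \<eta> b E f =
     (if f \<in> fun_space M N0
      then tilde_norm E 0 1 (\<lambda>t. ennreal (t powr (- \<eta>) * b t) * K_functional M N0 N1 t f)
      else \<infinity>)"

section \<open>Rearrangements, grand and small Lebesgue spaces, target spaces\<close>

definition rearrangement ::
    "'a measure \<Rightarrow> ('a \<Rightarrow> 'k::{real_normed_field, second_countable_topology}) \<Rightarrow> real \<Rightarrow> ennreal"
  where
  "rearrangement M f t =
     Inf {ennreal r | r. r \<ge> 0 \<and> emeasure M {x \<in> space M. norm (f x) > r} \<le> ennreal t}"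

definition weighted_rearr ::
    "'a measure \<Rightarrow> real \<Rightarrow> (real \<Rightarrow> real) \<Rightarrow>
      ('a \<Rightarrow> 'k::{real_normed_field, second_countable_topology}) \<Rightarrow> real \<Rightarrow> ennreal"
  where
  "weighted_rearr M p a f s = ennreal (s powr (1 / p) * a s) * rearrangement M f s"

definition conjugate_exponent :: "real \<Rightarrow> real" where
  "conjugate_exponent p = p / (p - 1)"

definition grand_norm ::
    "'a measure \<Rightarrow> real \<Rightarrow> real \<Rightarrow> ('a \<Rightarrow> 'k::{real_normed_field, second_countable_topology}) \<Rightarrow> ennreal"
  where
  "grand_norm M p \<alpha> f =
     tilde_norm Linf_norm 0 1 (\<lambda>t. ennreal (ell t powr (- \<alpha> / p)) *
       tilde_norm (Lp_norm p) t 1 (weighted_rearr M p (\<lambda>_. 1) f))"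

definition small_norm ::
    "'a measure \<Rightarrow> real \<Rightarrow> real \<Rightarrow> ('a \<Rightarrow> 'k::{real_normed_field, second_countable_topology}) \<Rightarrow> ennreal"
  where
  "small_norm M p \<alpha> f =
     tilde_norm (Lp_norm 1) 0 1 (\<lambda>t. ennreal (ell t powr (\<alpha> / conjugate_exponent p - 1)) *
       tilde_norm (Lp_norm p) 0 t (weighted_rearr M p (\<lambda>_. 1) f))"

definition R_norm ::
    "'a measure \<Rightarrow> real \<Rightarrow> (real \<Rightarrow> real) \<Rightarrow> ((real \<Rightarrow> ennreal) \<Rightarrow> ennreal) \<Rightarrow>
      (real \<Rightarrow> real) \<Rightarrow> ((real \<Rightarrow> ennreal) \<Rightarrow> ennreal) \<Rightarrow>
      ('a \<Rightarrow> 'k::{real_normed_field, second_countable_topology}) \<Rightarrow> ennreal"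
  where
  "R_norm M p b E a F f =
     hat_norm E (\<lambda>t. ennreal (b t) * tilde_norm F t 1 (weighted_rearr M p a f))"

definition L_norm ::
    "'a measure \<Rightarrow> real \<Rightarrow> (real \<Rightarrow> real) \<Rightarrow> ((real \<Rightarrow> ennreal) \<Rightarrow> ennreal) \<Rightarrow>
      (real \<Rightarrow> real) \<Rightarrow> ((real \<Rightarrow> ennreal) \<Rightarrow> ennreal) \<Rightarrow>
      ('a \<Rightarrow> 'k::{real_normed_field, second_countable_topology}) \<Rightarrow> ennreal"
  where
  "L_norm M p b E a F f =
     hat_norm E (\<lambda>t. ennreal (b t) * tilde_norm F 0 t (weighted_rearr M p a f))"

definition RL_norm ::
    "'a measure \<Rightarrow> real \<Rightarrow> (real \<Rightarrow> real) \<Rightarrow> ((real \<Rightarrow> ennreal) \<Rightarrow> ennreal) \<Rightarrow>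
      (real \<Rightarrow> real) \<Rightarrow> ((real \<Rightarrow> ennreal) \<Rightarrow> ennreal) \<Rightarrow>
      (real \<Rightarrow> real) \<Rightarrow> ((real \<Rightarrow> ennreal) \<Rightarrow> ennreal) \<Rightarrow>
      ('a \<Rightarrow> 'k::{real_normed_field, second_countable_topology}) \<Rightarrow> ennreal"
  where
  "RL_norm M p c E b F a G f =
     hat_norm E (\<lambda>u. ennreal (c u) * tilde_norm F 0 u (\<lambda>t. ennreal (b t) *
       tilde_norm G t u (weighted_rearr M p a f)))"

definition LR_norm ::
    "'a measure \<Rightarrow> real \<Rightarrow> (real \<Rightarrow> real) \<Rightarrow> ((real \<Rightarrow> ennreal) \<Rightarrow> ennreal) \<Rightarrow>
      (real \<Rightarrow> real) \<Rightarrow> ((real \<Rightarrow> ennreal) \<Rightarrow> ennreal) \<Rightarrow>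
      (real \<Rightarrow> real) \<Rightarrow> ((real \<Rightarrow> ennreal) \<Rightarrow> ennreal) \<Rightarrow>
      ('a \<Rightarrow> 'k::{real_normed_field, second_countable_topology}) \<Rightarrow> ennreal"
  where
  "LR_norm M p c E b F a G f =
     hat_norm E (\<lambda>u. ennreal (c u) * tilde_norm F u 1 (\<lambda>t. ennreal (b t) *
       tilde_norm G u t (weighted_rearr M p a f)))"

definition phi :: "real \<Rightarrow> real \<Rightarrow> real \<Rightarrow> real \<Rightarrow> real" where
  "phi p \<alpha> \<beta> u = ell u powr ((\<beta> - \<alpha>) / p - \<beta>)"

definition B_weight :: "real \<Rightarrow> real \<Rightarrow> real \<Rightarrow> (real \<Rightarrow> real) \<Rightarrow> real \<Rightarrow> real \<Rightarrow> real" where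
  "B_weight p \<alpha> \<beta> b \<eta> u =
     ell u powr (- (\<alpha> * (1 - \<eta>) / p) + \<beta> * \<eta> / conjugate_exponent p) *
     b (ell u powr ((\<beta> - \<alpha>) / p - \<beta>))"

definition B_sharp_weight :: "real \<Rightarrow> real \<Rightarrow> real \<Rightarrow> (real \<Rightarrow> real) \<Rightarrow> real \<Rightarrow> real \<Rightarrow> real" where
  "B_sharp_weight p \<alpha> \<beta> b \<eta> u =
     ell u powr (\<eta> * ((\<alpha> - \<beta>) / p + \<beta>)) * b (ell u powr ((\<beta> - \<alpha>) / p - \<beta>))"

end

theory Submission
  imports Defs
begin

text \<open>
  For a measurable function \<open>f\<close> put \<open>F u = f^*(e^(-u))\<close>, a
  nondecreasing function of \<open>u\<close>, and write \<open>a = \<alpha> / p\<close>,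
  \<open>c = \<beta> / p'\<close>, \<open>\<gamma> = a + c\<close>. Since \<open>\<ell>(e^(-u))
  = 1 + u\<close>, all norms of the statement become expressions in the weighted content
  \<open>N(S) = (\<integral>\<^sub>S e^(-u) F(u)^p du)^(1/p)\<close> of sets \<open>S\<close>,
  and a further substitution \<open>1 + u = e^y\<close> turns the norm \<open>\<hat>E\<close>
  into the norm of \<open>E\<close> in the variable \<open>y\<close>. Up to a dilation of
  \<open>(0, \<infinity>)\<close>, which is bounded on every rearrangement invariant space, the
  interpolation norm is the \<open>E\<close>-norm of \<open>\<omega>(y) K(e^(-\<gamma>y),
  f)\<close> with \<open>\<omega>(y) = e^(\<eta>\<gamma>y) b(e^(-\<gamma>y))\<close>.

  The K-functional is computed in \<open>K_functional_le\<close> and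
  \<open>K_functional_ge\<close>: with \<open>1 + x = e^y\<close>, \<open>K(e^(-\<gamma>y),
  f)\<close> is equivalent to \<open>A(y) + D(y)\<close>, where \<open>A(y)\<close>, the
  supremum of \<open>(1 + z)^(-a) N(x, z)\<close> over \<open>z > x\<close>, is essentially the
  grand norm of the part of \<open>f\<close> above the level \<open>F x\<close> and \<open>D(y)
  = e^(-\<gamma>y) \<integral> (1 + z)^(c-1) N(z, x) dz\<close> over \<open>0 < z < x\<close>
  is, up to a term controlled by \<open>A(y)\<close>, the small norm of the part below it,
  multiplied by \<open>e^(-\<gamma>y)\<close>. The upper bound truncates \<open>f\<close> at the
  level \<open>F x\<close>; the lower bound uses that the rearrangement of a sum at
  \<open>s\<close> is at most the sum of the rearrangements at \<open>s / 2\<close>, and halving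
  \<open>s\<close> is a bounded translation of \<open>u\<close>.

  Everything is then compared with the block function \<open>P(y) = e^(-ay) N(\<bar>ln (1 + u) -
  y\<bar> < 1)\<close>, the content of one block of length two in the variable in which
  \<open>E\<close> acts. Covering an interval by such blocks and using that \<open>N\<close> is
  countably subadditive bounds \<open>A\<close>, \<open>D\<close> and the integrands of the
  target norms by sums \<open>\<Sum>\<^sub>k e^(sk) P(y + k)\<close> or \<open>\<Sum>\<^sub>k
  e^(-sk) P(y - k)\<close>. Because \<open>\<omega>\<close> grows like
  \<open>e^(\<eta>\<gamma>y)\<close> up to a slowly varying factor and translations are
  contractions on \<open>E\<close>, the weighted norm of the first sum is bounded by that of
  \<open>P\<close> if \<open>s < \<eta>\<gamma>\<close>, and that of the second if \<open>s >
  \<eta>\<gamma>\<close> (\<open>norm_weighted_forward\<close>,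
  \<open>norm_weighted_backward\<close>). In the other direction \<open>P\<close> is bounded by
  a translate of \<open>A\<close>. The content of \<open>(0, x)\<close> is controlled by
  \<open>P\<close> when \<open>\<eta>\<gamma> < a\<close>, that of \<open>(x,
  \<infinity>)\<close> when \<open>\<eta>\<gamma> > a\<close>, and its weighted version when
  \<open>\<eta>\<gamma> > 0\<close>; as \<open>\<eta>\<gamma> = a\<close> is the critical value
  \<open>\<eta> = \<alpha> / (\<alpha> - \<beta> + p\<beta>)\<close>, these are the cases of the
  theorem. For \<open>\<eta> = 0\<close> the sum bounding \<open>A\<close> has no decay, for
  \<open>\<eta> = 1\<close> the one bounding \<open>D\<close> has none, so \<open>A\<close> or
  \<open>D\<close> itself remains in the norm: this is the second member of the intersections.
\<close>

section \<open>Powers of extended nonnegative reals\<close>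

lemma ennreal_powr_top [simp]: "ennreal_powr \<infinity> r = \<infinity>" "ennreal_powr top r = top"
  by (auto simp: ennreal_powr_def)

lemma ennreal_powr_0 [simp]: "ennreal_powr 0 r = 0"
  by (simp add: ennreal_powr_def)

lemma ennreal_powr_ennreal: "x \<ge> 0 \<Longrightarrow> ennreal_powr (ennreal x) r = ennreal (x powr r)"
  by (simp add: ennreal_powr_def)

lemma ennreal_powr_one [simp]: "ennreal_powr x 1 = x"
  by (cases x) (auto simp: ennreal_powr_ennreal)

lemma ennreal_powr_mono: "x \<le> y \<Longrightarrow> 0 \<le> r \<Longrightarrow> ennreal_powr x r \<le> ennreal_powr y r"
  by (cases x; cases y) (auto simp: ennreal_powr_ennreal powr_mono2 top_unique)

lemma ennreal_powr_mult: "ennreal_powr (x * y) r = ennreal_powr x r * ennreal_powr y r"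
proof (cases "x = 0 \<or> y = 0")
  case True
  then show ?thesis by auto
next
  case False
  then show ?thesis
    by (cases x; cases y)
      (auto simp: ennreal_powr_ennreal powr_mult ennreal_mult[symmetric] ennreal_mult_top
          ennreal_top_mult)
qed

lemma ennreal_powr_powr: "ennreal_powr (ennreal_powr x r) s = ennreal_powr x (r * s)"
  by (cases x) (auto simp: ennreal_powr_ennreal powr_powr)

lemma ennreal_powr_add_exp:
  "x < \<infinity> \<Longrightarrow> ennreal_powr x (r + s) = ennreal_powr x r * ennreal_powr x s"
  by (cases x) (auto simp: ennreal_powr_ennreal powr_add ennreal_mult[symmetric])

lemma borel_measurable_ennreal_powr [measurable (raw)]:
  assumes [measurable]: "g \<in> borel_measurable M"
  shows "(\<lambda>x. ennreal_powr (g x) r) \<in> borel_measurable M"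
  unfolding ennreal_powr_def by measurable

text \<open>
  With \<open>S\<close> the right-hand side, every term obeys \<open>x\<^sub>k = y\<^sub>k^p
  \<le> y\<^sub>k S^(p-1)\<close> for \<open>y\<^sub>k = x\<^sub>k^(1/p)\<close>; summing gives
  \<open>\<Sum> x\<^sub>k \<le> S^p\<close>.
\<close>

lemma ennreal_powr_suminf_le:
  fixes x :: "nat \<Rightarrow> ennreal"
  assumes "p \<ge> 1"
  shows "ennreal_powr (\<Sum>k. x k) (1 / p) \<le> (\<Sum>k. ennreal_powr (x k) (1 / p))"
proof (cases "(\<Sum>k. ennreal_powr (x k) (1 / p)) = \<infinity>")
  case False
  define S where "S = (\<Sum>k. ennreal_powr (x k) (1 / p))"
  have S: "S < \<infinity>"
    using False by (simp add: S_def less_top)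
  have le: "ennreal_powr (x k) (1 / p) \<le> S" for k
    unfolding S_def using sum_le_suminf[of "\<lambda>k. ennreal_powr (x k) (1 / p)" "{k}"] by simp
  have "x k \<le> ennreal_powr (x k) (1 / p) * ennreal_powr S (p - 1)" for k
  proof -
    have "x k = ennreal_powr (ennreal_powr (x k) (1 / p)) (1 + (p - 1))"
      using assms by (simp add: ennreal_powr_powr)
    also have "\<dots> = ennreal_powr (x k) (1 / p) * ennreal_powr (ennreal_powr (x k) (1 / p)) (p - 1)"
      using le[of k] S by (subst ennreal_powr_add_exp) auto
    also have "\<dots> \<le> ennreal_powr (x k) (1 / p) * ennreal_powr S (p - 1)"
      using assms by (intro mult_left_mono ennreal_powr_mono le) auto
    finally show ?thesis .
  qed
  then have "(\<Sum>k. x k) \<le> (\<Sum>k. ennreal_powr (x k) (1 / p) * ennreal_powr S (p - 1))"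
    by (intro suminf_le) auto
  also have "\<dots> = S * ennreal_powr S (p - 1)"
    by (simp add: S_def)
  also have "\<dots> = ennreal_powr S p"
    using ennreal_powr_add_exp[OF S, of 1 "p - 1"] by simp
  finally have "ennreal_powr (\<Sum>k. x k) (1 / p) \<le> ennreal_powr (ennreal_powr S p) (1 / p)"
    using assms by (intro ennreal_powr_mono) auto
  also have "\<dots> = S"
    using assms by (simp add: ennreal_powr_powr)
  finally show ?thesis
    by (simp add: S_def)
qed simp

lemma ennreal_powr_add_le:
  assumes "p \<ge> 1"
  shows "ennreal_powr (x + y) (1 / p) \<le> ennreal_powr x (1 / p) + ennreal_powr y (1 / p)"
proof -
  define z where "z k = (if k = 0 then x else if k = 1 then y else 0)" for k :: nat
  have "(\<Sum>k. ennreal_powr (z k) r) = (\<Sum>k\<in>{0,1}. ennreal_powr (z k) r)" for r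
    by (rule suminf_finite) (auto simp: z_def)
  moreover have "(\<Sum>k. z k) = (\<Sum>k\<in>{0,1}. z k)"
    by (rule suminf_finite) (auto simp: z_def)
  ultimately show ?thesis
    using ennreal_powr_suminf_le[OF assms, of z] by (simp add: z_def)
qed

lemma ennreal_powr_add_le_convex:
  assumes "p \<ge> 0"
  shows "ennreal_powr (x + y) p \<le> ennreal (2 powr p) * (ennreal_powr x p + ennreal_powr y p)"
proof -
  have "x + y \<le> 2 * max x y"
    by (metis add_mono max.cobounded1 max.cobounded2 mult_2)
  then have "ennreal_powr (x + y) p \<le> ennreal_powr (ennreal 2 * max x y) p"
    using assms by (intro ennreal_powr_mono) auto
  also have "\<dots> = ennreal (2 powr p) * ennreal_powr (max x y) p"
    using ennreal_powr_ennreal[of 2 p] by (simp add: ennreal_powr_mult)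
  also have "\<dots> \<le> ennreal (2 powr p) * (ennreal_powr x p + ennreal_powr y p)"
    by (intro mult_left_mono) (auto simp: max_def)
  finally show ?thesis .
qed

section \<open>Measurability\<close>

lemma borel_measurable_mono_ennreal:
  fixes f :: "real \<Rightarrow> ennreal"
  assumes "mono f"
  shows "f \<in> borel_measurable borel"
proof (rule borel_measurableI_greater)
  fix y
  have "is_interval {x. y < f x}"
    unfolding is_interval_1 using assms
    by (auto simp: mono_def) (meson less_le_trans)
  then show "{x \<in> space borel. y < f x} \<in> sets borel"
    using real_interval_borel_measurable by simp
qed

lemma borel_measurable_antimono_ennreal:
  fixes f :: "real \<Rightarrow> ennreal"
  assumes "antimono f"
  shows "f \<in> borel_measurable borel"
proof -
  have "mono (\<lambda>x. f (- x))"
    using assms by (auto simp: mono_def antimono_def)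
  then have [measurable]: "(\<lambda>x. f (- x)) \<in> borel_measurable borel"
    by (rule borel_measurable_mono_ennreal)
  have "(\<lambda>x. (\<lambda>x. f (- x)) (- x)) \<in> borel_measurable borel"
    by measurable
  then show ?thesis
    by simp
qed

lemma space_half_line [simp]: "space half_line = {0<..}"
  by simp

lemma AE_half_line_I: "(\<And>u. u > 0 \<Longrightarrow> P u) \<Longrightarrow> AE u in half_line. P u"
  by (rule AE_I2) simp

lemma borel_measurable_half_line: "f \<in> borel_measurable borel \<Longrightarrow> f \<in> borel_measurable half_line"
  by (intro measurable_restrict_space1 measurable_completion) simp

lemma emeasure_half_line: "A \<subseteq> {0<..} \<Longrightarrow> emeasure half_line A = emeasure lebesgue A"
  by (subst emeasure_restrict_space) auto

lemma sets_half_line: "A \<in> sets half_line \<longleftrightarrow> A \<in> sets lebesgue \<and> A \<subseteq> {0<..}"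
  by (subst sets_restrict_space_iff) auto

lemma half_line_Collect_sets:
  fixes f :: "real \<Rightarrow> 'b::topological_space"
  assumes "f \<in> borel_measurable half_line" "U \<in> sets borel"
  shows "{u. 0 < u \<and> f u \<in> U} \<in> sets lebesgue"
proof -
  have "f -` U \<inter> space half_line \<in> sets half_line"
    using assms by (rule measurable_sets)
  moreover have "f -` U \<inter> space half_line = {u. 0 < u \<and> f u \<in> U}"
    by auto
  ultimately show ?thesis
    by (simp add: sets_half_line)
qed

lemma nn_integral_half_line:
  assumes [measurable]: "f \<in> borel_measurable borel"
  shows "(\<integral>\<^sup>+u. f u \<partial>half_line) = (\<integral>\<^sup>+u\<in>{0<..}. f u \<partial>lborel)"
  by (subst nn_integral_restrict_space) (auto simp: nn_integral_completion)

text \<open>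
  Lebesgue measurability is not preserved by composition with a Borel function, so the change of
  variables is assumed to have a differentiable inverse, which maps null sets to null sets.
\<close>

lemma lebesgue_on_measurable_comp:
  fixes h k :: "real \<Rightarrow> real" and f :: "real \<Rightarrow> 'b::topological_space"
  assumes f: "f \<in> borel_measurable (lebesgue_on T)"
    and S: "S \<in> sets lebesgue" and T: "T \<in> sets lebesgue"
    and k: "k differentiable_on T"
    and hk: "\<And>x. x \<in> S \<Longrightarrow> h x \<in> T \<and> k (h x) = x" "\<And>t. t \<in> T \<Longrightarrow> k t \<in> S \<and> h (k t) = t"
  shows "(\<lambda>x. f (h x)) \<in> borel_measurable (lebesgue_on S)"
proof (rule measurableI)
  fix U :: "'b set" assume U: "U \<in> sets borel"
  have "f -` U \<inter> space (lebesgue_on T) \<in> sets (lebesgue_on T)"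
    using f U by (rule measurable_sets)
  then have "T \<inter> f -` U \<in> sets lebesgue"
    using T by (auto simp: sets_restrict_space_iff Int_commute)
  then have "k ` (T \<inter> f -` U) \<in> sets lebesgue"
    by (rule differentiable_image_in_sets_lebesgue) (auto intro: differentiable_on_subset[OF k])
  moreover have "k ` (T \<inter> f -` U) = (\<lambda>x. f (h x)) -` U \<inter> space (lebesgue_on S)"
    using hk by (force simp: image_iff)
  ultimately show "(\<lambda>x. f (h x)) -` U \<inter> space (lebesgue_on S) \<in> sets (lebesgue_on S)"
    using S by (auto simp: sets_restrict_space_iff)
qed auto

section \<open>Translations and dilations in rearrangement invariant spaces\<close>

context banach_function_norm
begin

lemma norm_le:
  assumes "f \<in> borel_measurable half_line" "g \<in> borel_measurable half_line"
    and "\<And>u. u > 0 \<Longrightarrow> g u \<le> f u"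
  shows "\<rho> g \<le> \<rho> f"
  using assms by (intro norm_mono AE_half_line_I)

lemma norm_cong:
  assumes "f \<in> borel_measurable half_line" "g \<in> borel_measurable half_line"
    and "\<And>u. u > 0 \<Longrightarrow> g u = f u"
  shows "\<rho> g = \<rho> f"
  using assms by (intro antisym norm_le) auto

lemma norm_zero: "\<rho> (\<lambda>_. 0) = 0"
  by (subst norm_eq_0_iff) auto

text \<open>
  Membership in the space implies integrability over bounded intervals.
\<close>

lemma norm_finite_AE:
  assumes [measurable]: "f \<in> borel_measurable half_line" and fin: "\<rho> f < \<infinity>"
  shows "AE u in half_line. f u < \<infinity>"
proof -
  have "AE u in half_line. f u * indicator {0<..<real n} u \<noteq> \<infinity>" for n
  proof (rule nn_integral_noteq_infinite)
    have A: "{0<..<real n} \<in> sets half_line"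
      by (auto simp: sets_half_line)
    then show "(\<lambda>u. f u * indicator {0<..<real n} u) \<in> borel_measurable half_line"
      by measurable
    have "emeasure half_line {0<..<real n} < \<infinity>"
      by (subst emeasure_half_line) auto
    from norm_integral_bound[OF A this] obtain C :: real where
      "(\<integral>\<^sup>+u. f u * indicator {0<..<real n} u \<partial>half_line) \<le> ennreal C * \<rho> f"
      using assms(1) by blast
    also have "\<dots> < \<infinity>"
      using fin by (simp add: ennreal_mult_less_top)
    finally show "(\<integral>\<^sup>+u. f u * indicator {0<..<real n} u \<partial>half_line) \<noteq> \<infinity>"
      by simp
  qed
  then have "AE u in half_line. \<forall>n. f u * indicator {0<..<real n} u \<noteq> \<infinity>"
    by (simp add: AE_all_countable)
  moreover have "AE u in half_line. 0 < u"
    by (rule AE_half_line_I)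
  ultimately show ?thesis
  proof eventually_elim
    case (elim u)
    obtain n where "u < real n"
      using reals_Archimedean2 by blast
    then have "f u \<noteq> \<infinity>"
      using elim(1)[rule_format, of n] elim(2) by simp
    then show ?case
      by (simp add: less_top)
  qed
qed

lemma norm_sum:
  assumes "finite I" "\<And>i. i \<in> I \<Longrightarrow> F i \<in> borel_measurable half_line"
  shows "\<rho> (\<lambda>u. \<Sum>i\<in>I. F i u) \<le> (\<Sum>i\<in>I. \<rho> (F i))"
  using assms
proof (induction I rule: finite_induct)
  case empty
  then show ?case by (simp add: norm_zero)
next
  case (insert x I)
  have "\<rho> (\<lambda>u. F x u + (\<Sum>i\<in>I. F i u)) \<le> \<rho> (F x) + \<rho> (\<lambda>u. \<Sum>i\<in>I. F i u)"
    using insert by (intro norm_triangle borel_measurable_sum) auto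
  also have "\<dots> \<le> \<rho> (F x) + (\<Sum>i\<in>I. \<rho> (F i))"
    using insert by (intro add_left_mono) auto
  finally show ?case
    using insert by simp
qed

text \<open>
  The Fatou property turns finite into countable subadditivity.
\<close>

lemma norm_suminf:
  fixes F :: "nat \<Rightarrow> real \<Rightarrow> ennreal"
  assumes [measurable]: "\<And>i. F i \<in> borel_measurable half_line"
  shows "\<rho> (\<lambda>u. \<Sum>i. F i u) \<le> (\<Sum>i. \<rho> (F i))"
proof -
  have "\<rho> (\<lambda>u. \<Sum>i. F i u) = (SUP n. \<rho> (\<lambda>u. \<Sum>i<n. F i u))"
    by (intro norm_Fatou)
      (auto simp: suminf_eq_SUP incseq_def intro!: sum_mono2)
  also have "\<dots> \<le> (\<Sum>i. \<rho> (F i))"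
    by (intro SUP_least order_trans[OF norm_sum] sum_le_suminf) auto
  finally show ?thesis .
qed

end

lemma emeasure_affine_image:
  "emeasure lebesgue ((\<lambda>v. m * v + d) ` A) = ennreal \<bar>m\<bar> * emeasure lebesgue A" for m d :: real
  using emeasure_lebesgue_affine[of m d A] by simp

lemma sets_affine_image:
  "A \<in> sets lebesgue \<Longrightarrow> (\<lambda>v. m * v + d) ` A \<in> sets lebesgue" for m d :: real
  by (rule differentiable_image_in_sets_lebesgue)
    (auto intro!: differentiable_on_add differentiable_on_mult)

text \<open>
  The copy of \<open>f\<close> in which the piece of the graph over \<open>(k, k + 1]\<close> is
  squeezed or stretched onto the interval \<open>(ck + ofs, ck + ofs + d]\<close>. Its
  distribution function is \<open>d\<close> times that of \<open>f\<close>, and copies with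
  different offsets can be placed side by side. Intervals closed on the right keep the point
  \<open>0\<close>, which is not in the half-line, from being an argument of \<open>f\<close>.
\<close>

definition spread :: "real \<Rightarrow> real \<Rightarrow> real \<Rightarrow> (real \<Rightarrow> ennreal) \<Rightarrow> real \<Rightarrow> ennreal" where
  "spread c d ofs f u =
    (let k = real_of_int (\<lceil>u / c\<rceil> - 1); s = u - c * k - ofs
     in if 0 < s \<and> s \<le> d then f (k + s / d) else 0)"

text \<open>
  The level set of the spread copy is the disjoint union over \<open>k\<close> of affine images,
  with slope \<open>d\<close>, of the pieces of the level set of \<open>f\<close> in \<open>(k,
  k + 1]\<close>. The value \<open>0\<close> is excluded from \<open>U\<close> because the copy
  is \<open>0\<close> outside the chosen intervals.
\<close>

lemma spread_level_sets:
  assumes f: "f \<in> borel_measurable half_line" and U: "U \<in> sets borel" "0 \<notin> U"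
    and cd: "0 < d" "0 \<le> ofs" "ofs + d \<le> c"
  shows "{u. 0 < u \<and> spread c d ofs f u \<in> U} \<in> sets lebesgue" (is "?S \<in> _")
    and "emeasure lebesgue {u. 0 < u \<and> spread c d ofs f u \<in> U} =
         ennreal d * emeasure lebesgue {u. 0 < u \<and> f u \<in> U}"
proof -
  define L where "L = {u. 0 < u \<and> f u \<in> U}"
  define P where "P n = L \<inter> {real n<..real n + 1}" for n :: nat
  define T where "T n v = d * v + (c * real n + ofs - d * real n)" for n :: nat and v :: real
  have L: "L \<in> sets lebesgue"
    unfolding L_def using f U(1) by (rule half_line_Collect_sets)
  have P: "P n \<in> sets lebesgue" for n
    unfolding P_def using L by auto
  have c: "c > 0"
    using cd by auto
  have index: "\<lceil>u / c\<rceil> - 1 = int n" if "c * real n < u" "u \<le> c * real n + c" for u n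
  proof -
    have "\<lceil>u / c\<rceil> = int n + 1"
      using that c by (intro ceiling_unique) (auto simp: field_simps)
    then show ?thesis by simp
  qed
  have T_range: "c * real n + ofs < T n v \<and> T n v \<le> c * real n + ofs + d" if "v \<in> P n" for n v
  proof -
    have "d * real n < d * v" "d * v \<le> d * (real n + 1)"
      using that cd by (auto simp: P_def)
    then show ?thesis
      by (auto simp: T_def algebra_simps)
  qed
  have "?S = (\<Union>n. T n ` P n)"
  proof (intro equalityI subsetI)
    fix u assume u: "u \<in> ?S"
    define k where "k = real_of_int (\<lceil>u / c\<rceil> - 1)"
    define s where "s = u - c * k - ofs"
    have s: "0 < s" "s \<le> d" "f (k + s / d) \<in> U"
      using u U(2) by (auto simp: spread_def Let_def k_def s_def split: if_splits)
    have "u / c > 0"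
      using u c by simp
    then have "0 \<le> \<lceil>u / c\<rceil> - 1"
      by simp
    then obtain n where "\<lceil>u / c\<rceil> - 1 = int n"
      using zero_le_imp_eq_int by blast
    then have n: "k = real n"
      by (simp add: k_def)
    have "k + s / d \<in> P n"
      using s cd n by (auto simp: P_def L_def add_nonneg_pos)
    moreover have "u = T n (k + s / d)"
      using cd n by (simp add: T_def s_def field_simps)
    ultimately show "u \<in> (\<Union>n. T n ` P n)"
      by blast
  next
    fix u assume "u \<in> (\<Union>n. T n ` P n)"
    then obtain n v where v: "v \<in> P n" "u = T n v"
      by auto
    have r: "c * real n + ofs < u" "u \<le> c * real n + ofs + d"
      using T_range[OF v(1)] v(2) by auto
    have k: "\<lceil>u / c\<rceil> - 1 = int n"
      using r cd by (intro index) auto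
    have "real n + (u - c * real n - ofs) / d = v"
      using cd by (simp add: v(2) T_def field_simps)
    then have "spread c d ofs f u = f v"
      using r by (simp add: spread_def k Let_def)
    moreover have "0 \<le> c * real n"
      using c by simp
    then have "u > 0"
      using r(1) cd by linarith
    ultimately show "u \<in> ?S"
      using v(1) by (simp add: P_def L_def)
  qed
  note eq = this
  have Tset: "T n ` P n \<in> sets lebesgue" for n
    unfolding T_def using P by (rule sets_affine_image)
  then show "?S \<in> sets lebesgue"
    unfolding eq by auto
  have "disjoint_family (\<lambda>n. T n ` P n)"
    unfolding disjoint_family_on_def
  proof safe
    fix m n u v w assume *: "m \<noteq> n" "v \<in> P m" "w \<in> P n" "T m v = T n w"
    then have "int m = int n"
      using T_range[OF *(2)] T_range[OF *(3)] cd index[of m "T m v"] index[of n "T n w"] by auto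
    then show "T m v \<in> {}"
      using * by simp
  qed
  then have "emeasure lebesgue ?S = (\<Sum>n. emeasure lebesgue (T n ` P n))"
    unfolding eq using Tset by (intro suminf_emeasure[symmetric]) auto
  also have "\<dots> = (\<Sum>n. ennreal d * emeasure lebesgue (P n))"
    using cd by (simp add: T_def[abs_def] emeasure_affine_image)
  also have "\<dots> = ennreal d * (\<Sum>n. emeasure lebesgue (P n))"
    by simp
  also have "(\<Sum>n. emeasure lebesgue (P n)) = emeasure lebesgue (\<Union>n. P n)"
  proof (rule suminf_emeasure)
    show "range P \<subseteq> sets lebesgue"
      using P by auto
    show "disjoint_family P"
      unfolding disjoint_family_on_def
    proof safe
      fix m n :: nat and v assume *: "m \<noteq> n" "v \<in> P m" "v \<in> P n"
      then have "real m < real n + 1" "real n < real m + 1"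
        by (auto simp: P_def)
      then have "m = n"
        by linarith
      then show "v \<in> {}"
        using * by simp
    qed
  qed
  also have "(\<Union>n. P n) = L"
  proof (intro equalityI subsetI)
    fix v assume v: "v \<in> L"
    then have "v > 0"
      by (simp add: L_def)
    define n where "n = nat (\<lceil>v\<rceil> - 1)"
    have "real n = real_of_int (\<lceil>v\<rceil> - 1)"
      using \<open>v > 0\<close> by (simp add: n_def)
    then have "v \<in> P n"
      using v by (simp add: P_def) linarith
    then show "v \<in> (\<Union>n. P n)"
      by auto
  qed (auto simp: P_def)
  finally show "emeasure lebesgue ?S = ennreal d * emeasure lebesgue {u. 0 < u \<and> f u \<in> U}"
    by (simp add: L_def)
qed

lemma borel_measurable_half_lineI:
  fixes g :: "real \<Rightarrow> ennreal"
  assumes "\<And>U. U \<in> sets borel \<Longrightarrow> 0 \<notin> U \<Longrightarrow> {u. 0 < u \<and> g u \<in> U} \<in> sets lebesgue"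
  shows "g \<in> borel_measurable half_line"
proof (rule borel_measurableI_greater)
  fix y
  have "{u. 0 < u \<and> g u \<in> {y<..}} \<in> sets lebesgue"
    by (rule assms) auto
  moreover have "{x \<in> space half_line. y < g x} = {u. 0 < u \<and> g u \<in> {y<..}}"
    by auto
  ultimately show "{x \<in> space half_line. y < g x} \<in> sets half_line"
    by (auto simp: sets_half_line)
qed

lemma spread_measurable:
  assumes "f \<in> borel_measurable half_line" "0 < d" "0 \<le> ofs" "ofs + d \<le> c"
  shows "spread c d ofs f \<in> borel_measurable half_line"
  using spread_level_sets(1)[OF assms(1) _ _ assms(2-4)] by (intro borel_measurable_half_lineI) auto

lemma two_spreads_level_sets:
  assumes f: "f \<in> borel_measurable half_line" and U: "U \<in> sets borel" "0 \<notin> U"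
    and cd: "0 < d" "0 < e" "d + e \<le> c"
  shows "emeasure lebesgue {u. 0 < u \<and> spread c d 0 f u + spread c e d f u \<in> U} =
         ennreal (d + e) * emeasure lebesgue {u. 0 < u \<and> f u \<in> U}"
proof -
  let ?A = "{u. 0 < u \<and> spread c d 0 f u \<in> U}" and ?B = "{u. 0 < u \<and> spread c e d f u \<in> U}"
  have disj: "spread c d 0 f u = 0 \<or> spread c e d f u = 0" for u
    by (auto simp: spread_def Let_def)
  have "{u. 0 < u \<and> spread c d 0 f u + spread c e d f u \<in> U} = ?A \<union> ?B"
  proof (intro set_eqI)
    fix u show "u \<in> {u. 0 < u \<and> spread c d 0 f u + spread c e d f u \<in> U} \<longleftrightarrow> u \<in> ?A \<union> ?B"
      using disj[of u] U(2) by auto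
  qed
  moreover have "emeasure lebesgue (?A \<union> ?B) = emeasure lebesgue ?A + emeasure lebesgue ?B"
  proof (rule plus_emeasure[symmetric])
    show "?A \<inter> ?B = {}"
      using disj U(2) by (auto simp: disjoint_iff) metis
  qed (use f U cd in \<open>auto intro!: spread_level_sets(1)\<close>)
  ultimately show ?thesis
    using cd by (simp add: spread_level_sets(2)[OF f U] ennreal_plus distrib_right)
qed

context ri_function_norm
begin

text \<open>
  Equimeasurability away from the value \<open>0\<close>, for functions that may take the value
  \<open>\<infinity>\<close>: the sets where they do have equal measure, and a function that is
  infinite on a set of positive measure has infinite norm.
\<close>

lemma norm_eq_of_level_sets:
  assumes f[measurable]: "f \<in> borel_measurable half_line"
    and g[measurable]: "g \<in> borel_measurable half_line"
    and eq: "\<And>U. U \<in> sets borel \<Longrightarrow> 0 \<notin> U \<Longrightarrow>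
      emeasure lebesgue {u. 0 < u \<and> f u \<in> U} = emeasure lebesgue {u. 0 < u \<and> g u \<in> U}"
  shows "\<rho> f = \<rho> g"
proof -
  have AE_iff: "(AE u in half_line. h u < \<infinity>) \<longleftrightarrow> emeasure lebesgue {u. 0 < u \<and> h u \<in> {\<infinity>}} = 0"
    if [measurable]: "h \<in> borel_measurable half_line" for h :: "real \<Rightarrow> ennreal"
  proof -
    let ?N = "{u. 0 < u \<and> h u \<in> {\<infinity>}}"
    have "?N \<in> sets half_line"
      using half_line_Collect_sets[OF that, of "{\<infinity>}"] by (auto simp: sets_half_line)
    then have "(AE u in half_line. h u < \<infinity>) \<longleftrightarrow> emeasure half_line ?N = 0"
      by (intro AE_iff_measurable) (auto simp: less_top[symmetric])
    then show ?thesis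
      by (subst (asm) emeasure_half_line) auto
  qed
  have fin_iff: "(AE u in half_line. f u < \<infinity>) \<longleftrightarrow> (AE u in half_line. g u < \<infinity>)"
    by (subst (1 2) AE_iff) (use eq[of "{\<infinity>}"] in simp_all)
  show ?thesis
  proof (cases "AE u in half_line. f u < \<infinity>")
    case True
    then have "AE u in half_line. g u < \<infinity>"
      using fin_iff by blast
    with True show ?thesis
    proof (intro rearrangement_invariant f g)
      fix r :: real
      have *: "emeasure half_line {u \<in> space half_line. ennreal r < h u} =
          emeasure lebesgue {u. 0 < u \<and> h u \<in> {ennreal r<..}}" for h
        by (subst emeasure_half_line) (auto intro: arg_cong[where f = "emeasure lebesgue"])
      show "emeasure half_line {u \<in> space half_line. ennreal r < f u} =
          emeasure half_line {u \<in> space half_line. ennreal r < g u}"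
        unfolding * by (rule eq) auto
    qed
  next
    case False
    then have "\<not> (AE u in half_line. g u < \<infinity>)"
      using fin_iff by blast
    with False have "\<not> \<rho> f < \<infinity>" "\<not> \<rho> g < \<infinity>"
      using norm_finite_AE f g by blast+
    then show ?thesis
      by (simp add: less_top[symmetric])
  qed
qed

text \<open>
  The translate is equimeasurable with the restriction of \<open>f\<close> to \<open>(k,
  \<infinity>)\<close>.
\<close>

lemma norm_shift_left:
  assumes f[measurable]: "f \<in> borel_measurable half_line" and k: "k \<ge> 0"
  shows "(\<lambda>u. f (u + k)) \<in> borel_measurable half_line" "\<rho> (\<lambda>u. f (u + k)) \<le> \<rho> f"
proof -
  let ?f = "\<lambda>u. f u * indicator {k<..} u"
  have [measurable]: "{k<..} \<in> sets half_line"
    using k by (auto simp: sets_half_line)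
  have eq: "{u. 0 < u \<and> f (u + k) \<in> U} = (\<lambda>v. 1 * v + (- k)) ` {u. 0 < u \<and> ?f u \<in> U}"
    if "0 \<notin> U" for U
  proof (intro equalityI subsetI)
    fix u assume "u \<in> {u. 0 < u \<and> f (u + k) \<in> U}"
    then show "u \<in> (\<lambda>v. 1 * v + (- k)) ` {u. 0 < u \<and> ?f u \<in> U}"
      using k by (intro image_eqI[where x = "u + k"]) auto
  next
    fix u assume "u \<in> (\<lambda>v. 1 * v + (- k)) ` {u. 0 < u \<and> ?f u \<in> U}"
    then show "u \<in> {u. 0 < u \<and> f (u + k) \<in> U}"
      using that by (auto simp: indicator_def of_bool_def split: if_splits)
  qed
  show m: "(\<lambda>u. f (u + k)) \<in> borel_measurable half_line"
  proof (rule borel_measurable_half_lineI)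
    fix U :: "ennreal set" assume "U \<in> sets borel" "0 \<notin> U"
    then show "{u. 0 < u \<and> f (u + k) \<in> U} \<in> sets lebesgue"
      unfolding eq[OF \<open>0 \<notin> U\<close>] by (intro sets_affine_image half_line_Collect_sets) auto
  qed
  have "\<rho> (\<lambda>u. f (u + k)) = \<rho> ?f"
  proof (rule norm_eq_of_level_sets[OF m])
    fix U :: "ennreal set" assume "0 \<notin> U"
    show "emeasure lebesgue {u. 0 < u \<and> f (u + k) \<in> U} = emeasure lebesgue {u. 0 < u \<and> ?f u \<in> U}"
      unfolding eq[OF \<open>0 \<notin> U\<close>] emeasure_affine_image by simp
  qed measurable
  also have "\<dots> \<le> \<rho> f"
    by (rule norm_le) (auto simp: indicator_def)
  finally show "\<rho> (\<lambda>u. f (u + k)) \<le> \<rho> f" .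
qed

lemma norm_shift_right:
  assumes f[measurable]: "f \<in> borel_measurable half_line" and k: "k \<ge> 0"
  shows "(\<lambda>u. if k < u then f (u - k) else 0) \<in> borel_measurable half_line" (is "?g \<in> _")
    and "\<rho> (\<lambda>u. if k < u then f (u - k) else 0) = \<rho> f"
proof -
  have eq: "{u. 0 < u \<and> ?g u \<in> U} = (\<lambda>v. 1 * v + k) ` {u. 0 < u \<and> f u \<in> U}"
    if "0 \<notin> U" for U
  proof (intro equalityI subsetI)
    fix u assume "u \<in> {u. 0 < u \<and> ?g u \<in> U}"
    then show "u \<in> (\<lambda>v. 1 * v + k) ` {u. 0 < u \<and> f u \<in> U}"
      using that by (intro image_eqI[where x = "u - k"]) (auto split: if_splits)
  qed (use k in auto)
  show m: "?g \<in> borel_measurable half_line"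
  proof (rule borel_measurable_half_lineI)
    fix U :: "ennreal set" assume "U \<in> sets borel" "0 \<notin> U"
    then show "{u. 0 < u \<and> ?g u \<in> U} \<in> sets lebesgue"
      unfolding eq[OF \<open>0 \<notin> U\<close>] by (intro sets_affine_image half_line_Collect_sets) auto
  qed
  show "\<rho> ?g = \<rho> f"
  proof (rule norm_eq_of_level_sets[OF m f])
    fix U :: "ennreal set" assume "0 \<notin> U"
    show "emeasure lebesgue {u. 0 < u \<and> ?g u \<in> U} = emeasure lebesgue {u. 0 < u \<and> f u \<in> U}"
      unfolding eq[OF \<open>0 \<notin> U\<close>] emeasure_affine_image by simp
  qed
qed

lemma dilation_level_sets:
  fixes \<gamma> :: real
  assumes "\<gamma> > 0"
  shows "{u. 0 < u \<and> f (\<gamma> * u) \<in> U} = (\<lambda>v. inverse \<gamma> * v + 0) ` {u. 0 < u \<and> f u \<in> U}"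
proof (intro equalityI subsetI)
  fix u assume "u \<in> {u. 0 < u \<and> f (\<gamma> * u) \<in> U}"
  then show "u \<in> (\<lambda>v. inverse \<gamma> * v + 0) ` {u. 0 < u \<and> f u \<in> U}"
    using assms by (intro image_eqI[where x = "\<gamma> * u"]) auto
qed (use assms in \<open>auto simp: mult.assoc[symmetric]\<close>)

lemma dilation_measurable:
  fixes f :: "real \<Rightarrow> ennreal"
  assumes "f \<in> borel_measurable half_line" "\<gamma> > 0"
  shows "(\<lambda>u. f (\<gamma> * u)) \<in> borel_measurable half_line"
proof (rule borel_measurable_half_lineI)
  fix U :: "ennreal set" assume "U \<in> sets borel"
  then show "{u. 0 < u \<and> f (\<gamma> * u) \<in> U} \<in> sets lebesgue"
    unfolding dilation_level_sets[OF assms(2)]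
    by (intro sets_affine_image half_line_Collect_sets assms)
qed

lemma emeasure_dilation_level_sets:
  fixes \<gamma> :: real
  assumes "\<gamma> > 0"
  shows "emeasure lebesgue {u. 0 < u \<and> f (\<gamma> * u) \<in> U} =
    ennreal (inverse \<gamma>) * emeasure lebesgue {u. 0 < u \<and> f u \<in> U}"
  unfolding dilation_level_sets[OF assms] emeasure_affine_image using assms by simp

text \<open>
  The function \<open>f\<close> is equimeasurable with the sum of two disjoint spread copies,
  with densities \<open>1 / \<gamma>\<close> and \<open>1 - 1 / \<gamma>\<close>, and the first
  of them is equimeasurable with the dilated function.
\<close>

lemma norm_dilation_contract:
  assumes f: "f \<in> borel_measurable half_line" and \<gamma>: "\<gamma> \<ge> 1"
  shows "\<rho> (\<lambda>u. f (\<gamma> * u)) \<le> \<rho> f"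
proof (cases "\<gamma> = 1")
  case False
  define d where "d = inverse \<gamma>"
  have d: "0 < d" "d < 1"
    using \<gamma> False by (auto simp: d_def field_simps)
  note m = spread_measurable[OF f]
  have "\<rho> (\<lambda>u. f (\<gamma> * u)) = \<rho> (spread 1 d 0 f)"
    using \<gamma> d f
    by (intro norm_eq_of_level_sets dilation_measurable m)
      (simp_all add: emeasure_dilation_level_sets spread_level_sets(2) d_def[symmetric])
  also have "\<dots> \<le> \<rho> (\<lambda>u. spread 1 d 0 f u + spread 1 (1 - d) d f u)"
    using d by (intro norm_le borel_measurable_add m) auto
  also have "\<dots> = \<rho> f"
    using d by (intro norm_eq_of_level_sets borel_measurable_add m f)
      (simp_all add: two_spreads_level_sets[OF f])
  finally show ?thesis .
qed simp

text \<open>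
  The stretched function is equimeasurable with the sum of two disjoint copies of
  \<open>f\<close>, placed on the intervals \<open>(2k, 2k + 1]\<close> and \<open>(2k + 1, 2k +
  2]\<close>.
\<close>

lemma norm_dilation_half:
  assumes f: "f \<in> borel_measurable half_line"
  shows "\<rho> (\<lambda>u. f (1 / 2 * u)) \<le> 2 * \<rho> f"
proof -
  note m = spread_measurable[OF f]
  have "\<rho> (\<lambda>u. f (1 / 2 * u)) = \<rho> (\<lambda>u. spread 2 1 0 f u + spread 2 1 1 f u)"
    using f by (intro norm_eq_of_level_sets dilation_measurable borel_measurable_add m)
      (simp_all add: emeasure_dilation_level_sets two_spreads_level_sets del: times_divide_eq_left)
  also have "\<dots> \<le> \<rho> (spread 2 1 0 f) + \<rho> (spread 2 1 1 f)"
    by (intro norm_triangle m) auto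
  also have "\<rho> (spread 2 1 0 f) = \<rho> f"
    using f by (intro norm_eq_of_level_sets m) (simp_all add: spread_level_sets(2)[OF f])
  also have "\<rho> (spread 2 1 1 f) = \<rho> f"
    using f by (intro norm_eq_of_level_sets m) (simp_all add: spread_level_sets(2)[OF f])
  finally show ?thesis
    by (simp add: mult_2)
qed

text \<open>
  The operator \<open>f \<mapsto> f(\<gamma> \<cdot>)\<close> is a finite number of halvings
  followed by a contraction.
\<close>

lemma norm_dilation:
  assumes \<gamma>: "\<gamma> > 0"
  obtains C :: real where "C > 0"
    "\<And>f :: real \<Rightarrow> ennreal. f \<in> borel_measurable half_line \<Longrightarrow> \<rho> (\<lambda>u. f (\<gamma> * u)) \<le> ennreal C * \<rho> f"
proof -
  have half: "\<rho> (\<lambda>u. f ((1 / 2) ^ n * u)) \<le> ennreal (2 ^ n) * \<rho> f"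
    if f: "f \<in> borel_measurable half_line" for f :: "real \<Rightarrow> ennreal" and n
  proof (induction n)
    case (Suc n)
    have "\<rho> (\<lambda>u. f ((1 / 2) ^ Suc n * u)) = \<rho> (\<lambda>u. (\<lambda>u. f ((1 / 2) ^ n * u)) (1 / 2 * u))"
      by (simp add: ac_simps)
    also have "\<dots> \<le> 2 * \<rho> (\<lambda>u. f ((1 / 2) ^ n * u))"
      using f by (intro norm_dilation_half dilation_measurable) auto
    also have "\<dots> \<le> 2 * (ennreal (2 ^ n) * \<rho> f)"
      by (intro mult_left_mono Suc) simp
    finally show ?case
      by (simp add: ennreal_mult mult.assoc)
  qed simp
  obtain n where n: "(1 / 2) ^ n < \<gamma>"
    using real_arch_pow_inv[OF \<gamma>, of "1 / 2"] by auto
  show ?thesis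
  proof (rule that)
    fix f :: "real \<Rightarrow> ennreal" assume f: "f \<in> borel_measurable half_line"
    have "\<rho> (\<lambda>u. f (\<gamma> * u)) = \<rho> (\<lambda>u. (\<lambda>u. f ((1 / 2) ^ n * u)) ((\<gamma> * 2 ^ n) * u))"
      by (simp add: field_simps)
    also have "\<dots> \<le> \<rho> (\<lambda>u. f ((1 / 2) ^ n * u))"
      using n f by (intro norm_dilation_contract dilation_measurable) (auto simp: field_simps)
    also have "\<dots> \<le> ennreal (2 ^ n) * \<rho> f"
      by (rule half[OF f])
    finally show "\<rho> (\<lambda>u. f (\<gamma> * u)) \<le> ennreal (2 ^ n) * \<rho> f" .
  qed simp
qed

end

section \<open>Slowly varying weights and discrete Hardy inequalities\<close>

lemma almost_increasing_onE:
  assumes "almost_increasing_on S f" "\<And>t. t \<in> S \<Longrightarrow> f t > 0"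
  obtains C where "C > 0" "\<And>s t. s \<in> S \<Longrightarrow> t \<in> S \<Longrightarrow> s \<le> t \<Longrightarrow> f s \<le> C * f t"
proof -
  obtain g C where g: "mono_on S g" and C: "C > 0"
    and eq: "\<And>t. t \<in> S \<Longrightarrow> inverse C * g t \<le> f t \<and> f t \<le> C * g t"
    using assms(1) by (auto simp: almost_increasing_on_def equivalent_on_def)
  show ?thesis
  proof (rule that[of "C * C"])
    fix s t assume st: "s \<in> S" "t \<in> S" "s \<le> t"
    have "f s \<le> C * g t"
      using eq[OF st(1)] mono_onD[OF g st] C by (meson mult_left_mono less_imp_le order_trans)
    also have "g t \<le> C * f t"
      using eq[OF st(2)] C by (simp add: field_simps)
    finally show "f s \<le> C * C * f t"
      using C by (simp add: mult.assoc)
  qed (use C in auto)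
qed

lemma almost_decreasing_onE:
  assumes "almost_decreasing_on S f" "\<And>t. t \<in> S \<Longrightarrow> f t > 0"
  obtains C where "C > 0" "\<And>s t. s \<in> S \<Longrightarrow> t \<in> S \<Longrightarrow> s \<le> t \<Longrightarrow> f t \<le> C * f s"
proof -
  obtain g C where g: "antimono_on S g" and C: "C > 0"
    and eq: "\<And>t. t \<in> S \<Longrightarrow> inverse C * g t \<le> f t \<and> f t \<le> C * g t"
    using assms(1) by (auto simp: almost_decreasing_on_def equivalent_on_def)
  show ?thesis
  proof (rule that[of "C * C"])
    fix s t assume st: "s \<in> S" "t \<in> S" "s \<le> t"
    have "g t \<le> g s"
      using g st by (auto simp: monotone_on_def)
    then have "f t \<le> C * g s"
      using eq[OF st(2)] C by (meson mult_left_mono less_imp_le order_trans)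
    also have "g s \<le> C * f s"
      using eq[OF st(1)] C by (simp add: field_simps)
    finally show "f t \<le> C * C * f s"
      using C by (simp add: mult.assoc)
  qed (use C in auto)
qed

text \<open>
  The Potter bound for \<open>b\<close>, in the variable \<open>y = - ln t\<close>: monotonicity
  of \<open>t^\<epsilon> b(t)\<close> gives it for \<open>z \<le> y\<close>, that of
  \<open>t^(-\<epsilon>) b(t)\<close> for \<open>y \<le> z\<close>.
\<close>

lemma slowly_varying_exp_bound:
  assumes b: "slowly_varying b" and \<epsilon>: "\<epsilon> > 0"
  obtains C where "C > 0"
    "\<And>y z. y > 0 \<Longrightarrow> z > 0 \<Longrightarrow> b (exp (- y)) \<le> C * exp (\<epsilon> * \<bar>y - z\<bar>) * b (exp (- z))"
proof -
  have pos: "b t > 0" if "t \<in> {0<..<1}" for t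
    using b that by (auto simp: slowly_varying_def)
  obtain C where C: "C > 0" "\<And>s t. s \<in> {0<..<1} \<Longrightarrow> t \<in> {0<..<1} \<Longrightarrow> s \<le> t \<Longrightarrow>
      s powr \<epsilon> * b s \<le> C * (t powr \<epsilon> * b t)"
  proof (rule almost_increasing_onE)
    show "almost_increasing_on {0<..<1} (\<lambda>t. t powr \<epsilon> * b t)"
      using b \<epsilon> by (simp add: slowly_varying_def)
  qed (use pos in auto)
  obtain D where D: "D > 0" "\<And>s t. s \<in> {0<..<1} \<Longrightarrow> t \<in> {0<..<1} \<Longrightarrow> s \<le> t \<Longrightarrow>
      t powr (- \<epsilon>) * b t \<le> D * (s powr (- \<epsilon>) * b s)"
  proof (rule almost_decreasing_onE)
    show "almost_decreasing_on {0<..<1} (\<lambda>t. t powr (- \<epsilon>) * b t)"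
      using b \<epsilon> by (simp add: slowly_varying_def)
  qed (use pos in auto)
  show ?thesis
  proof (rule that[of "max C D"])
    fix y z :: real assume yz: "y > 0" "z > 0"
    define t where "t = exp (- y)"
    define s where "s = exp (- z)"
    have ts: "t \<in> {0<..<1}" "s \<in> {0<..<1}"
      using yz by (auto simp: t_def s_def)
    have powr: "t powr r = exp (- y * r)" "s powr r = exp (- z * r)" for r
      by (auto simp: t_def s_def powr_def)
    show "b (exp (- y)) \<le> max C D * exp (\<epsilon> * \<bar>y - z\<bar>) * b (exp (- z))"
    proof (cases "z \<le> y")
      case True
      then have "t powr \<epsilon> * b t \<le> C * (s powr \<epsilon> * b s)"
        using ts by (intro C) (auto simp: t_def s_def)
      then have "exp (y * \<epsilon>) * (exp (- y * \<epsilon>) * b t) \<le> exp (y * \<epsilon>) * (C * (exp (- z * \<epsilon>) * b s))"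
        unfolding powr by (intro mult_left_mono) auto
      also have "exp (y * \<epsilon>) * (exp (- y * \<epsilon>) * b t) = b t"
        by (simp add: mult.assoc[symmetric] exp_add[symmetric])
      also have "exp (y * \<epsilon>) * (C * (exp (- z * \<epsilon>) * b s)) = C * (exp (\<epsilon> * \<bar>y - z\<bar>) * b s)"
      proof -
        have "\<epsilon> * \<bar>y - z\<bar> = y * \<epsilon> + - z * \<epsilon>"
          using True by (simp add: algebra_simps)
        then show ?thesis
          by (simp only: exp_add ac_simps)
      qed
      also have "\<dots> \<le> max C D * (exp (\<epsilon> * \<bar>y - z\<bar>) * b s)"
        using pos[OF ts(2)] by (intro mult_right_mono) auto
      finally show ?thesis
        by (simp add: t_def s_def mult.assoc)
    next
      case False
      then have "t powr (- \<epsilon>) * b t \<le> D * (s powr (- \<epsilon>) * b s)"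
        using ts by (intro D) (auto simp: t_def s_def)
      then have "exp (- y * \<epsilon>) * (exp (y * \<epsilon>) * b t) \<le> exp (- y * \<epsilon>) * (D * (exp (z * \<epsilon>) * b s))"
        unfolding powr by (intro mult_left_mono) auto
      also have "exp (- y * \<epsilon>) * (exp (y * \<epsilon>) * b t) = b t"
        by (simp add: mult.assoc[symmetric] exp_add[symmetric])
      also have "exp (- y * \<epsilon>) * (D * (exp (z * \<epsilon>) * b s)) = D * (exp (\<epsilon> * \<bar>y - z\<bar>) * b s)"
      proof -
        have "\<epsilon> * \<bar>y - z\<bar> = - y * \<epsilon> + z * \<epsilon>"
          using False by (simp add: algebra_simps)
        then show ?thesis
          by (simp only: exp_add ac_simps)
      qed
      also have "\<dots> \<le> max C D * (exp (\<epsilon> * \<bar>y - z\<bar>) * b s)"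
        using pos[OF ts(2)] by (intro mult_right_mono) auto
      finally show ?thesis
        by (simp add: t_def s_def mult.assoc)
    qed
  qed (use C in auto)
qed

text \<open>
  The weight \<open>t^(-\<eta>) b(t)\<close> at \<open>t = e^(-\<gamma>y)\<close>, where
  \<open>\<theta> = \<eta>\<gamma>\<close>.
\<close>

definition log_weight :: "real \<Rightarrow> real \<Rightarrow> (real \<Rightarrow> real) \<Rightarrow> real \<Rightarrow> ennreal" where
  "log_weight \<theta> \<gamma> b y = ennreal (exp (\<theta> * y) * b (exp (- (\<gamma> * y))))"

lemma slowly_varying_measurable_exp:
  assumes "slowly_varying b" "\<gamma> > 0"
  shows "(\<lambda>y. b (exp (- (\<gamma> * y)))) \<in> borel_measurable half_line"
proof (rule lebesgue_on_measurable_comp[where h = "\<lambda>y. exp (- (\<gamma> * y))" and k = "\<lambda>t. - ln t / \<gamma>"])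
  show "b \<in> borel_measurable (lebesgue_on {0<..<1})"
    using assms by (simp add: slowly_varying_def)
  show "(\<lambda>t. - ln t / \<gamma>) differentiable_on {0<..<1}"
    using assms unfolding differentiable_on_def real_differentiable_def
    by (auto intro!: exI derivative_eq_intros)
qed (use assms in \<open>auto simp: field_simps zero_less_mult_iff\<close>)

lemma log_weight_measurable:
  assumes "slowly_varying b" "\<gamma> > 0"
  shows "log_weight \<theta> \<gamma> b \<in> borel_measurable half_line"
proof -
  have [measurable]: "(\<lambda>y. b (exp (- (\<gamma> * y)))) \<in> borel_measurable half_line"
    using assms by (rule slowly_varying_measurable_exp)
  have [measurable]: "(\<lambda>y::real. exp (\<theta> * y)) \<in> borel_measurable half_line"
    by (rule borel_measurable_half_line) simp
  show ?thesis
    unfolding log_weight_def[abs_def] by measurable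
qed

lemma log_weight_shift_up:
  assumes b: "slowly_varying b" and \<gamma>: "\<gamma> > 0" and r: "r < \<theta>"
  obtains C where "C > 0"
    "\<And>y k. y > 0 \<Longrightarrow> k \<ge> 0 \<Longrightarrow>
      log_weight \<theta> \<gamma> b y \<le> ennreal (C * exp (- r * k)) * log_weight \<theta> \<gamma> b (y + k)"
proof -
  obtain C where C: "C > 0" "\<And>y z. y > 0 \<Longrightarrow> z > 0 \<Longrightarrow>
      b (exp (- y)) \<le> C * exp ((\<theta> - r) / \<gamma> * \<bar>y - z\<bar>) * b (exp (- z))"
    using slowly_varying_exp_bound[OF b, of "(\<theta> - r) / \<gamma>"] r \<gamma> by auto
  show ?thesis
  proof (rule that[OF C(1)])
    fix y k :: real assume yk: "y > 0" "k \<ge> 0"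
    have "b (exp (- (\<gamma> * y))) \<le>
        C * exp ((\<theta> - r) / \<gamma> * \<bar>\<gamma> * y - \<gamma> * (y + k)\<bar>) * b (exp (- (\<gamma> * (y + k))))"
      using yk \<gamma> by (intro C) (auto intro!: mult_pos_pos)
    also have "\<bar>\<gamma> * y - \<gamma> * (y + k)\<bar> = \<gamma> * k"
      using yk \<gamma> by (simp add: right_diff_distrib distrib_left)
    also have "(\<theta> - r) / \<gamma> * (\<gamma> * k) = (\<theta> - r) * k"
      using \<gamma> by simp
    finally have "exp (\<theta> * y) * b (exp (- (\<gamma> * y))) \<le>
        exp (\<theta> * y) * (C * exp ((\<theta> - r) * k) * b (exp (- (\<gamma> * (y + k)))))"
      by (intro mult_left_mono) auto
    also have "\<dots> = C * exp (\<theta> * y + (\<theta> - r) * k) * b (exp (- (\<gamma> * (y + k))))"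
      by (simp only: exp_add ac_simps)
    also have "\<theta> * y + (\<theta> - r) * k = - r * k + \<theta> * (y + k)"
      by (simp add: algebra_simps)
    also have "C * exp (- r * k + \<theta> * (y + k)) * b (exp (- (\<gamma> * (y + k)))) =
        (C * exp (- r * k)) * (exp (\<theta> * (y + k)) * b (exp (- (\<gamma> * (y + k)))))"
      by (simp only: exp_add ac_simps)
    finally show "log_weight \<theta> \<gamma> b y \<le> ennreal (C * exp (- r * k)) * log_weight \<theta> \<gamma> b (y + k)"
      unfolding log_weight_def using C(1) by (subst ennreal_mult'[symmetric]) (auto intro!: ennreal_leI)
  qed
qed

lemma log_weight_shift_down:
  assumes b: "slowly_varying b" and \<gamma>: "\<gamma> > 0" and r: "\<theta> < r"
  obtains C where "C > 0"
    "\<And>y k. y > k \<Longrightarrow> k \<ge> 0 \<Longrightarrow>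
      log_weight \<theta> \<gamma> b y \<le> ennreal (C * exp (r * k)) * log_weight \<theta> \<gamma> b (y - k)"
proof -
  obtain C where C: "C > 0" "\<And>y z. y > 0 \<Longrightarrow> z > 0 \<Longrightarrow>
      b (exp (- y)) \<le> C * exp ((r - \<theta>) / \<gamma> * \<bar>y - z\<bar>) * b (exp (- z))"
    using slowly_varying_exp_bound[OF b, of "(r - \<theta>) / \<gamma>"] r \<gamma> by auto
  show ?thesis
  proof (rule that[OF C(1)])
    fix y k :: real assume yk: "y > k" "k \<ge> 0"
    have "b (exp (- (\<gamma> * y))) \<le>
        C * exp ((r - \<theta>) / \<gamma> * \<bar>\<gamma> * y - \<gamma> * (y - k)\<bar>) * b (exp (- (\<gamma> * (y - k))))"
      using yk \<gamma> by (intro C) (auto intro!: mult_pos_pos)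
    also have "\<bar>\<gamma> * y - \<gamma> * (y - k)\<bar> = \<gamma> * k"
      using yk \<gamma> by (simp add: right_diff_distrib distrib_left)
    also have "(r - \<theta>) / \<gamma> * (\<gamma> * k) = (r - \<theta>) * k"
      using \<gamma> by simp
    finally have "exp (\<theta> * y) * b (exp (- (\<gamma> * y))) \<le>
        exp (\<theta> * y) * (C * exp ((r - \<theta>) * k) * b (exp (- (\<gamma> * (y - k)))))"
      by (intro mult_left_mono) auto
    also have "\<dots> = C * exp (\<theta> * y + (r - \<theta>) * k) * b (exp (- (\<gamma> * (y - k))))"
      by (simp only: exp_add ac_simps)
    also have "\<theta> * y + (r - \<theta>) * k = r * k + \<theta> * (y - k)"
      by (simp add: algebra_simps)
    also have "C * exp (r * k + \<theta> * (y - k)) * b (exp (- (\<gamma> * (y - k)))) =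
        (C * exp (r * k)) * (exp (\<theta> * (y - k)) * b (exp (- (\<gamma> * (y - k)))))"
      by (simp only: exp_add ac_simps)
    finally show "log_weight \<theta> \<gamma> b y \<le> ennreal (C * exp (r * k)) * log_weight \<theta> \<gamma> b (y - k)"
      unfolding log_weight_def using C(1) by (subst ennreal_mult'[symmetric]) (auto intro!: ennreal_leI)
  qed
qed

lemma suminf_ennreal_exp:
  assumes "d < 0" "C \<ge> 0"
  shows "(\<Sum>k. ennreal (C * exp (d * real k))) = ennreal (C / (1 - exp d))"
proof -
  have "(\<lambda>k. exp d ^ k) sums (1 / (1 - exp d))"
    using assms by (intro geometric_sums) auto
  from sums_mult[OF this, of C] show ?thesis
    using assms by (intro suminf_ennreal_eq) (auto simp: exp_of_nat2_mult)
qed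

lemma mult_exp_exp_ennreal:
  "K \<ge> 0 \<Longrightarrow> D \<ge> 0 \<Longrightarrow> ennreal (K * exp r) * ennreal (D * exp s) = ennreal (K * D * exp (r + s))"
  by (subst ennreal_mult[symmetric]) (auto simp: exp_add ac_simps)

context ri_function_norm
begin

text \<open>
  The common core of the two discrete Hardy inequalities below: countable subadditivity and a
  geometric series.
\<close>

lemma norm_geometric_series:
  assumes [measurable]: "g \<in> borel_measurable half_line" "\<And>k::nat. R k \<in> borel_measurable half_line"
    and d: "d < 0" and K: "K \<ge> 0" and R: "\<And>k. \<rho> (R k) \<le> N"
    and g: "\<And>y. y > 0 \<Longrightarrow> g y \<le> (\<Sum>k. ennreal (K * exp (d * real k)) * R k y)"
  shows "\<rho> g \<le> ennreal (K / (1 - exp d)) * N"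
proof -
  let ?q = "\<lambda>k. ennreal (K * exp (d * real k))"
  have "\<rho> g \<le> \<rho> (\<lambda>y. \<Sum>k. ?q k * R k y)"
    by (rule norm_le) (measurable, rule g)
  also have "\<dots> \<le> (\<Sum>k. \<rho> (\<lambda>y. ?q k * R k y))"
    by (rule norm_suminf) measurable
  also have "\<dots> = (\<Sum>k. ?q k * \<rho> (R k))"
    using K by (subst norm_scale) auto
  also have "\<dots> \<le> (\<Sum>k. ?q k * N)"
    by (intro suminf_le allI mult_left_mono R) auto
  also have "\<dots> = ennreal (K / (1 - exp d)) * N"
    using d K by (subst ennreal_suminf_multc, subst suminf_ennreal_exp) auto
  finally show ?thesis .
qed

text \<open>
  A discrete Hardy inequality. Moving the weight from \<open>y\<close> to \<open>y + k\<close>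
  gains almost \<open>e^(-\<theta>k)\<close>, which beats the factor \<open>e^(sk)\<close>, and
  translations to the left are contractions; so the norms of the summands form a convergent
  geometric series.
\<close>

lemma norm_weighted_forward:
  assumes b: "slowly_varying b" and \<gamma>: "\<gamma> > 0" and s: "s < \<theta>" and K: "K \<ge> 0"
  obtains C where "C > 0"
    "\<And>G P. G \<in> borel_measurable half_line \<Longrightarrow> P \<in> borel_measurable half_line \<Longrightarrow>
      (\<And>y. y > 0 \<Longrightarrow> G y \<le> (\<Sum>k. ennreal (K * exp (s * real k)) * P (y + real k))) \<Longrightarrow>
      \<rho> (\<lambda>y. log_weight \<theta> \<gamma> b y * G y) \<le> ennreal C * \<rho> (\<lambda>y. log_weight \<theta> \<gamma> b y * P y)"
proof -
  \<comment> \<open>The margin between \<open>s\<close> and \<open>\<theta>\<close> is shared by the Potter bound and the geometric series.\<close>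
  define r where "r = (s + \<theta>) / 2"
  have r: "s < r" "r < \<theta>"
    using s by (auto simp: r_def)
  let ?w = "log_weight \<theta> \<gamma> b"
  obtain D where D: "D > 0" "\<And>y k. y > 0 \<Longrightarrow> k \<ge> 0 \<Longrightarrow> ?w y \<le> ennreal (D * exp (- r * k)) * ?w (y + k)"
    using log_weight_shift_up[OF b \<gamma> r(2)] by blast
  have w[measurable]: "?w \<in> borel_measurable half_line"
    using b \<gamma> by (rule log_weight_measurable)
  define C where "C = K * D / (1 - exp (s - r))"
  have C: "C \<ge> 0"
    using K D r by (auto simp: C_def intro!: divide_nonneg_pos)
  show ?thesis
  proof (rule that[of "C + 1"])
    fix G P :: "real \<Rightarrow> ennreal"
    assume [measurable]: "G \<in> borel_measurable half_line" "P \<in> borel_measurable half_line"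
      and le: "\<And>y. y > 0 \<Longrightarrow> G y \<le> (\<Sum>k. ennreal (K * exp (s * real k)) * P (y + real k))"
    have "\<rho> (\<lambda>y. ?w y * G y) \<le> ennreal C * \<rho> (\<lambda>y. ?w y * P y)"
      unfolding C_def
    proof (rule norm_geometric_series)
      show "(\<lambda>y. ?w (y + real k) * P (y + real k)) \<in> borel_measurable half_line"
        "\<rho> (\<lambda>y. ?w (y + real k) * P (y + real k)) \<le> \<rho> (\<lambda>y. ?w y * P y)" for k
        by (rule norm_shift_left[of "\<lambda>y. ?w y * P y"]; simp)+
      fix y :: real assume y: "y > 0"
      have "?w y * G y \<le> (\<Sum>k. ?w y * (ennreal (K * exp (s * real k)) * P (y + real k)))"
        using le[OF y] by (subst ennreal_suminf_cmult) (rule mult_left_mono, auto)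
      also have "\<dots> \<le> (\<Sum>k. ennreal (K * D * exp ((s - r) * real k)) * (?w (y + real k) * P (y + real k)))"
      proof (intro suminf_le allI)
        fix k
        have "?w y * (ennreal (K * exp (s * real k)) * P (y + real k)) \<le>
            (ennreal (D * exp (- r * real k)) * ?w (y + real k)) * (ennreal (K * exp (s * real k)) * P (y + real k))"
          using y by (intro mult_right_mono D(2)) auto
        also have "\<dots> = (ennreal (K * exp (s * real k)) * ennreal (D * exp (- r * real k))) * (?w (y + real k) * P (y + real k))"
          by (simp add: ac_simps)
        also have "ennreal (K * exp (s * real k)) * ennreal (D * exp (- r * real k)) = ennreal (K * D * exp ((s - r) * real k))"
          unfolding mult_exp_exp_ennreal[OF K less_imp_le[OF D(1)]] by (simp add: algebra_simps)
        finally show "?w y * (ennreal (K * exp (s * real k)) * P (y + real k)) \<le>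
            ennreal (K * D * exp ((s - r) * real k)) * (?w (y + real k) * P (y + real k))" .
      qed auto
      finally show "?w y * G y \<le> (\<Sum>k. ennreal (K * D * exp ((s - r) * real k)) * (?w (y + real k) * P (y + real k)))" .
    qed (use r K D in auto)
    also have "\<dots> \<le> ennreal (C + 1) * \<rho> (\<lambda>y. ?w y * P y)"
      using C by (intro mult_right_mono ennreal_leI) auto
    finally show "\<rho> (\<lambda>y. ?w y * G y) \<le> ennreal (C + 1) * \<rho> (\<lambda>y. ?w y * P y)" .
  qed (use C in auto)
qed

text \<open>
  The mirror image: moving the weight from \<open>y\<close> to \<open>y - k\<close> costs little
  more than \<open>e^(\<theta>k)\<close>, which is beaten by \<open>e^(-sk)\<close>.
\<close>

lemma norm_weighted_backward:
  assumes b: "slowly_varying b" and \<gamma>: "\<gamma> > 0" and s: "\<theta> < s" and K: "K \<ge> 0"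
  obtains C where "C > 0"
    "\<And>G P. G \<in> borel_measurable half_line \<Longrightarrow> P \<in> borel_measurable half_line \<Longrightarrow>
      (\<And>y. y > 0 \<Longrightarrow> G y \<le>
        (\<Sum>k. ennreal (K * exp (- s * real k)) * (if real k < y then P (y - real k) else 0))) \<Longrightarrow>
      \<rho> (\<lambda>y. log_weight \<theta> \<gamma> b y * G y) \<le> ennreal C * \<rho> (\<lambda>y. log_weight \<theta> \<gamma> b y * P y)"
proof -
  define r where "r = (s + \<theta>) / 2"
  have r: "r < s" "\<theta> < r"
    using s by (auto simp: r_def)
  let ?w = "log_weight \<theta> \<gamma> b"
  obtain D where D: "D > 0" "\<And>y k. y > k \<Longrightarrow> k \<ge> 0 \<Longrightarrow> ?w y \<le> ennreal (D * exp (r * k)) * ?w (y - k)"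
    using log_weight_shift_down[OF b \<gamma> r(2)] by blast
  have w[measurable]: "?w \<in> borel_measurable half_line"
    using b \<gamma> by (rule log_weight_measurable)
  define C where "C = K * D / (1 - exp (r - s))"
  have C: "C \<ge> 0"
    using K D r by (auto simp: C_def intro!: divide_nonneg_pos)
  show ?thesis
  proof (rule that[of "C + 1"])
    fix G P :: "real \<Rightarrow> ennreal"
    assume [measurable]: "G \<in> borel_measurable half_line" "P \<in> borel_measurable half_line"
      and le: "\<And>y. y > 0 \<Longrightarrow> G y \<le>
        (\<Sum>k. ennreal (K * exp (- s * real k)) * (if real k < y then P (y - real k) else 0))"
    let ?R = "\<lambda>k y. if real k < y then ?w (y - real k) * P (y - real k) else 0"
    have "\<rho> (\<lambda>y. ?w y * G y) \<le> ennreal C * \<rho> (\<lambda>y. ?w y * P y)"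
      unfolding C_def
    proof (rule norm_geometric_series)
      show "?R k \<in> borel_measurable half_line" "\<rho> (?R k) \<le> \<rho> (\<lambda>y. ?w y * P y)" for k
        using norm_shift_right[of "\<lambda>y. ?w y * P y" "real k"] by auto
      fix y :: real assume y: "y > 0"
      let ?P = "\<lambda>k. if real k < y then P (y - real k) else 0"
      have "?w y * G y \<le> (\<Sum>k. ?w y * (ennreal (K * exp (- s * real k)) * ?P k))"
        using le[OF y] by (subst ennreal_suminf_cmult) (rule mult_left_mono, auto)
      also have "\<dots> \<le> (\<Sum>k. ennreal (K * D * exp ((r - s) * real k)) * ?R k y)"
      proof (intro suminf_le allI)
        fix k
        show "?w y * (ennreal (K * exp (- s * real k)) * ?P k) \<le>
            ennreal (K * D * exp ((r - s) * real k)) * ?R k y"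
        proof (cases "real k < y")
          case True
          have "?w y * (ennreal (K * exp (- s * real k)) * P (y - real k)) \<le>
              (ennreal (D * exp (r * real k)) * ?w (y - real k)) *
              (ennreal (K * exp (- s * real k)) * P (y - real k))"
            using True by (intro mult_right_mono D(2)) auto
          also have "\<dots> = (ennreal (K * exp (- s * real k)) * ennreal (D * exp (r * real k))) * (?w (y - real k) * P (y - real k))"
            by (simp add: ac_simps)
          also have "ennreal (K * exp (- s * real k)) * ennreal (D * exp (r * real k)) = ennreal (K * D * exp ((r - s) * real k))"
            unfolding mult_exp_exp_ennreal[OF K less_imp_le[OF D(1)]] by (simp add: algebra_simps)
          finally show ?thesis
            using True by simp
        qed simp
      qed auto
      finally show "?w y * G y \<le> (\<Sum>k. ennreal (K * D * exp ((r - s) * real k)) * ?R k y)" .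
    qed (use r K D in auto)
    also have "\<dots> \<le> ennreal (C + 1) * \<rho> (\<lambda>y. ?w y * P y)"
      using C by (intro mult_right_mono ennreal_leI) auto
    finally show "\<rho> (\<lambda>y. ?w y * G y) \<le> ennreal (C + 1) * \<rho> (\<lambda>y. ?w y * P y)" .
  qed (use C in auto)
qed

end

section \<open>Grand and small expressions in logarithmic variables\<close>

text \<open>
  For \<open>F u = f^*(e^(-u))\<close> this is the norm of \<open>s^(1/p) f^*(s)\<close> in
  \<open>L\<^sub>p(ds / s)\<close> over the set of all \<open>s = e^(-u)\<close> with \<open>u
  \<in> S\<close>.
\<close>

definition exp_Lp :: "real \<Rightarrow> (real \<Rightarrow> ennreal) \<Rightarrow> real set \<Rightarrow> ennreal" where
  "exp_Lp p F S =
    ennreal_powr (\<integral>\<^sup>+u\<in>S. ennreal (exp (- u)) * ennreal_powr (F u) p \<partial>lborel) (1 / p)"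

text \<open>
  In the variable \<open>u = - ln s\<close> one has \<open>\<ell>(s) = 1 + u\<close>. With
  \<open>a = \<alpha> / p\<close> the value at \<open>x = 0\<close> is the norm of the grand
  Lebesgue space; larger \<open>x\<close> restrict it to \<open>s < e^(-x)\<close>, where the
  rearrangement is large.
\<close>

definition tail_sup :: "real \<Rightarrow> real \<Rightarrow> (real \<Rightarrow> ennreal) \<Rightarrow> real \<Rightarrow> ennreal" where
  "tail_sup p a F x = esssup half_line (\<lambda>z.
    indicator {x<..} z * (ennreal ((1 + z) powr (- a)) * exp_Lp p F {x<..<z}))"

text \<open>
  With \<open>c = \<beta> / p'\<close>, \<open>full_int\<close> below is the norm of the small
  Lebesgue space; \<open>head_int\<close> is its restriction to \<open>s > e^(-x)\<close>, where
  the rearrangement is small.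
\<close>

definition head_int :: "real \<Rightarrow> real \<Rightarrow> (real \<Rightarrow> ennreal) \<Rightarrow> real \<Rightarrow> ennreal" where
  "head_int p c F x =
    (\<integral>\<^sup>+z\<in>{0<..<x}. ennreal ((1 + z) powr (c - 1)) * exp_Lp p F {z<..<x} \<partial>lborel)"

definition full_int :: "real \<Rightarrow> real \<Rightarrow> (real \<Rightarrow> ennreal) \<Rightarrow> ennreal" where
  "full_int p c F =
    (\<integral>\<^sup>+z\<in>{0<..}. ennreal ((1 + z) powr (c - 1)) * exp_Lp p F {z<..} \<partial>lborel)"

text \<open>
  The r.i. norm acts in the variable \<open>y = ln (1 + u) = ln \<ell>(s)\<close>, and
  translations by integers of \<open>y\<close> are used. An open block of radius one around each
  point contains the half-open unit intervals on both of its sides, so the same blocks cover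
  intervals to the right and to the left of \<open>y\<close>. The condition \<open>0 < u\<close>
  cuts off the blocks near the origin.
\<close>

definition block :: "real \<Rightarrow> real set" where
  "block y = {u. 0 < u \<and> y - 1 < ln (1 + u) \<and> ln (1 + u) < y + 1}"

definition block_norm :: "real \<Rightarrow> real \<Rightarrow> (real \<Rightarrow> ennreal) \<Rightarrow> real \<Rightarrow> ennreal" where
  "block_norm p a F y = ennreal (exp (- (a * y))) * exp_Lp p F (block y)"

lemma AE_half_line_ex:
  assumes "AE u in half_line. Q u" "0 \<le> l" "l < r"
  shows "\<exists>u. l < u \<and> u < r \<and> Q u"
proof (rule ccontr)
  assume no: "\<not> ?thesis"
  obtain N where N: "{u \<in> space half_line. \<not> Q u} \<subseteq> N" "emeasure half_line N = 0" "N \<in> sets half_line"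
    using assms(1) by (rule AE_E)
  have "{l<..<r} \<subseteq> N"
    using no N(1) assms(2) by fastforce
  then have "emeasure half_line {l<..<r} \<le> 0"
    using emeasure_mono N by metis
  moreover have "emeasure half_line {l<..<r} = ennreal (r - l)"
    using assms by (subst emeasure_half_line) auto
  ultimately show False
    using assms by (simp add: ennreal_eq_0_iff)
qed

lemma exp_Lp_empty [simp]: "exp_Lp p F {} = 0"
  by (simp add: exp_Lp_def)

lemma exp_Lp_cmult:
  assumes [measurable]: "F \<in> borel_measurable borel" "S \<in> sets borel" and p: "p > 0"
  shows "exp_Lp p (\<lambda>u. r * F u) S = r * exp_Lp p F S"
proof -
  have "(\<integral>\<^sup>+u\<in>S. ennreal (exp (- u)) * ennreal_powr (r * F u) p \<partial>lborel) =
      (\<integral>\<^sup>+u. ennreal_powr r p * (ennreal (exp (- u)) * ennreal_powr (F u) p * indicator S u) \<partial>lborel)"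
    by (simp add: ennreal_powr_mult ac_simps)
  also have "\<dots> = ennreal_powr r p * (\<integral>\<^sup>+u\<in>S. ennreal (exp (- u)) * ennreal_powr (F u) p \<partial>lborel)"
    by (rule nn_integral_cmult) measurable
  finally show ?thesis
    using p by (simp add: exp_Lp_def ennreal_powr_mult ennreal_powr_powr)
qed

lemma exp_Lp_mono:
  assumes "p > 0" "S \<subseteq> T" "\<And>u. u \<in> S \<Longrightarrow> F u \<le> G u"
  shows "exp_Lp p F S \<le> exp_Lp p G T"
  unfolding exp_Lp_def using assms
  by (intro ennreal_powr_mono nn_integral_mono)
    (auto simp: indicator_def intro!: mult_left_mono ennreal_powr_mono)

lemma exp_Lp_cover:
  fixes T :: "nat \<Rightarrow> real set"
  assumes [measurable]: "F \<in> borel_measurable borel" "\<And>k. T k \<in> sets borel"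
    and p: "p \<ge> 1" and S: "S \<subseteq> (\<Union>k. T k)"
  shows "exp_Lp p F S \<le> (\<Sum>k. exp_Lp p F (T k))"
proof -
  let ?g = "\<lambda>u. ennreal (exp (- u)) * ennreal_powr (F u) p"
  have "(\<integral>\<^sup>+u\<in>S. ?g u \<partial>lborel) \<le> (\<integral>\<^sup>+u. (\<Sum>k. ?g u * indicator (T k) u) \<partial>lborel)"
  proof (rule nn_integral_mono)
    fix u show "?g u * indicator S u \<le> (\<Sum>k. ?g u * indicator (T k) u)"
    proof (cases "u \<in> S")
      case True
      then obtain k where "u \<in> T k"
        using S by auto
      then show ?thesis
        using True sum_le_suminf[of "\<lambda>k. ?g u * indicator (T k) u" "{k}"] by simp
    qed simp
  qed
  also have "\<dots> = (\<Sum>k. \<integral>\<^sup>+u\<in>T k. ?g u \<partial>lborel)"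
    by (rule nn_integral_suminf) measurable
  finally have "exp_Lp p F S \<le> ennreal_powr (\<Sum>k. \<integral>\<^sup>+u\<in>T k. ?g u \<partial>lborel) (1 / p)"
    unfolding exp_Lp_def using p by (intro ennreal_powr_mono) auto
  also have "\<dots> \<le> (\<Sum>k. exp_Lp p F (T k))"
    unfolding exp_Lp_def using p by (rule ennreal_powr_suminf_le)
  finally show ?thesis .
qed

lemma exp_Lp_Un:
  assumes [measurable]: "F \<in> borel_measurable borel" "S \<in> sets borel" "T \<in> sets borel"
    and p: "p \<ge> 1" and R: "R \<subseteq> S \<union> T"
  shows "exp_Lp p F R \<le> exp_Lp p F S + exp_Lp p F T"
proof -
  define Q where "Q k = (if k = 0 then S else if k = 1 then T else {})" for k :: nat
  have "exp_Lp p F R \<le> (\<Sum>k. exp_Lp p F (Q k))"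
  proof (rule exp_Lp_cover)
    show "R \<subseteq> (\<Union>k. Q k)"
      using R by (auto simp: Q_def split: if_splits)
  qed (use p in \<open>auto simp: Q_def\<close>)
  also have "\<dots> = (\<Sum>k\<in>{0, 1}. exp_Lp p F (Q k))"
    by (rule suminf_finite) (auto simp: Q_def)
  finally show ?thesis
    by (simp add: Q_def)
qed

lemma exp_Lp_interval_measurable [measurable]:
  assumes "p > 0"
  shows "(\<lambda>z. exp_Lp p F {x<..<z}) \<in> borel_measurable borel"
    and "(\<lambda>z. exp_Lp p F {z<..<x}) \<in> borel_measurable borel"
    and "(\<lambda>z. exp_Lp p F {z<..}) \<in> borel_measurable borel"
  using assms
  by (intro borel_measurable_mono_ennreal borel_measurable_antimono_ennreal;
      auto simp: mono_def antimono_def intro!: exp_Lp_mono)+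

lemma nn_integral_exp_atLeast:
  "(\<integral>\<^sup>+u\<in>{x..}. ennreal (exp (- u)) \<partial>lborel) = ennreal (exp (- x))"
proof -
  have "((\<lambda>u::real. - exp (- u)) \<longlongrightarrow> - 0) at_top"
    by (intro tendsto_minus filterlim_compose[OF exp_at_bot] filterlim_uminus_at_bot_at_top)
  then have "(\<integral>\<^sup>+u\<in>{x..}. ennreal (exp (- u)) \<partial>lborel) = - 0 - (- exp (- x))"
    by (intro nn_integral_FTC_atLeast) (auto intro!: derivative_eq_intros)
  then show ?thesis
    by simp
qed

lemma exp_Lp_const_le:
  assumes p: "p > 0"
  shows "exp_Lp p (\<lambda>_. r) {x..} \<le> r * ennreal (exp (- (x / p)))"
proof -
  have "(\<integral>\<^sup>+u\<in>{x..}. ennreal (exp (- u)) * ennreal_powr r p \<partial>lborel)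
      = (\<integral>\<^sup>+u. ennreal_powr r p * (ennreal (exp (- u)) * indicator {x..} u) \<partial>lborel)"
    by (simp add: ac_simps)
  also have "\<dots> = ennreal_powr r p * ennreal (exp (- x))"
    by (subst nn_integral_cmult) (auto simp: nn_integral_exp_atLeast)
  finally have "exp_Lp p (\<lambda>_. r) {x..} \<le> ennreal_powr (ennreal_powr r p * ennreal (exp (- x))) (1 / p)"
    unfolding exp_Lp_def using p by (intro ennreal_powr_mono) auto
  also have "\<dots> = r * ennreal (exp (- (x / p)))"
    using p by (simp add: ennreal_powr_mult ennreal_powr_powr ennreal_powr_ennreal powr_def)
  finally show ?thesis .
qed

lemma exp_Lp_unit_interval_ge:
  assumes p: "p > 0" and F: "\<And>u. x < u \<Longrightarrow> u < x + 1 \<Longrightarrow> r \<le> F u"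
  shows "r * ennreal (exp (- ((x + 1) / p))) \<le> exp_Lp p F {x<..<x + 1}"
proof -
  have "ennreal_powr r p * ennreal (exp (- (x + 1))) =
      (\<integral>\<^sup>+u. ennreal_powr r p * ennreal (exp (- (x + 1))) * indicator {x<..<x + 1} u \<partial>lborel)"
    by (subst nn_integral_cmult_indicator) auto
  also have "\<dots> \<le> (\<integral>\<^sup>+u\<in>{x<..<x + 1}. ennreal (exp (- u)) * ennreal_powr (F u) p \<partial>lborel)"
  proof (rule nn_integral_mono)
    fix u :: real
    show "ennreal_powr r p * ennreal (exp (- (x + 1))) * indicator {x<..<x + 1} u
        \<le> ennreal (exp (- u)) * ennreal_powr (F u) p * indicator {x<..<x + 1} u"
    proof (cases "u \<in> {x<..<x + 1}")
      case True
      then have "ennreal (exp (- (x + 1))) * ennreal_powr r p \<le> ennreal (exp (- u)) * ennreal_powr (F u) p"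
        using p F by (intro mult_mono ennreal_powr_mono ennreal_leI) auto
      then show ?thesis
        using True by (simp add: ac_simps)
    qed simp
  qed
  finally have "ennreal_powr (ennreal_powr r p * ennreal (exp (- (x + 1)))) (1 / p) \<le> exp_Lp p F {x<..<x + 1}"
    unfolding exp_Lp_def using p by (intro ennreal_powr_mono) auto
  moreover have "ennreal_powr (ennreal_powr r p * ennreal (exp (- (x + 1)))) (1 / p) =
      r * ennreal (exp (- ((x + 1) / p)))"
    using p by (simp add: ennreal_powr_mult ennreal_powr_powr ennreal_powr_ennreal powr_def
        add_divide_distrib diff_divide_distrib)
  ultimately show ?thesis
    by simp
qed

lemma nn_integral_one_plus_powr_le:
  assumes c: "c > 0" and x: "x \<ge> 0"
  shows "(\<integral>\<^sup>+z\<in>{0<..<x}. ennreal ((1 + z) powr (c - 1)) \<partial>lborel) \<le> ennreal ((1 + x) powr c / c)"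
proof -
  have "(\<integral>\<^sup>+z\<in>{0<..<x}. ennreal ((1 + z) powr (c - 1)) \<partial>lborel)
      \<le> (\<integral>\<^sup>+z\<in>{0..x}. ennreal ((1 + z) powr (c - 1)) \<partial>lborel)"
    by (intro nn_integral_mono) (auto simp: indicator_def)
  also have "\<dots> = ennreal ((1 + x) powr c / c - (1 + 0) powr c / c)"
    using c x by (intro nn_integral_FTC_Icc) (auto intro!: derivative_eq_intros)
  also have "\<dots> \<le> ennreal ((1 + x) powr c / c)"
    using c by (intro ennreal_leI) simp
  finally show ?thesis .
qed

lemma tail_sup_le:
  assumes "p > 0" "x \<ge> 0"
    and "\<And>z. x < z \<Longrightarrow> ennreal ((1 + z) powr (- a)) * exp_Lp p F {x<..<z} \<le> C"
  shows "tail_sup p a F x \<le> C"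
  unfolding tail_sup_def using assms
  by (intro esssup_I AE_half_line_I borel_measurable_half_line) (auto simp: indicator_def)

text \<open>
  The essential supremum bounds the values at almost all points only. Some point
  \<open>w\<close> of \<open>(z, 2z + 1)\<close> is among them; there the integral is larger
  than at \<open>z\<close> and the weight is smaller by a factor of at most \<open>2^a\<close>.
\<close>

lemma tail_sup_ge:
  assumes p: "p > 0" and a: "a \<ge> 0" and x: "x \<ge> 0" "x < z"
  shows "ennreal ((1 + z) powr (- a)) * exp_Lp p F {x<..<z} \<le> ennreal (2 powr a) * tail_sup p a F x"
proof -
  obtain w where w: "z < w" "w < 2 * z + 1"
    "indicator {x<..} w * (ennreal ((1 + w) powr (- a)) * exp_Lp p F {x<..<w}) \<le> tail_sup p a F x"
    using AE_half_line_ex[OF esssup_AE, of z "2 * z + 1"] x unfolding tail_sup_def by fastforce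
  have "(1 + w) powr a \<le> (2 * (1 + z)) powr a"
    using w x a by (intro powr_mono2) auto
  also have "\<dots> = 2 powr a * (1 + z) powr a"
    by (rule powr_mult)
  finally have "(1 + z) powr (- a) \<le> 2 powr a * (1 + w) powr (- a)"
    using w x by (simp add: powr_minus field_simps)
  then have "ennreal ((1 + z) powr (- a)) * exp_Lp p F {x<..<z} \<le>
      ennreal (2 powr a * (1 + w) powr (- a)) * exp_Lp p F {x<..<w}"
    using w p by (intro mult_mono ennreal_leI exp_Lp_mono) auto
  also have "\<dots> = ennreal (2 powr a) * (ennreal ((1 + w) powr (- a)) * exp_Lp p F {x<..<w})"
    by (simp add: ennreal_mult mult.assoc)
  also have "\<dots> \<le> ennreal (2 powr a) * tail_sup p a F x"
    using w x by (intro mult_left_mono) auto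
  finally show ?thesis .
qed

lemma exp_Lp_interval_le_tail_sup:
  assumes p: "p > 0" and a: "a \<ge> 0" and x: "x \<ge> 0" "x < z"
  shows "exp_Lp p F {x<..<z} \<le> ennreal ((2 * (1 + z)) powr a) * tail_sup p a F x"
proof -
  have "exp_Lp p F {x<..<z} = ennreal ((1 + z) powr a * (1 + z) powr (- a)) * exp_Lp p F {x<..<z}"
    using x by (simp add: powr_add[symmetric])
  also have "\<dots> = ennreal ((1 + z) powr a) * (ennreal ((1 + z) powr (- a)) * exp_Lp p F {x<..<z})"
    by (simp add: ennreal_mult mult.assoc)
  also have "\<dots> \<le> ennreal ((1 + z) powr a) * (ennreal (2 powr a) * tail_sup p a F x)"
    using assms by (intro mult_left_mono tail_sup_ge) auto
  also have "\<dots> = ennreal ((2 * (1 + z)) powr a) * tail_sup p a F x"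
    by (simp only: powr_mult[of 2 "1 + z"]) (simp add: ennreal_mult ac_simps)
  finally show ?thesis .
qed

lemma tail_sup_antimono:
  assumes "p > 0"
  shows "antimono (tail_sup p a F)"
proof (rule antimonoI)
  fix x y :: real assume "x \<le> y"
  then show "tail_sup p a F y \<le> tail_sup p a F x"
    unfolding tail_sup_def using assms
    by (intro esssup_mono borel_measurable_half_line)
      (auto simp: indicator_def intro!: mult_left_mono exp_Lp_mono)
qed

lemma head_int_mono:
  assumes "p > 0"
  shows "mono (head_int p c F)"
  unfolding head_int_def using assms
  by (intro monoI nn_integral_mono) (auto simp: indicator_def intro!: mult_left_mono exp_Lp_mono)

lemma head_int_le:
  assumes p: "p > 0" and c: "c > 0" and x: "x \<ge> 0"
  shows "head_int p c F x \<le> ennreal ((1 + x) powr c / c) * exp_Lp p F {0<..<x}"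
proof -
  have "head_int p c F x \<le>
      (\<integral>\<^sup>+z. ennreal ((1 + z) powr (c - 1)) * indicator {0<..<x} z * exp_Lp p F {0<..<x} \<partial>lborel)"
    unfolding head_int_def using p
    by (intro nn_integral_mono) (auto simp: indicator_def intro!: mult_left_mono exp_Lp_mono)
  also have "\<dots> = (\<integral>\<^sup>+z\<in>{0<..<x}. ennreal ((1 + z) powr (c - 1)) \<partial>lborel) * exp_Lp p F {0<..<x}"
    by (rule nn_integral_multc) measurable
  also have "\<dots> \<le> ennreal ((1 + x) powr c / c) * exp_Lp p F {0<..<x}"
    using c x by (intro mult_right_mono nn_integral_one_plus_powr_le) auto
  finally show ?thesis .
qed

text \<open>
  The supremum only sees points above \<open>x\<close>, but a nondecreasing \<open>F\<close> is
  at least \<open>F x\<close> there; this controls the part of \<open>F\<close> below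
  \<open>x\<close>.
\<close>

lemma tail_sup_ge_value:
  assumes p: "p > 0" and a: "a \<ge> 0" and x: "x \<ge> 0" and F: "mono F"
  shows "F x * ennreal (exp (- (x / p)) * (1 + x) powr (- a)) \<le>
    ennreal (exp (1 / p) * 4 powr a) * tail_sup p a F x"
proof -
  have "F x * ennreal (exp (- ((x + 1) / p))) \<le> exp_Lp p F {x<..<x + 1}"
    using p F by (intro exp_Lp_unit_interval_ge) (auto simp: mono_def)
  also have "\<dots> \<le> ennreal ((2 * (1 + (x + 1))) powr a) * tail_sup p a F x"
    using assms by (intro exp_Lp_interval_le_tail_sup) auto
  also have "\<dots> \<le> ennreal (4 powr a * (1 + x) powr a) * tail_sup p a F x"
  proof (intro mult_right_mono ennreal_leI)
    have "(2 * (1 + (x + 1))) powr a \<le> (4 * (1 + x)) powr a"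
      using x a by (intro powr_mono2) auto
    also have "\<dots> = 4 powr a * (1 + x) powr a"
      by (rule powr_mult)
    finally show "(2 * (1 + (x + 1))) powr a \<le> 4 powr a * (1 + x) powr a" .
  qed simp
  finally have "ennreal (exp (1 / p) * (1 + x) powr (- a)) * (F x * ennreal (exp (- ((x + 1) / p)))) \<le>
      ennreal (exp (1 / p) * (1 + x) powr (- a)) * (ennreal (4 powr a * (1 + x) powr a) * tail_sup p a F x)"
    by (intro mult_left_mono) auto
  also have "\<dots> = ennreal (exp (1 / p) * (1 + x) powr (- a) * (4 powr a * (1 + x) powr a)) * tail_sup p a F x"
    by (simp add: ennreal_mult mult.assoc)
  also have "exp (1 / p) * (1 + x) powr (- a) * (4 powr a * (1 + x) powr a) = exp (1 / p) * 4 powr a"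
    using x by (simp add: powr_minus field_simps)
  also have "ennreal (exp (1 / p) * (1 + x) powr (- a)) * (F x * ennreal (exp (- ((x + 1) / p)))) =
      F x * ennreal (exp (1 / p) * (1 + x) powr (- a) * exp (- ((x + 1) / p)))"
    by (simp add: ennreal_mult ac_simps)
  also have "exp (1 / p) * (1 + x) powr (- a) * exp (- ((x + 1) / p)) = exp (- (x / p)) * (1 + x) powr (- a)"
  proof -
    have "exp (1 / p) * exp (- ((x + 1) / p)) = exp (- (x / p))"
      by (simp add: exp_add[symmetric] add_divide_distrib)
    then show ?thesis
      by (simp add: ac_simps)
  qed
  finally show ?thesis .
qed

section \<open>Comparison with unit blocks\<close>

lemma block_sets [measurable]: "block y \<in> sets borel"
proof -
  have "block y = {u \<in> space borel. 0 < u \<and> y - 1 < ln (1 + u) \<and> ln (1 + u) < y + 1}"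
    by (simp add: block_def)
  also have "\<dots> \<in> sets borel"
    by measurable
  finally show ?thesis .
qed

lemma block_norm_measurable:
  assumes [measurable]: "F \<in> borel_measurable borel"
  shows "block_norm p a F \<in> borel_measurable half_line"
proof (rule borel_measurable_half_line)
  have "(\<lambda>y. \<integral>\<^sup>+u. ennreal (exp (- u)) * ennreal_powr (F u) p *
      indicator {u. 0 < u \<and> y - 1 < ln (1 + u) \<and> ln (1 + u) < y + 1} u \<partial>lborel) \<in> borel_measurable borel"
    unfolding indicator_def mem_Collect_eq by measurable
  then show "block_norm p a F \<in> borel_measurable borel"
    unfolding block_norm_def[abs_def] exp_Lp_def block_def by measurable
qed

lemma less_ln_one_plus_iff: "u > 0 \<Longrightarrow> y < ln (1 + u) \<longleftrightarrow> exp y - 1 < u" for u y :: real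
  by (smt (verit) exp_less_cancel_iff exp_ln)

lemma ln_one_plus_less_iff: "u > 0 \<Longrightarrow> ln (1 + u) < y \<longleftrightarrow> u < exp y - 1" for u y :: real
  by (smt (verit) exp_less_cancel_iff exp_ln)

lemma blocks_cover_forward:
  assumes "y > 0" "exp y - 1 < u"
  shows "\<exists>k. u \<in> block (y + real k)"
proof -
  have u: "u > 0"
    using assms by (smt (verit) one_less_exp_iff)
  then have "y < ln (1 + u)"
    using assms by (simp add: less_ln_one_plus_iff)
  define k where "k = nat \<lfloor>ln (1 + u) - y\<rfloor>"
  have "real k = of_int \<lfloor>ln (1 + u) - y\<rfloor>"
    using \<open>y < ln (1 + u)\<close> by (simp add: k_def)
  then have "u \<in> block (y + real k)"
    using u unfolding block_def by (simp, linarith)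
  then show ?thesis ..
qed

lemma blocks_cover_backward:
  assumes "0 < u" "u < exp y - 1"
  shows "\<exists>k. real k < y \<and> u \<in> block (y - real k)"
proof -
  have y: "ln (1 + u) < y"
    using assms by (simp add: ln_one_plus_less_iff)
  define k where "k = nat \<lfloor>y - ln (1 + u)\<rfloor>"
  have k: "real k = of_int \<lfloor>y - ln (1 + u)\<rfloor>"
    using y by (simp add: k_def)
  have "ln (1 + u) > 0"
    using assms by simp
  then have "real k < y" "u \<in> block (y - real k)"
    using k assms unfolding block_def by (simp_all, linarith+)
  then show ?thesis
    by blast
qed

text \<open>
  Each summand keeps the intersection with \<open>S\<close>: it vanishes unless the block meets
  \<open>S\<close>, and the position of \<open>S\<close> then bounds the weights that accompany
  the content.
\<close>

lemma exp_Lp_tail_le_blocks: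
  assumes [measurable]: "F \<in> borel_measurable borel" and p: "p \<ge> 1" and y: "y > 0"
    and S: "S \<in> sets borel" "S \<subseteq> {exp y - 1<..}"
  shows "exp_Lp p F S \<le> (\<Sum>k. exp_Lp p F (S \<inter> block (y + real k)))"
  using S p blocks_cover_forward[OF y] by (intro exp_Lp_cover) auto

lemma exp_Lp_head_le_blocks:
  assumes [measurable]: "F \<in> borel_measurable borel" and p: "p \<ge> 1"
    and S: "S \<in> sets borel" "S \<subseteq> {0<..<exp y - 1}"
  shows "exp_Lp p F S \<le> (\<Sum>k. if real k < y then exp_Lp p F (S \<inter> block (y - real k)) else 0)"
proof -
  let ?T = "\<lambda>k. if real k < y then S \<inter> block (y - real k) else {}"
  have "exp_Lp p F S \<le> (\<Sum>k. exp_Lp p F (?T k))"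
  proof (rule exp_Lp_cover)
    show "S \<subseteq> (\<Union>k. ?T k)"
    proof
      fix u assume u: "u \<in> S"
      then have "0 < u" "u < exp y - 1"
        using S(2) by auto
      from blocks_cover_backward[OF this] obtain k where "real k < y" "u \<in> block (y - real k)"
        by blast
      then show "u \<in> (\<Union>k. ?T k)"
        using u by (intro UN_I[of k]) auto
    qed
  qed (use S p in auto)
  also have "\<dots> = (\<Sum>k. if real k < y then exp_Lp p F (S \<inter> block (y - real k)) else 0)"
    by (intro suminf_cong) simp
  finally show ?thesis .
qed

lemma ennreal_exp_mult: "ennreal (exp r) * ennreal (exp s) = ennreal (exp (r + s))"
  by (simp add: ennreal_mult exp_add)

lemma exp_Lp_head_le_value:
  assumes p: "p > 0" and F_mono: "mono F"
  shows "exp_Lp p F {0<..x} \<le> F x"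
proof -
  have "exp_Lp p F {0<..x} \<le> exp_Lp p (\<lambda>_. F x) {0..}"
    using p F_mono by (intro exp_Lp_mono) (auto simp: mono_def)
  also have "\<dots> \<le> F x * ennreal (exp (- (0 / p)))"
    using p by (intro exp_Lp_const_le) auto
  finally show ?thesis
    by simp
qed

context
  fixes p a :: real and F :: "real \<Rightarrow> ennreal"
  assumes p: "p \<ge> 1" and a: "a > 0" and F_mono: "mono F"
begin

declare borel_measurable_mono_ennreal[OF F_mono, measurable]

text \<open>
  If the block around \<open>y + k\<close> meets the interval below \<open>z\<close>, then
  \<open>1 + z > e^(y+k-1)\<close>, so the weight \<open>(1 + z)^(-a)\<close> is at most the
  weight of the block, up to \<open>e^a\<close>. There is neither growth nor decay in
  \<open>k\<close>; the zero exponent gives the sum the shape of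
  \<open>norm_weighted_forward\<close>.
\<close>

lemma tail_sup_le_blocks:
  assumes y: "y > 0"
  shows "tail_sup p a F (exp y - 1) \<le>
    (\<Sum>k. ennreal (exp a * exp (0 * real k)) * block_norm p a F (y + real k))"
proof (rule tail_sup_le)
  fix z assume z: "exp y - 1 < z"
  let ?S = "{exp y - 1<..<z}"
  have "z > 0"
    using z y by (smt (verit) one_less_exp_iff)
  have "ennreal ((1 + z) powr (- a)) * exp_Lp p F ?S \<le>
      ennreal ((1 + z) powr (- a)) * (\<Sum>k. exp_Lp p F (?S \<inter> block (y + real k)))"
    using p y by (intro mult_left_mono exp_Lp_tail_le_blocks) auto
  also have "\<dots> = (\<Sum>k. ennreal ((1 + z) powr (- a)) * exp_Lp p F (?S \<inter> block (y + real k)))"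
    by simp
  also have "\<dots> \<le> (\<Sum>k. ennreal (exp a * exp (0 * real k)) * block_norm p a F (y + real k))"
  proof (intro suminf_le allI)
    fix k
    show "ennreal ((1 + z) powr (- a)) * exp_Lp p F (?S \<inter> block (y + real k)) \<le>
        ennreal (exp a * exp (0 * real k)) * block_norm p a F (y + real k)"
    proof (cases "?S \<inter> block (y + real k) = {}")
      case False
      then obtain u where u: "u < z" "0 < u" "y + real k - 1 < ln (1 + u)"
        by (auto simp: block_def)
      then have "ln (1 + u) < ln (1 + z)"
        by simp
      then have "- a * ln (1 + z) \<le> a + - (a * (y + real k))"
        using u a mult_left_mono[of "y + real k - 1" "ln (1 + z)" a] \<open>ln (1 + u) < ln (1 + z)\<close> by (simp add: algebra_simps)
      then have "(1 + z) powr (- a) \<le> exp (a + - (a * (y + real k)))"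
        using \<open>z > 0\<close> by (simp add: powr_def)
      then have "ennreal ((1 + z) powr (- a)) * exp_Lp p F (?S \<inter> block (y + real k)) \<le>
          ennreal (exp (a + - (a * (y + real k)))) * exp_Lp p F (block (y + real k))"
        using p by (intro mult_mono ennreal_leI exp_Lp_mono) auto
      then show ?thesis
        by (simp add: block_norm_def mult.assoc[symmetric] ennreal_exp_mult)
    qed simp
  qed auto
  finally show "ennreal ((1 + z) powr (- a)) * exp_Lp p F ?S \<le>
      (\<Sum>k. ennreal (exp a * exp (0 * real k)) * block_norm p a F (y + real k))" .
qed (use p y in auto)

lemma tail_norm_le_blocks:
  assumes y: "y > 0"
  shows "ennreal (exp (- (a * y))) * exp_Lp p F {exp y - 1<..} \<le>
    (\<Sum>k. ennreal (1 * exp (a * real k)) * block_norm p a F (y + real k))"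
proof -
  have "ennreal (exp (- (a * y))) * exp_Lp p F {exp y - 1<..} \<le>
      ennreal (exp (- (a * y))) * (\<Sum>k. exp_Lp p F ({exp y - 1<..} \<inter> block (y + real k)))"
    using p y by (intro mult_left_mono exp_Lp_tail_le_blocks) auto
  also have "\<dots> = (\<Sum>k. ennreal (exp (- (a * y))) * exp_Lp p F ({exp y - 1<..} \<inter> block (y + real k)))"
    by simp
  also have "\<dots> \<le> (\<Sum>k. ennreal (1 * exp (a * real k)) * block_norm p a F (y + real k))"
  proof (intro suminf_le allI)
    fix k
    have "ennreal (exp (- (a * y))) * exp_Lp p F ({exp y - 1<..} \<inter> block (y + real k)) \<le>
        ennreal (exp (a * real k + - (a * (y + real k)))) * exp_Lp p F (block (y + real k))"
      using p by (intro mult_mono ennreal_leI exp_Lp_mono) (auto simp: algebra_simps)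
    then show "ennreal (exp (- (a * y))) * exp_Lp p F ({exp y - 1<..} \<inter> block (y + real k)) \<le>
        ennreal (1 * exp (a * real k)) * block_norm p a F (y + real k)"
      by (simp only: block_norm_def mult.assoc[symmetric] ennreal_exp_mult mult_1)
  qed auto
  finally show ?thesis .
qed

lemma head_norm_le_blocks:
  "ennreal (exp (- (a * y))) * exp_Lp p F {0<..<exp y - 1} \<le>
    (\<Sum>k. ennreal (1 * exp (- a * real k)) * (if real k < y then block_norm p a F (y - real k) else 0))"
proof -
  let ?S = "{0<..<exp y - 1}"
  have "ennreal (exp (- (a * y))) * exp_Lp p F ?S \<le>
      ennreal (exp (- (a * y))) * (\<Sum>k. if real k < y then exp_Lp p F (?S \<inter> block (y - real k)) else 0)"
    using p by (intro mult_left_mono exp_Lp_head_le_blocks) auto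
  also have "\<dots> = (\<Sum>k. ennreal (exp (- (a * y))) *
      (if real k < y then exp_Lp p F (?S \<inter> block (y - real k)) else 0))"
    by simp
  also have "\<dots> \<le> (\<Sum>k. ennreal (1 * exp (- a * real k)) *
      (if real k < y then block_norm p a F (y - real k) else 0))"
  proof (intro suminf_le allI)
    fix k
    have "ennreal (exp (- (a * y))) * exp_Lp p F (?S \<inter> block (y - real k)) \<le>
        ennreal (exp (- a * real k + - (a * (y - real k)))) * exp_Lp p F (block (y - real k))"
      using p by (intro mult_mono ennreal_leI exp_Lp_mono) (auto simp: algebra_simps)
    also have "\<dots> = ennreal (1 * exp (- a * real k)) * block_norm p a F (y - real k)"
      by (simp only: block_norm_def mult.assoc[symmetric] ennreal_exp_mult mult_1)
    finally show "ennreal (exp (- (a * y))) * (if real k < y then exp_Lp p F (?S \<inter> block (y - real k)) else 0) \<le>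
        ennreal (1 * exp (- a * real k)) * (if real k < y then block_norm p a F (y - real k) else 0)"
      by simp
  qed auto
  finally show ?thesis .
qed

lemma weighted_tail_le_blocks:
  assumes y: "y > 0"
  shows "exp_Lp p (\<lambda>u. ennreal ((1 + u) powr (- a)) * F u) {exp y - 1<..} \<le>
    (\<Sum>k. ennreal (exp a * exp (0 * real k)) * block_norm p a F (y + real k))"
proof -
  let ?G = "\<lambda>u. ennreal ((1 + u) powr (- a)) * F u"
  have "exp_Lp p ?G {exp y - 1<..} \<le> (\<Sum>k. exp_Lp p ?G ({exp y - 1<..} \<inter> block (y + real k)))"
    using p y by (intro exp_Lp_tail_le_blocks) auto
  also have "\<dots> \<le> (\<Sum>k. ennreal (exp a * exp (0 * real k)) * block_norm p a F (y + real k))"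
  proof (intro suminf_le allI)
    fix k
    let ?r = "ennreal (exp (a + - (a * (y + real k))))"
    have "exp_Lp p ?G ({exp y - 1<..} \<inter> block (y + real k)) \<le>
        exp_Lp p (\<lambda>u. ?r * F u) (block (y + real k))"
    proof (rule exp_Lp_mono)
      fix u assume "u \<in> {exp y - 1<..} \<inter> block (y + real k)"
      then have u: "0 < u" "y + real k - 1 < ln (1 + u)"
        by (auto simp: block_def)
      then have "- a * ln (1 + u) \<le> a + - (a * (y + real k))"
        using a mult_left_mono[of "y + real k - 1" "ln (1 + u)" a] by (simp add: algebra_simps)
      then show "?G u \<le> ?r * F u"
        using u by (intro mult_right_mono ennreal_leI) (auto simp: powr_def)
    qed (use p in auto)
    also have "\<dots> = ?r * exp_Lp p F (block (y + real k))"
      using p by (intro exp_Lp_cmult) auto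
    finally show "exp_Lp p ?G ({exp y - 1<..} \<inter> block (y + real k)) \<le>
        ennreal (exp a * exp (0 * real k)) * block_norm p a F (y + real k)"
      by (simp add: block_norm_def mult.assoc[symmetric] ennreal_exp_mult)
  qed auto
  finally show ?thesis .
qed

text \<open>
  The block around \<open>y - k\<close> contributes to the content of \<open>(z, x)\<close> only
  if \<open>1 + z < e^(y-k+1)\<close>, and the integral of \<open>(1 + z)^(c-1)\<close> over
  these \<open>z\<close> is at most \<open>e^(c(y-k+1)) / c\<close>.
\<close>

lemma head_int_le_blocks:
  assumes c: "c > 0" and y: "y > 0"
  shows "ennreal (exp (- ((a + c) * y))) * head_int p c F (exp y - 1) \<le>
    (\<Sum>k. ennreal (exp c / c * exp (- (a + c) * real k)) *
      (if real k < y then block_norm p a F (y - real k) else 0))"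
proof -
  let ?X = "exp y - 1"
  let ?J = "\<lambda>k. exp (y - real k + 1) - 1"
  let ?w = "\<lambda>z. ennreal ((1 + z) powr (c - 1))"
  let ?e = "\<lambda>k. if real k < y then exp_Lp p F (block (y - real k)) else 0"
  have pointwise: "?w z * exp_Lp p F {z<..<?X} * indicator {0<..<?X} z \<le>
      (\<Sum>k. ?w z * indicator {0<..<?J k} z * ?e k)" for z
  proof (cases "z \<in> {0<..<?X}")
    case True
    have "exp_Lp p F {z<..<?X} \<le>
        (\<Sum>k. if real k < y then exp_Lp p F ({z<..<?X} \<inter> block (y - real k)) else 0)"
      using p True by (intro exp_Lp_head_le_blocks) auto
    also have "\<dots> \<le> (\<Sum>k. indicator {0<..<?J k} z * ?e k)"
    proof (intro suminf_le allI)
      fix k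
      show "(if real k < y then exp_Lp p F ({z<..<?X} \<inter> block (y - real k)) else 0) \<le>
          indicator {0<..<?J k} z * ?e k"
      proof (cases "{z<..<?X} \<inter> block (y - real k) = {}")
        case False
        then obtain u where u: "z < u" "0 < u" "ln (1 + u) < y - real k + 1"
          by (auto simp: block_def)
        then have "z \<in> {0<..<?J k}"
          using True ln_one_plus_less_iff[of u "y - real k + 1"] by auto
        then show ?thesis
          using p by (auto intro!: exp_Lp_mono)
      qed auto
    qed auto
    finally have "?w z * exp_Lp p F {z<..<?X} \<le> ?w z * (\<Sum>k. indicator {0<..<?J k} z * ?e k)"
      by (intro mult_left_mono) auto
    also have "\<dots> = (\<Sum>k. ?w z * indicator {0<..<?J k} z * ?e k)"
      by (simp add: mult.assoc)
    finally show ?thesis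
      using True by simp
  qed simp
  have "head_int p c F ?X \<le> (\<integral>\<^sup>+z. (\<Sum>k. ?w z * indicator {0<..<?J k} z * ?e k) \<partial>lborel)"
    unfolding head_int_def by (intro nn_integral_mono pointwise)
  also have "\<dots> = (\<Sum>k. \<integral>\<^sup>+z. ?w z * indicator {0<..<?J k} z * ?e k \<partial>lborel)"
    by (rule nn_integral_suminf) measurable
  also have "\<dots> \<le> (\<Sum>k. ennreal (exp (c * (y - real k + 1)) / c) * ?e k)"
  proof (intro suminf_le allI)
    fix k
    show "(\<integral>\<^sup>+z. ?w z * indicator {0<..<?J k} z * ?e k \<partial>lborel) \<le>
        ennreal (exp (c * (y - real k + 1)) / c) * ?e k"
    proof (cases "real k < y")
      case True
      have "(\<integral>\<^sup>+z. ?w z * indicator {0<..<?J k} z * ?e k \<partial>lborel) =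
          (\<integral>\<^sup>+z. ?w z * indicator {0<..<?J k} z \<partial>lborel) * ?e k"
        by (rule nn_integral_multc) measurable
      also have "\<dots> \<le> ennreal ((1 + ?J k) powr c / c) * ?e k"
        using c True by (intro mult_right_mono nn_integral_one_plus_powr_le) auto
      finally show ?thesis
        by (simp add: powr_def)
    qed simp
  qed auto
  finally have "ennreal (exp (- ((a + c) * y))) * head_int p c F ?X \<le>
      ennreal (exp (- ((a + c) * y))) * (\<Sum>k. ennreal (exp (c * (y - real k + 1)) / c) * ?e k)"
    by (intro mult_left_mono) auto
  also have "\<dots> = (\<Sum>k. ennreal (exp (- ((a + c) * y))) * (ennreal (exp (c * (y - real k + 1)) / c) * ?e k))"
    by simp
  also have "\<dots> = (\<Sum>k. ennreal (exp c / c * exp (- (a + c) * real k)) *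
      (if real k < y then block_norm p a F (y - real k) else 0))"
  proof (intro suminf_cong)
    fix k
    have "- ((a + c) * y) + c * (y - real k + 1) = c + - (a + c) * real k + - (a * (y - real k))"
      by (simp add: algebra_simps)
    then have "exp (- ((a + c) * y)) * exp (c * (y - real k + 1)) =
        exp c * exp (- (a + c) * real k) * exp (- (a * (y - real k)))"
      by (simp only: exp_add[symmetric])
    then have "ennreal (exp (- ((a + c) * y))) * ennreal (exp (c * (y - real k + 1)) / c) =
        ennreal (exp c / c * exp (- (a + c) * real k)) * ennreal (exp (- (a * (y - real k))))"
      using c by (subst (1 2) ennreal_mult[symmetric]) (auto simp: field_simps)
    then show "ennreal (exp (- ((a + c) * y))) * (ennreal (exp (c * (y - real k + 1)) / c) * ?e k) =
        ennreal (exp c / c * exp (- (a + c) * real k)) * (if real k < y then block_norm p a F (y - real k) else 0)"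
      by (simp add: block_norm_def mult.assoc[symmetric])
  qed
  finally show ?thesis .
qed

lemma block_norm_le_head_norm:
  "block_norm p a F y \<le> ennreal (exp a) *
    (ennreal (exp (- (a * (y + 1)))) * exp_Lp p F {0<..<exp (y + 1) - 1})"
proof -
  have "block y \<subseteq> {0<..<exp (y + 1) - 1}"
    by (auto simp: block_def ln_one_plus_less_iff)
  then have "block_norm p a F y \<le> ennreal (exp (- (a * y))) * exp_Lp p F {0<..<exp (y + 1) - 1}"
    unfolding block_norm_def using p by (intro mult_left_mono exp_Lp_mono) auto
  also have "ennreal (exp (- (a * y))) = ennreal (exp a) * ennreal (exp (- (a * (y + 1))))"
    by (simp add: ennreal_exp_mult algebra_simps)
  finally show ?thesis
    by (simp add: mult.assoc)
qed

lemma block_norm_le_tail_sup: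
  assumes y: "y > 1"
  shows "block_norm p a F y \<le> ennreal (2 powr a * exp a) * tail_sup p a F (exp (y - 1) - 1)"
proof -
  have "block y \<subseteq> {exp (y - 1) - 1<..<exp (y + 1) - 1}"
    by (auto simp: block_def ln_one_plus_less_iff less_ln_one_plus_iff)
  then have "exp_Lp p F (block y) \<le> exp_Lp p F {exp (y - 1) - 1<..<exp (y + 1) - 1}"
    using p by (intro exp_Lp_mono) auto
  also have "\<dots> \<le> ennreal ((2 * (1 + (exp (y + 1) - 1))) powr a) * tail_sup p a F (exp (y - 1) - 1)"
    using p a y by (intro exp_Lp_interval_le_tail_sup) auto
  finally have "block_norm p a F y \<le> ennreal (exp (- (a * y))) *
      (ennreal ((2 * exp (y + 1)) powr a) * tail_sup p a F (exp (y - 1) - 1))"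
    unfolding block_norm_def by (intro mult_left_mono) auto
  also have "\<dots> = ennreal (exp (- (a * y)) * (2 * exp (y + 1)) powr a) * tail_sup p a F (exp (y - 1) - 1)"
    by (simp add: ennreal_mult mult.assoc)
  also have "exp (- (a * y)) * (2 * exp (y + 1)) powr a = 2 powr a * (exp (- (a * y)) * exp (a * (y + 1)))"
    by (simp only: powr_mult) (simp add: powr_def)
  also have "exp (- (a * y)) * exp (a * (y + 1)) = exp a"
    by (simp add: exp_add[symmetric] algebra_simps)
  finally show ?thesis .
qed

text \<open>
  The constant grows with \<open>x\<close>, so the bound serves only for bounded
  \<open>x\<close> and to deduce finiteness.
\<close>

lemma exp_Lp_head_le_tail_sup:
  assumes x: "x \<ge> 0"
  shows "exp_Lp p F {0<..x} \<le> ennreal (exp ((x + 1) / p) * (4 * (1 + x)) powr a) * tail_sup p a F x"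
proof -
  have "F x = ennreal (exp (x / p) * (1 + x) powr a) * (F x * ennreal (exp (- (x / p)) * (1 + x) powr (- a)))"
  proof -
    have "exp (x / p) * (1 + x) powr a * (exp (- (x / p)) * (1 + x) powr (- a)) = 1"
    proof -
      have "exp (x / p) * exp (- (x / p)) = 1" "(1 + x) powr a * (1 + x) powr (- a) = 1"
        using x by (simp_all add: exp_add[symmetric] powr_add[symmetric])
      moreover have "exp (x / p) * (1 + x) powr a * (exp (- (x / p)) * (1 + x) powr (- a)) =
          (exp (x / p) * exp (- (x / p))) * ((1 + x) powr a * (1 + x) powr (- a))"
        by (simp only: ac_simps)
      ultimately show ?thesis
        by simp
    qed
    then have "ennreal (exp (x / p) * (1 + x) powr a) * ennreal (exp (- (x / p)) * (1 + x) powr (- a)) = 1"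
      by (subst ennreal_mult[symmetric]) auto
    then show ?thesis
      by (metis mult.commute mult.left_commute mult_1)
  qed
  also have "\<dots> \<le> ennreal (exp (x / p) * (1 + x) powr a) * (ennreal (exp (1 / p) * 4 powr a) * tail_sup p a F x)"
    using p a x F_mono by (intro mult_left_mono tail_sup_ge_value) auto
  also have "\<dots> = ennreal (exp (x / p) * (1 + x) powr a * (exp (1 / p) * 4 powr a)) * tail_sup p a F x"
    by (simp add: ennreal_mult mult.assoc)
  also have "exp (x / p) * (1 + x) powr a * (exp (1 / p) * 4 powr a) = exp ((x + 1) / p) * (4 * (1 + x)) powr a"
    by (simp only: powr_mult add_divide_distrib exp_add ac_simps)
  finally show ?thesis
    using exp_Lp_head_le_value[of p F x] p F_mono by (auto elim: order_trans)
qed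

lemma block_norm_le_tail_sup_near_zero:
  assumes y: "0 < y" "y \<le> 1"
  shows "block_norm p a F y \<le>
    ennreal (exp (exp 1 / p) * (4 * exp 1) powr a + (2 * exp 2) powr a) * tail_sup p a F (exp y - 1)"
proof -
  define x where "x = exp y - 1"
  have x: "0 < x" "x \<le> exp 1 - 1"
    using y by (auto simp: x_def)
  let ?z = "exp (y + 1) - 1"
  have "block_norm p a F y \<le> 1 * exp_Lp p F (block y)"
    unfolding block_norm_def using y a by (intro mult_right_mono) auto
  also have "\<dots> \<le> exp_Lp p F {0<..x} + exp_Lp p F {x<..<?z}"
    using p by (simp, intro exp_Lp_Un) (auto simp: block_def ln_one_plus_less_iff)
  also have "\<dots> \<le> ennreal (exp ((x + 1) / p) * (4 * (1 + x)) powr a) * tail_sup p a F x +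
      ennreal ((2 * (1 + ?z)) powr a) * tail_sup p a F x"
    using p a x by (intro add_mono exp_Lp_head_le_tail_sup exp_Lp_interval_le_tail_sup)
      (auto simp: x_def)
  also have "\<dots> \<le> ennreal (exp (exp 1 / p) * (4 * exp 1) powr a) * tail_sup p a F x +
      ennreal ((2 * exp 2) powr a) * tail_sup p a F x"
  proof (intro add_mono mult_right_mono ennreal_leI mult_mono)
    show "exp ((x + 1) / p) \<le> exp (exp 1 / p)"
      using x p by (simp add: divide_right_mono)
    show "(4 * (1 + x)) powr a \<le> (4 * exp 1) powr a" "(2 * (1 + ?z)) powr a \<le> (2 * exp 2) powr a"
      using x a y by (auto intro!: powr_mono2)
  qed auto
  also have "\<dots> = ennreal (exp (exp 1 / p) * (4 * exp 1) powr a + (2 * exp 2) powr a) * tail_sup p a F x"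
    by (subst ennreal_plus) (auto simp: distrib_right)
  finally show ?thesis
    by (simp add: x_def)
qed

text \<open>
  For \<open>y > 1\<close> the block lies to the right of \<open>e^(y-1) - 1\<close>, and the
  term \<open>k = 1\<close> suffices. For \<open>y \<le> 1\<close> the part of the block below
  \<open>e^y - 1\<close> has no translate of the supremum to its left, but it is controlled
  through the monotonicity of \<open>F\<close>, and the term \<open>k = 0\<close> suffices.
\<close>

lemma block_norm_le_shifted_tail_sup:
  assumes y: "y > 0"
  shows "block_norm p a F y \<le>
    (\<Sum>k. ennreal ((exp (exp 1 / p) * (4 * exp 1) powr a + (2 * exp 2) powr a + 2 powr a * exp (a + s)) *
        exp (- s * real k)) *
      (if real k < y then tail_sup p a F (exp (y - real k) - 1) else 0))"
    (is "_ \<le> (\<Sum>k. ?f k)")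
proof -
  have term_le: "?f k \<le> (\<Sum>k. ?f k)" for k
    using sum_le_suminf[of ?f "{k}"] by simp
  show ?thesis
  proof (cases "y \<le> 1")
    case True
    have "block_norm p a F y \<le> ?f 0"
      using block_norm_le_tail_sup_near_zero[OF y True] y
      by (elim order_trans) (auto intro!: mult_right_mono ennreal_leI)
    then show ?thesis
      using term_le[of 0] by (rule order_trans)
  next
    case False
    have "2 powr a * exp a = 2 powr a * exp (a + s) * exp (- s)"
      by (simp add: mult.assoc exp_add[symmetric])
    also have "\<dots> \<le> (exp (exp 1 / p) * (4 * exp 1) powr a + (2 * exp 2) powr a + 2 powr a * exp (a + s)) * exp (- s)"
      by (intro mult_right_mono) auto
    finally have le: "2 powr a * exp a \<le> \<dots>" .
    have "block_norm p a F y \<le> ?f 1"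
      by (rule order_trans[OF block_norm_le_tail_sup])
        (use False le in \<open>auto intro!: mult_right_mono ennreal_leI\<close>)
    then show ?thesis
      using term_le[of 1] by (rule order_trans)
  qed
qed

lemma tail_sup_le_tail_norm:
  assumes x: "x \<ge> 0"
  shows "tail_sup p a F x \<le> ennreal ((1 + x) powr (- a)) * exp_Lp p F {x<..}"
proof (rule tail_sup_le)
  fix z assume z: "x < z"
  have "(1 + z) powr (- a) \<le> (1 + x) powr (- a)"
    using z x a by (intro powr_mono2') auto
  then show "ennreal ((1 + z) powr (- a)) * exp_Lp p F {x<..<z} \<le>
      ennreal ((1 + x) powr (- a)) * exp_Lp p F {x<..}"
    using p by (intro mult_mono ennreal_leI exp_Lp_mono) auto
qed (use p x in auto)

lemma tail_sup_le_weighted_tail: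
  assumes x: "x \<ge> 0"
  shows "tail_sup p a F x \<le> exp_Lp p (\<lambda>u. ennreal ((1 + u) powr (- a)) * F u) {x<..}"
proof (rule tail_sup_le)
  fix z assume z: "x < z"
  have "ennreal ((1 + z) powr (- a)) * exp_Lp p F {x<..<z} =
      exp_Lp p (\<lambda>u. ennreal ((1 + z) powr (- a)) * F u) {x<..<z}"
    using p by (intro exp_Lp_cmult[symmetric]) auto
  also have "\<dots> \<le> exp_Lp p (\<lambda>u. ennreal ((1 + u) powr (- a)) * F u) {x<..}"
    using p a x by (intro exp_Lp_mono mult_right_mono ennreal_leI powr_mono2') auto
  finally show "ennreal ((1 + z) powr (- a)) * exp_Lp p F {x<..<z} \<le>
      exp_Lp p (\<lambda>u. ennreal ((1 + u) powr (- a)) * F u) {x<..}" .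
qed (use p x in auto)

text \<open>
  Bounding all contents under the integral by the largest one leaves \<open>\<integral> (1 +
  z)^(c-1) dz\<close>.
\<close>

lemma head_int_le_head_norm:
  assumes c: "c > 0" and y: "y > 0"
  shows "ennreal (exp (- ((a + c) * y))) * head_int p c F (exp y - 1) \<le>
    ennreal (1 / c) * (ennreal (exp (- (a * y))) * exp_Lp p F {0<..<exp y - 1})"
proof -
  have "ennreal (exp (- ((a + c) * y))) * head_int p c F (exp y - 1) \<le>
      ennreal (exp (- ((a + c) * y))) * (ennreal ((1 + (exp y - 1)) powr c / c) * exp_Lp p F {0<..<exp y - 1})"
    using p c y by (intro mult_left_mono head_int_le) auto
  also have "\<dots> = ennreal (exp (- ((a + c) * y)) * ((1 + (exp y - 1)) powr c / c)) * exp_Lp p F {0<..<exp y - 1}"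
    using c by (subst ennreal_mult) (simp_all add: mult.assoc)
  also have "exp (- ((a + c) * y)) * ((1 + (exp y - 1)) powr c / c) = 1 / c * exp (- (a * y))"
    by (simp add: powr_def exp_add[symmetric] algebra_simps)
  also have "ennreal (1 / c * exp (- (a * y))) = ennreal (1 / c) * ennreal (exp (- (a * y)))"
    using c by (intro ennreal_mult) auto
  finally show ?thesis
    by (simp only: mult.assoc)
qed

end

section \<open>Rearrangements\<close>

lemma rearrangement_antimono: "antimono (rearrangement M f)"
  unfolding rearrangement_def
  by (intro antimonoI Inf_superset_mono) (blast intro: order_trans ennreal_leI)

lemma rearrangement_le:
  "r \<ge> 0 \<Longrightarrow> emeasure M {x \<in> space M. norm (f x) > r} \<le> ennreal t \<Longrightarrow> rearrangement M f t \<le> ennreal r"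
  unfolding rearrangement_def by (intro Inf_lower) auto

lemma rearrangement_mono:
  assumes [measurable]: "f \<in> borel_measurable M"
    and le: "\<And>x. x \<in> space M \<Longrightarrow> norm (g x) \<le> norm (f x)"
  shows "rearrangement M g t \<le> rearrangement M f t"
  unfolding rearrangement_def
proof (rule Inf_superset_mono, safe)
  fix r :: real assume r: "r \<ge> 0" "emeasure M {x \<in> space M. r < norm (f x)} \<le> ennreal t"
  have "emeasure M {x \<in> space M. r < norm (g x)} \<le> emeasure M {x \<in> space M. r < norm (f x)}"
    using le by (intro emeasure_mono) (auto intro: less_le_trans)
  then show "\<exists>r'. ennreal r = ennreal r' \<and> 0 \<le> r' \<and> emeasure M {x \<in> space M. r' < norm (g x)} \<le> ennreal t"
    using r by (intro exI[of _ r]) auto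
qed

lemma (in finite_measure) rearrangement_finite:
  assumes [measurable]: "f \<in> borel_measurable M" and t: "t > 0"
  shows "rearrangement M f t < \<infinity>"
proof -
  let ?A = "\<lambda>n::nat. {x \<in> space M. norm (f x) > real n}"
  have "(\<lambda>n. emeasure M (?A n)) \<longlonglongrightarrow> emeasure M (\<Inter>n. ?A n)"
    by (intro Lim_emeasure_decseq) (auto simp: decseq_def)
  moreover have "(\<Inter>n. ?A n) = {}"
  proof safe
    fix x assume *: "x \<in> (\<Inter>n. ?A n)"
    obtain n where "norm (f x) < real n"
      using reals_Archimedean2 by blast
    moreover have "x \<in> ?A n"
      using * by blast
    ultimately show "x \<in> {}"
      by simp
  qed
  ultimately have "(\<lambda>n. emeasure M (?A n)) \<longlonglongrightarrow> 0"
    by simp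
  then have "\<forall>\<^sub>F n in sequentially. emeasure M (?A n) < ennreal t"
    using t by (intro order_tendstoD(2)) auto
  then obtain n where "emeasure M (?A n) < ennreal t"
    by (auto simp: eventually_sequentially)
  then have "rearrangement M f t \<le> ennreal (real n)"
    by (intro rearrangement_le) auto
  then show ?thesis
    by (simp add: le_less_trans)
qed

text \<open>
  The infimum that defines the rearrangement is attained, by continuity from below of the
  measure.
\<close>

lemma emeasure_above_rearrangement:
  assumes [measurable]: "f \<in> borel_measurable M" and r: "r \<ge> 0" "rearrangement M f t = ennreal r"
  shows "emeasure M {x \<in> space M. norm (f x) > r} \<le> ennreal t"
proof -
  let ?A = "\<lambda>n::nat. {x \<in> space M. norm (f x) > r + 1 / (real n + 1)}"
  have "incseq ?A"
  proof (rule incseq_SucI)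
    fix n
    have "1 / (real (Suc n) + 1) \<le> 1 / (real n + 1)"
      by (intro divide_left_mono) auto
    then show "?A n \<le> ?A (Suc n)"
      by auto
  qed
  then have "(SUP n. emeasure M (?A n)) = emeasure M (\<Union>n. ?A n)"
    by (intro SUP_emeasure_incseq) auto
  moreover have "(\<Union>n. ?A n) = {x \<in> space M. norm (f x) > r}"
  proof (intro equalityI subsetI)
    fix x assume x: "x \<in> {x \<in> space M. norm (f x) > r}"
    then obtain n where "inverse (real (Suc n)) < norm (f x) - r"
      using reals_Archimedean[of "norm (f x) - r"] by auto
    then have "x \<in> ?A n"
      using x by (auto simp: inverse_eq_divide algebra_simps)
    then show "x \<in> (\<Union>n. ?A n)"
      by blast
  next
    fix x assume "x \<in> (\<Union>n. ?A n)"
    then obtain n where "x \<in> space M" "norm (f x) > r + 1 / (real n + 1)"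
      by auto
    moreover have "r < r + 1 / (real n + 1)"
      by simp
    ultimately have "x \<in> space M" "r < norm (f x)"
      by (blast, linarith)
    then show "x \<in> {x \<in> space M. norm (f x) > r}"
      by simp
  qed
  moreover have "emeasure M (?A n) \<le> ennreal t" for n
  proof -
    have "rearrangement M f t < ennreal (r + 1 / (real n + 1))"
      using r by (simp add: ennreal_less_iff)
    then obtain s where s: "s \<ge> 0" "emeasure M {x \<in> space M. norm (f x) > s} \<le> ennreal t"
      "ennreal s < ennreal (r + 1 / (real n + 1))"
      unfolding rearrangement_def Inf_less_iff by auto
    then have "s < r + 1 / (real n + 1)"
      by (simp add: ennreal_less_iff)
    then have "emeasure M (?A n) \<le> emeasure M {x \<in> space M. norm (f x) > s}"
      by (intro emeasure_mono) auto
    with s(2) show ?thesis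
      by (rule order_trans[rotated])
  qed
  ultimately show ?thesis
    by (metis (no_types, lifting) SUP_least)
qed

lemma le_add_Inf_ennreal:
  fixes x y :: ennreal
  assumes "\<And>s. s \<in> S \<Longrightarrow> x \<le> y + s"
  shows "x \<le> y + Inf S"
proof (cases "y = \<infinity>")
  case False
  then have y: "y < top"
    by (simp add: less_top)
  have "x - y \<le> s" if "s \<in> S" for s
    using assms[OF that] y by (auto simp: ennreal_minus_le_iff add.commute)
  then have "x - y \<le> Inf S"
    by (rule Inf_greatest)
  then show ?thesis
    using y by (auto simp: ennreal_minus_le_iff add.commute)
qed simp

text \<open>
  If \<open>\<bar>g + h\<bar> > r + s\<close> then \<open>\<bar>g\<bar> > r\<close> or
  \<open>\<bar>h\<bar> > s\<close>, so levels that are admissible for \<open>g\<close> and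
  \<open>h\<close> at \<open>t / 2\<close> add up to a level that is admissible for the sum at
  \<open>t\<close>.
\<close>

lemma rearrangement_add_le:
  assumes [measurable]: "f \<in> borel_measurable M" "g \<in> borel_measurable M" "h \<in> borel_measurable M"
    and ae: "AE x in M. f x = g x + h x" and t: "t \<ge> 0"
  shows "rearrangement M f t \<le> rearrangement M g (t / 2) + rearrangement M h (t / 2)"
proof -
  have *: "rearrangement M f t \<le> ennreal s + ennreal r"
    if r: "r \<ge> 0" "emeasure M {x \<in> space M. norm (g x) > r} \<le> ennreal (t / 2)"
      and s: "s \<ge> 0" "emeasure M {x \<in> space M. norm (h x) > s} \<le> ennreal (t / 2)" for r s
  proof -
    have "emeasure M {x \<in> space M. norm (f x) > s + r} \<le>
        emeasure M ({x \<in> space M. norm (g x) > r} \<union> {x \<in> space M. norm (h x) > s})"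
    proof (rule emeasure_mono_AE)
      show "AE x in M. x \<in> {x \<in> space M. norm (f x) > s + r} \<longrightarrow>
          x \<in> {x \<in> space M. norm (g x) > r} \<union> {x \<in> space M. norm (h x) > s}"
        using ae
      proof eventually_elim
        case (elim x)
        then show ?case
          using norm_triangle_ineq[of "g x" "h x"] by auto
      qed
    qed measurable
    also have "\<dots> \<le> emeasure M {x \<in> space M. norm (g x) > r} + emeasure M {x \<in> space M. norm (h x) > s}"
      by (intro emeasure_subadditive) measurable
    also have "\<dots> \<le> ennreal (t / 2) + ennreal (t / 2)"
      using r s by (intro add_mono)
    also have "\<dots> = ennreal t"
      using t by (subst ennreal_plus[symmetric]) auto
    finally have "rearrangement M f t \<le> ennreal (s + r)"
      using r s by (intro rearrangement_le) auto
    then show ?thesis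
      using r s by simp
  qed
  have "rearrangement M f t \<le> ennreal r + rearrangement M h (t / 2)"
    if "r \<ge> 0" "emeasure M {x \<in> space M. norm (g x) > r} \<le> ennreal (t / 2)" for r
    unfolding rearrangement_def[of M h]
    using *[OF that] by (intro le_add_Inf_ennreal) (auto simp: add.commute)
  then have "rearrangement M f t \<le> rearrangement M h (t / 2) + rearrangement M g (t / 2)"
    unfolding rearrangement_def[of M g] by (intro le_add_Inf_ennreal) (auto simp: add.commute)
  then show ?thesis
    by (simp add: add.commute)
qed

definition log_rearr ::
    "'a measure \<Rightarrow> ('a \<Rightarrow> 'k::{real_normed_field, second_countable_topology}) \<Rightarrow> real \<Rightarrow> ennreal"
  where
  "log_rearr M f u = rearrangement M f (exp (- u))"

lemma log_rearr_mono: "mono (log_rearr M f)"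
  using rearrangement_antimono[of M f] by (auto simp: log_rearr_def mono_def antimono_def)

lemma log_rearr_measurable [measurable]: "log_rearr M f \<in> borel_measurable borel"
  using log_rearr_mono by (rule borel_measurable_mono_ennreal)

section \<open>Norms in logarithmic variables\<close>

lemma ennreal_powr_indicator: "ennreal_powr (indicator S u) r = indicator S u"
  by (simp add: indicator_def ennreal_powr_def)

lemma ell_exp: "u \<ge> 0 \<Longrightarrow> ell (exp (- u)) = 1 + u"
  by (simp add: ell_def)

lemma tilde_Lp_eq:
  assumes p: "p > 0" and w: "\<And>t. w t \<ge> 0" and [measurable]: "w \<in> borel_measurable borel"
  shows "tilde_norm (Lp_norm p) l r (weighted_rearr M p w f) =
    exp_Lp p (\<lambda>u. ennreal (w (exp (- u))) * log_rearr M f u) {u. 0 < u \<and> l < exp (- u) \<and> exp (- u) < r}"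
proof -
  let ?F = "\<lambda>u. ennreal (w (exp (- u))) * log_rearr M f u"
  let ?g = "\<lambda>u. indicator {l<..<r} (exp (- u)) * (ennreal (exp (- u)) * ennreal_powr (?F u) p)"
  have "tilde_norm (Lp_norm p) l r (weighted_rearr M p w f) =
      ennreal_powr (\<integral>\<^sup>+u. ?g u \<partial>half_line) (1 / p)"
  proof -
    have "ennreal_powr (indicator {l<..<r} (exp (- u)) * weighted_rearr M p w f (exp (- u))) p = ?g u" for u
    proof -
      have "ennreal (exp (- u) powr (1 / p) * w (exp (- u))) =
          ennreal (exp (- u) powr (1 / p)) * ennreal (w (exp (- u)))"
        using w by (intro ennreal_mult) auto
      then show ?thesis
        using p by (simp add: weighted_rearr_def log_rearr_def[symmetric] ennreal_powr_indicator
            ennreal_powr_mult ennreal_powr_ennreal powr_powr mult.assoc)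
    qed
    then show ?thesis
      by (simp add: tilde_norm_def Lp_norm_def)
  qed
  also have "(\<integral>\<^sup>+u. ?g u \<partial>half_line) = (\<integral>\<^sup>+u. ?g u * indicator {0<..} u \<partial>lborel)"
    by (rule nn_integral_half_line) measurable
  also have "\<dots> = (\<integral>\<^sup>+u\<in>{u. 0 < u \<and> l < exp (- u) \<and> exp (- u) < r}.
      ennreal (exp (- u)) * ennreal_powr (?F u) p \<partial>lborel)"
    by (intro nn_integral_cong) (auto simp: indicator_def)
  finally show ?thesis
    by (simp add: exp_Lp_def)
qed

lemma tilde_Lp_between:
  assumes "p > 0" "x \<ge> 0"
  shows "tilde_norm (Lp_norm p) (exp (- z)) (exp (- x)) (weighted_rearr M p (\<lambda>_. 1) f) =
    exp_Lp p (log_rearr M f) {x<..<z}"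
proof -
  have "{u. 0 < u \<and> exp (- z) < exp (- u) \<and> exp (- u) < exp (- x)} = {x<..<z}"
    using assms by auto
  then show ?thesis
    using assms by (subst tilde_Lp_eq) auto
qed

lemma tilde_Lp_tail:
  assumes "p > 0" "x \<ge> 0" "\<And>t. w t \<ge> 0" "w \<in> borel_measurable borel"
  shows "tilde_norm (Lp_norm p) 0 (exp (- x)) (weighted_rearr M p w f) =
    exp_Lp p (\<lambda>u. ennreal (w (exp (- u))) * log_rearr M f u) {x<..}"
proof -
  have "{u. 0 < u \<and> 0 < exp (- u) \<and> exp (- u) < exp (- x)} = {x<..}"
    using assms by auto
  then show ?thesis
    using assms by (subst tilde_Lp_eq) auto
qed

lemma Linf_norm_cong:
  assumes "\<And>u. u > 0 \<Longrightarrow> f u = g u"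
  shows "Linf_norm f = Linf_norm g"
proof -
  have "f \<in> borel_measurable half_line \<longleftrightarrow> g \<in> borel_measurable half_line"
    using assms by (intro measurable_cong) auto
  then show ?thesis
    unfolding Linf_norm_def using assms
    by (cases "f \<in> borel_measurable half_line")
      (auto simp: esssup_non_measurable intro!: esssup_AE_cong AE_half_line_I)
qed

lemma L1_norm_eq:
  assumes "\<And>u. u > 0 \<Longrightarrow> f u = g u" and [measurable]: "g \<in> borel_measurable borel"
  shows "Lp_norm 1 f = (\<integral>\<^sup>+u\<in>{0<..}. g u \<partial>lborel)"
proof -
  have "Lp_norm 1 f = (\<integral>\<^sup>+u. g u \<partial>half_line)"
    unfolding Lp_norm_def using assms(1) by (simp, intro nn_integral_cong) auto
  then show ?thesis
    by (simp add: nn_integral_half_line)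
qed

lemma tilde_Linf_eq_tail_sup:
  assumes p: "p > 0" and x: "x \<ge> 0"
  shows "tilde_norm Linf_norm 0 (exp (- x)) (\<lambda>t. ennreal (ell t powr (- a)) *
      tilde_norm (Lp_norm p) t (exp (- x)) (weighted_rearr M p (\<lambda>_. 1) f)) =
    tail_sup p a (log_rearr M f) x"
  unfolding tilde_norm_def[of Linf_norm] tail_sup_def Linf_norm_def[symmetric]
proof (rule Linf_norm_cong)
  fix u :: real assume "u > 0"
  then show "indicator {0<..<exp (- x)} (exp (- u)) * (ennreal (ell (exp (- u)) powr (- a)) *
      tilde_norm (Lp_norm p) (exp (- u)) (exp (- x)) (weighted_rearr M p (\<lambda>_. 1) f)) =
    indicator {x<..} u * (ennreal ((1 + u) powr (- a)) * exp_Lp p (log_rearr M f) {x<..<u})"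
    using assms by (simp add: tilde_Lp_between ell_exp indicator_def)
qed

lemma tilde_L1_eq_head_int:
  assumes p: "p > 0" and x: "x \<ge> 0"
  shows "tilde_norm (Lp_norm 1) (exp (- x)) 1 (\<lambda>t. ennreal (ell t powr (c - 1)) *
      tilde_norm (Lp_norm p) (exp (- x)) t (weighted_rearr M p (\<lambda>_. 1) f)) =
    head_int p c (log_rearr M f) x"
proof -
  note [measurable] = exp_Lp_interval_measurable[OF p]
  have "tilde_norm (Lp_norm 1) (exp (- x)) 1 (\<lambda>t. ennreal (ell t powr (c - 1)) *
      tilde_norm (Lp_norm p) (exp (- x)) t (weighted_rearr M p (\<lambda>_. 1) f)) =
    (\<integral>\<^sup>+z\<in>{0<..}. indicator {0<..<x} z *
      (ennreal ((1 + z) powr (c - 1)) * exp_Lp p (log_rearr M f) {z<..<x}) \<partial>lborel)"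
    unfolding tilde_norm_def[of "Lp_norm 1"]
    by (rule L1_norm_eq) (use assms in \<open>auto simp: tilde_Lp_between ell_exp indicator_def\<close>)
  also have "\<dots> = head_int p c (log_rearr M f) x"
    unfolding head_int_def by (intro nn_integral_cong) (auto simp: indicator_def)
  finally show ?thesis .
qed

lemma grand_norm_eq: "p > 0 \<Longrightarrow> grand_norm M p \<alpha> f = tail_sup p (\<alpha> / p) (log_rearr M f) 0"
  using tilde_Linf_eq_tail_sup[of p 0 "\<alpha> / p" M f] by (simp add: grand_norm_def)

lemma small_norm_eq:
  assumes p: "p > 0"
  shows "small_norm M p \<beta> f = full_int p (\<beta> / conjugate_exponent p) (log_rearr M f)"
proof -
  note [measurable] = exp_Lp_interval_measurable[OF p]
  have "small_norm M p \<beta> f = (\<integral>\<^sup>+z\<in>{0<..}. (ennreal ((1 + z) powr (\<beta> / conjugate_exponent p - 1)) *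
      exp_Lp p (log_rearr M f) {z<..}) \<partial>lborel)"
    unfolding small_norm_def tilde_norm_def[of "Lp_norm 1"]
    by (rule L1_norm_eq) (use assms in \<open>auto simp: tilde_Lp_tail ell_exp indicator_def\<close>)
  then show ?thesis
    by (simp add: full_int_def)
qed

section \<open>The K-functional\<close>

lemma exp_Lp_shift:
  assumes [measurable]: "G \<in> borel_measurable borel" "S \<in> sets borel" and p: "p > 0"
  shows "exp_Lp p (\<lambda>u. G (u + t)) {u. u + t \<in> S} = ennreal (exp (t / p)) * exp_Lp p G S"
proof -
  let ?h = "\<lambda>v. ennreal (exp t) * (ennreal (exp (- v)) * ennreal_powr (G v) p * indicator S v)"
  have "(\<integral>\<^sup>+v. ?h v \<partial>lborel) = (\<integral>\<^sup>+u. ?h (t + 1 * u) \<partial>lborel)"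
    by (subst nn_integral_real_affine[of ?h 1 t]) auto
  also have "\<dots> = (\<integral>\<^sup>+u\<in>{u. u + t \<in> S}. ennreal (exp (- u)) * ennreal_powr (G (u + t)) p \<partial>lborel)"
  proof (intro nn_integral_cong)
    fix u
    have "ennreal (exp t) * ennreal (exp (- (t + u))) = ennreal (exp (- u))"
      by (simp add: ennreal_exp_mult)
    then show "?h (t + 1 * u) = ennreal (exp (- u)) * ennreal_powr (G (u + t)) p * indicator {u. u + t \<in> S} u"
      by (simp add: mult.assoc[symmetric] indicator_def add.commute)
  qed
  finally have "(\<integral>\<^sup>+u\<in>{u. u + t \<in> S}. ennreal (exp (- u)) * ennreal_powr (G (u + t)) p \<partial>lborel) =
      ennreal (exp t) * (\<integral>\<^sup>+v\<in>S. ennreal (exp (- v)) * ennreal_powr (G v) p \<partial>lborel)"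
    by (simp add: nn_integral_cmult)
  then show ?thesis
    by (simp add: exp_Lp_def ennreal_powr_mult ennreal_powr_ennreal powr_def)
qed

text \<open>
  The factor \<open>2\<close> comes from the elementary bound \<open>(x + y)^p \<le> 2^p (x^p +
  y^p)\<close>, which replaces Minkowski's inequality.
\<close>

lemma exp_Lp_triangle:
  assumes [measurable]: "G \<in> borel_measurable borel" "H \<in> borel_measurable borel" "S \<in> sets borel"
    and p: "p \<ge> 1" and F: "\<And>u. u \<in> S \<Longrightarrow> F u \<le> G u + H u"
  shows "exp_Lp p F S \<le> 2 * (exp_Lp p G S + exp_Lp p H S)"
proof -
  let ?I = "\<lambda>F. \<integral>\<^sup>+u\<in>S. ennreal (exp (- u)) * ennreal_powr (F u) p \<partial>lborel"
  have "?I F \<le> (\<integral>\<^sup>+u. ennreal (2 powr p) * (ennreal (exp (- u)) * ennreal_powr (G u) p * indicator S u +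
      ennreal (exp (- u)) * ennreal_powr (H u) p * indicator S u) \<partial>lborel)"
  proof (rule nn_integral_mono)
    fix u
    show "ennreal (exp (- u)) * ennreal_powr (F u) p * indicator S u \<le>
        ennreal (2 powr p) * (ennreal (exp (- u)) * ennreal_powr (G u) p * indicator S u +
          ennreal (exp (- u)) * ennreal_powr (H u) p * indicator S u)"
    proof (cases "u \<in> S")
      case True
      have "ennreal_powr (F u) p \<le> ennreal_powr (G u + H u) p"
        using p F[OF True] by (intro ennreal_powr_mono) auto
      also have "\<dots> \<le> ennreal (2 powr p) * (ennreal_powr (G u) p + ennreal_powr (H u) p)"
        using p by (intro ennreal_powr_add_le_convex) auto
      finally have "ennreal (exp (- u)) * ennreal_powr (F u) p \<le>
          ennreal (exp (- u)) * (ennreal (2 powr p) * (ennreal_powr (G u) p + ennreal_powr (H u) p))"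
        by (intro mult_left_mono) auto
      then show ?thesis
        using True by (simp add: distrib_left ac_simps)
    qed simp
  qed
  also have "\<dots> = ennreal (2 powr p) * (?I G + ?I H)"
    by (subst nn_integral_cmult, measurable) (subst nn_integral_add, auto)
  finally have "exp_Lp p F S \<le> ennreal_powr (ennreal (2 powr p) * (?I G + ?I H)) (1 / p)"
    unfolding exp_Lp_def using p by (intro ennreal_powr_mono) auto
  also have "\<dots> = 2 * ennreal_powr (?I G + ?I H) (1 / p)"
    using p by (simp add: ennreal_powr_mult ennreal_powr_ennreal powr_powr)
  also have "\<dots> \<le> 2 * (exp_Lp p G S + exp_Lp p H S)"
    unfolding exp_Lp_def using p by (intro mult_left_mono ennreal_powr_add_le) auto
  finally show ?thesis .
qed

text \<open>Halving the argument of a rearrangement is a translation by \<open>ln 2 \<le> 1\<close> in the logarithmic variable.\<close>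

lemma exp_Lp_split:
  assumes G[measurable]: "G \<in> borel_measurable borel" and H[measurable]: "H \<in> borel_measurable borel"
    and p: "p \<ge> 1" and F: "\<And>u. F u \<le> G (u + ln 2) + H (u + ln 2)"
    and S: "S \<in> sets borel" "\<And>u. u \<in> S \<Longrightarrow> u + ln 2 \<in> T" and T: "T \<in> sets borel"
  shows "exp_Lp p F S \<le> 4 * (exp_Lp p G T + exp_Lp p H T)"
proof -
  have shifted: "exp_Lp p (\<lambda>u. K (u + ln 2)) S \<le> 2 * exp_Lp p K T"
    if [measurable]: "K \<in> borel_measurable borel" for K
  proof -
    have "exp_Lp p (\<lambda>u. K (u + ln 2)) S \<le> exp_Lp p (\<lambda>u. K (u + ln 2)) {u. u + ln 2 \<in> T}"
      using p S by (intro exp_Lp_mono) auto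
    also have "\<dots> = ennreal (exp (ln 2 / p)) * exp_Lp p K T"
      using p T by (intro exp_Lp_shift) auto
    also have "exp (ln 2 / p) \<le> exp (ln (2::real))"
      by (subst exp_le_cancel_iff) (use p in \<open>simp add: divide_le_eq\<close>)
    then have "ennreal (exp (ln 2 / p)) * exp_Lp p K T \<le> 2 * exp_Lp p K T"
      using ennreal_leI[of "exp (ln 2 / p)" 2] by (intro mult_right_mono) auto
    finally show ?thesis .
  qed
  have "exp_Lp p F S \<le> 2 * (exp_Lp p (\<lambda>u. G (u + ln 2)) S + exp_Lp p (\<lambda>u. H (u + ln 2)) S)"
    using p F S by (intro exp_Lp_triangle) auto
  also have "\<dots> \<le> 2 * (2 * exp_Lp p G T + 2 * exp_Lp p H T)"
    by (intro mult_left_mono add_mono shifted G H) auto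
  also have "\<dots> = 4 * (exp_Lp p G T + exp_Lp p H T)"
    by (simp add: distrib_left mult.assoc[symmetric])
  finally show ?thesis .
qed

text \<open>
  Since \<open>F\<close> is nondecreasing, moving the left end point from \<open>x\<close> to
  \<open>x + 1\<close> costs only the factor \<open>e^(1/p)\<close>. The content of \<open>(x +
  1, \<infinity>)\<close> is a lower bound for those of \<open>(z, \<infinity>)\<close> with
  \<open>(x + 1) / 2 < z < x + 1\<close>, and on this range \<open>1 + z\<close> is comparable
  with \<open>1 + x\<close>, also for \<open>x\<close> near \<open>0\<close>.
\<close>

lemma exp_Lp_tail_le_full_int:
  assumes p: "p \<ge> 1" and c: "c > 0" and x: "x \<ge> 0" and F: "mono F"
  shows "ennreal ((1 + x) powr c) * exp_Lp p F {x<..} \<le>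
    ennreal (2 powr (\<bar>c - 1\<bar> + 1) * exp (1 / p)) * full_int p c F"
proof -
  have [measurable]: "F \<in> borel_measurable borel"
    using F by (rule borel_measurable_mono_ennreal)
  let ?N = "exp_Lp p F {x + 1<..}"
  have "exp_Lp p F {x<..} \<le> exp_Lp p (\<lambda>u. F (u + 1)) {u. u + 1 \<in> {x + 1<..}}"
    using p F by (intro exp_Lp_mono) (auto simp: mono_def)
  also have "\<dots> = ennreal (exp (1 / p)) * ?N"
    using p by (intro exp_Lp_shift) auto
  finally have shift: "exp_Lp p F {x<..} \<le> ennreal (exp (1 / p)) * ?N" .
  let ?m = "2 powr (- \<bar>c - 1\<bar>) * (1 + x) powr (c - 1)"
  let ?J = "{(x + 1) / 2<..<x + 1}"
  have weight: "?m \<le> (1 + z) powr (c - 1)" if z: "z \<in> ?J" for z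
  proof (cases "c \<ge> 1")
    case True
    have "(1 / 2) powr (c - 1) = 2 powr (- (c - 1))"
      by (simp only: powr_divide powr_minus inverse_eq_divide powr_one_eq_one)
    then have "?m = ((1 / 2) * (1 + x)) powr (c - 1)"
      using True by (simp add: powr_mult[of "1 / 2" "1 + x"] del: mult_1 times_divide_eq_left)
    also have "\<dots> \<le> (1 + z) powr (c - 1)"
      using z x True by (intro powr_mono2) auto
    finally show ?thesis .
  next
    case False
    then have "?m = (2 * (1 + x)) powr (c - 1)"
      by (simp only: powr_mult) simp
    also have "\<dots> \<le> (1 + z) powr (c - 1)"
      using z x False by (intro powr_mono2') auto
    finally show ?thesis .
  qed
  have "ennreal (?m * ((x + 1) / 2)) * ?N = (\<integral>\<^sup>+z. (ennreal ?m * ?N) * indicator ?J z \<partial>lborel)"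
  proof -
    have "x + 1 - (x + 1) / 2 = (x + 1) / 2"
      by (simp add: field_simps)
    then have "emeasure lborel ?J = ennreal ((x + 1) / 2)"
      using x by simp
    moreover have "ennreal (?m * ((x + 1) / 2)) = ennreal ?m * ennreal ((x + 1) / 2)"
      using x by (intro ennreal_mult) auto
    ultimately show ?thesis
      by (subst nn_integral_cmult_indicator) (auto simp: ac_simps)
  qed
  also have "\<dots> \<le> full_int p c F"
    unfolding full_int_def
  proof (rule nn_integral_mono)
    fix z
    show "(ennreal ?m * ?N) * indicator ?J z \<le>
        ennreal ((1 + z) powr (c - 1)) * exp_Lp p F {z<..} * indicator {0<..} z"
    proof (cases "z \<in> ?J")
      case True
      then have "ennreal ?m * ?N \<le> ennreal ((1 + z) powr (c - 1)) * exp_Lp p F {z<..}"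
        using p weight[OF True] by (intro mult_mono ennreal_leI exp_Lp_mono) auto
      moreover have "z > 0"
        using True x by auto
      ultimately show ?thesis
        using True by simp
    qed simp
  qed
  finally have le: "ennreal (?m * ((x + 1) / 2)) * ?N \<le> full_int p c F" .
  have "(1 + x) powr c = (1 + x) powr (c - 1) * (1 + x)"
    using x powr_add[of "1 + x" "c - 1" 1] by simp
  moreover have "2 powr (\<bar>c - 1\<bar> + 1) * 2 powr (- \<bar>c - 1\<bar>) = (2::real)"
    by (simp add: powr_add[symmetric])
  ultimately have eq: "(1 + x) powr c = 2 powr (\<bar>c - 1\<bar> + 1) * (?m * ((x + 1) / 2))"
    by (simp add: mult.assoc[symmetric])
  have "ennreal ((1 + x) powr c) * exp_Lp p F {x<..} \<le> ennreal ((1 + x) powr c) * (ennreal (exp (1 / p)) * ?N)"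
    by (intro mult_left_mono shift) auto
  also have "\<dots> = ennreal (2 powr (\<bar>c - 1\<bar> + 1) * exp (1 / p)) * (ennreal (?m * ((x + 1) / 2)) * ?N)"
  proof -
    have regroup: "ennreal (A * d) * (ennreal B * N) = ennreal (A * B) * (ennreal d * N)"
      if "A \<ge> 0" "B \<ge> 0" "d \<ge> 0" for A B d :: real and N
      using that by (simp add: ennreal_mult ac_simps)
    show ?thesis
      unfolding eq by (rule regroup) (use x in auto)
  qed
  also have "\<dots> \<le> ennreal (2 powr (\<bar>c - 1\<bar> + 1) * exp (1 / p)) * full_int p c F"
    by (intro mult_left_mono le) auto
  finally show ?thesis .
qed

lemma add_ln_2_mem: "u + ln 2 \<in> {l<..<r + 1}" if "u \<in> {l<..<r}" for l r u :: real
proof -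
  have "0 < ln (2::real)" "ln 2 \<le> (1::real)"
    using ln_le_minus_one[of "2::real"] by simp_all
  then show ?thesis
    using that unfolding greaterThanLessThan_iff by linarith
qed

text \<open>
  The pieces \<open>G\<close> and \<open>H\<close> are the rearrangements of the two parts of a
  decomposition \<open>f = f\<^sub>0 + f\<^sub>1\<close>: the content of \<open>G\<close> is
  measured by the grand norm, that of \<open>H\<close> on \<open>(x, \<infinity>)\<close> by the
  small one.
\<close>

lemma tail_sup_split_le:
  assumes p: "p \<ge> 1" and a: "a > 0" and c: "c > 0" and x: "x \<ge> 0"
    and G: "mono G" and H: "mono H" and F: "\<And>u. F u \<le> G (u + ln 2) + H (u + ln 2)"
  shows "tail_sup p a F x \<le> ennreal (4 * 4 powr a) * tail_sup p a G 0 +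
    ennreal (4 * (2 powr (\<bar>c - 1\<bar> + 1) * exp (1 / p))) * (ennreal ((1 + x) powr (- (a + c))) * full_int p c H)"
proof (rule tail_sup_le)
  have [measurable]: "G \<in> borel_measurable borel" "H \<in> borel_measurable borel"
    using G H by (auto intro: borel_measurable_mono_ennreal)
  fix z assume z: "x < z"
  let ?L = "2 powr (\<bar>c - 1\<bar> + 1) * exp (1 / p)"
  have "exp_Lp p F {x<..<z} \<le> 4 * (exp_Lp p G {x<..<z + 1} + exp_Lp p H {x<..<z + 1})"
    using p F by (intro exp_Lp_split) (auto simp del: greaterThanLessThan_iff intro: add_ln_2_mem)
  also have "\<dots> \<le> 4 * (exp_Lp p G {0<..<z + 1} + exp_Lp p H {x<..})"
    using p x by (intro mult_left_mono add_mono exp_Lp_mono) auto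
  finally have "ennreal ((1 + z) powr (- a)) * exp_Lp p F {x<..<z} \<le>
      ennreal ((1 + z) powr (- a)) * (4 * (exp_Lp p G {0<..<z + 1} + exp_Lp p H {x<..}))"
    by (intro mult_left_mono) auto
  also have "\<dots> = 4 * (ennreal ((1 + z) powr (- a)) * exp_Lp p G {0<..<z + 1}) +
      4 * (ennreal ((1 + z) powr (- a)) * exp_Lp p H {x<..})"
    by (simp add: distrib_left ac_simps)
  also have "\<dots> \<le> 4 * (ennreal (4 powr a) * tail_sup p a G 0) +
      4 * (ennreal ((1 + x) powr (- (a + c)) * ?L) * full_int p c H)"
  proof (intro add_mono mult_left_mono)
    have "ennreal ((1 + z) powr (- a)) * exp_Lp p G {0<..<z + 1} \<le>
        ennreal ((1 + z) powr (- a)) * (ennreal ((2 * (1 + (z + 1))) powr a) * tail_sup p a G 0)"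
      using p a x z by (intro mult_left_mono exp_Lp_interval_le_tail_sup) auto
    also have "\<dots> \<le> ennreal ((1 + z) powr (- a)) * (ennreal ((4 * (1 + z)) powr a) * tail_sup p a G 0)"
      using x z a by (intro mult_left_mono mult_right_mono ennreal_leI powr_mono2) auto
    also have "\<dots> = ennreal ((1 + z) powr (- a) * (4 * (1 + z)) powr a) * tail_sup p a G 0"
      by (simp add: ennreal_mult mult.assoc)
    also have "(1 + z) powr (- a) * (4 * (1 + z)) powr a = 4 powr a"
      using x z by (simp only: powr_mult) (simp add: powr_minus)
    finally show "ennreal ((1 + z) powr (- a)) * exp_Lp p G {0<..<z + 1} \<le> ennreal (4 powr a) * tail_sup p a G 0" .
    have "ennreal ((1 + z) powr (- a)) * exp_Lp p H {x<..} \<le> ennreal ((1 + x) powr (- a)) * exp_Lp p H {x<..}"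
      using x z a by (intro mult_right_mono ennreal_leI powr_mono2') auto
    also have "(1 + x) powr (- a) = (1 + x) powr (- (a + c)) * (1 + x) powr c"
      using x by (simp add: powr_add[symmetric])
    also have "ennreal ((1 + x) powr (- (a + c)) * (1 + x) powr c) * exp_Lp p H {x<..} =
        ennreal ((1 + x) powr (- (a + c))) * (ennreal ((1 + x) powr c) * exp_Lp p H {x<..})"
      by (simp add: ennreal_mult mult.assoc)
    also have "\<dots> \<le> ennreal ((1 + x) powr (- (a + c))) * (ennreal ?L * full_int p c H)"
      using p c x H by (intro mult_left_mono exp_Lp_tail_le_full_int) auto
    also have "\<dots> = ennreal ((1 + x) powr (- (a + c)) * ?L) * full_int p c H"
      by (simp add: ennreal_mult mult.assoc)
    finally show "ennreal ((1 + z) powr (- a)) * exp_Lp p H {x<..} \<le>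
      ennreal ((1 + x) powr (- (a + c)) * ?L) * full_int p c H" .
  qed auto
  also have "\<dots> = ennreal (4 * 4 powr a) * tail_sup p a G 0 +
      ennreal (4 * ?L) * (ennreal ((1 + x) powr (- (a + c))) * full_int p c H)"
    by (simp add: ennreal_mult ac_simps)
  finally show "ennreal ((1 + z) powr (- a)) * exp_Lp p F {x<..<z} \<le> \<dots>" .
qed (use p x in auto)

lemma head_int_split_le:
  assumes p: "p \<ge> 1" and a: "a > 0" and c: "c > 0" and x: "x \<ge> 0"
    and G: "mono G" and H: "mono H" and F: "\<And>u. F u \<le> G (u + ln 2) + H (u + ln 2)"
  shows "head_int p c F x \<le>
    ennreal (4 * 4 powr a / c * (1 + x) powr (a + c)) * tail_sup p a G 0 + 4 * full_int p c H"
proof -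
  have m[measurable]: "G \<in> borel_measurable borel" "H \<in> borel_measurable borel"
    using G H by (auto intro: borel_measurable_mono_ennreal)
  have [measurable]: "(\<lambda>z. exp_Lp p H {z<..}) \<in> borel_measurable borel"
    using p by (intro exp_Lp_interval_measurable) auto
  let ?w = "\<lambda>z. ennreal ((1 + z) powr (c - 1))"
  let ?N = "exp_Lp p G {0<..<x + 1}"
  have "head_int p c F x \<le> (\<integral>\<^sup>+z. 4 * (?w z * indicator {0<..<x} z * ?N + ?w z * exp_Lp p H {z<..} * indicator {0<..} z) \<partial>lborel)"
    unfolding head_int_def
  proof (rule nn_integral_mono)
    fix z
    show "?w z * exp_Lp p F {z<..<x} * indicator {0<..<x} z \<le>
      4 * (?w z * indicator {0<..<x} z * ?N + ?w z * exp_Lp p H {z<..} * indicator {0<..} z)"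
    proof (cases "z \<in> {0<..<x}")
      case True
      have "exp_Lp p F {z<..<x} \<le> 4 * (exp_Lp p G {z<..<x + 1} + exp_Lp p H {z<..<x + 1})"
        using p F by (intro exp_Lp_split) (auto simp del: greaterThanLessThan_iff intro: add_ln_2_mem)
      also have "\<dots> \<le> 4 * (?N + exp_Lp p H {z<..})"
        using p x True by (intro mult_left_mono add_mono exp_Lp_mono) auto
      finally have "?w z * exp_Lp p F {z<..<x} \<le> ?w z * (4 * (?N + exp_Lp p H {z<..}))"
        by (intro mult_left_mono) auto
      then show ?thesis
        using True by (simp add: distrib_left ac_simps)
    qed simp
  qed
  also have "\<dots> = 4 * ((\<integral>\<^sup>+z\<in>{0<..<x}. ?w z \<partial>lborel) * ?N + full_int p c H)"
    by (subst nn_integral_cmult, measurable)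
      (subst nn_integral_add, measurable, simp add: nn_integral_multc full_int_def)
  also have "\<dots> \<le> 4 * (ennreal ((1 + x) powr c / c) * (ennreal ((4 * (1 + x)) powr a) * tail_sup p a G 0) + full_int p c H)"
  proof (intro mult_left_mono add_mono mult_mono)
    show "(\<integral>\<^sup>+z\<in>{0<..<x}. ?w z \<partial>lborel) \<le> ennreal ((1 + x) powr c / c)"
      using c x by (rule nn_integral_one_plus_powr_le)
    have "?N \<le> ennreal ((2 * (1 + (x + 1))) powr a) * tail_sup p a G 0"
      using p a x by (intro exp_Lp_interval_le_tail_sup) auto
    also have "\<dots> \<le> ennreal ((4 * (1 + x)) powr a) * tail_sup p a G 0"
      using a x by (intro mult_right_mono ennreal_leI powr_mono2) auto
    finally show "?N \<le> ennreal ((4 * (1 + x)) powr a) * tail_sup p a G 0" .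
  qed auto
  also have "\<dots> = (4 * (ennreal ((1 + x) powr c / c) * ennreal ((4 * (1 + x)) powr a))) * tail_sup p a G 0 + 4 * full_int p c H"
    by (simp only: distrib_left mult.assoc)
  also have "4 * (ennreal ((1 + x) powr c / c) * ennreal ((4 * (1 + x)) powr a)) =
      ennreal (4 * ((1 + x) powr c / c * (4 * (1 + x)) powr a))"
  proof -
    have "4 * (ennreal r * ennreal s) = ennreal (4 * (r * s))" if "r \<ge> 0" "s \<ge> 0" for r s
      using that by (simp add: ennreal_mult)
    then show ?thesis
      using c by simp
  qed
  also have "4 * ((1 + x) powr c / c * (4 * (1 + x)) powr a) = 4 * 4 powr a / c * (1 + x) powr (a + c)"
    by (simp only: powr_mult powr_add) simp
  finally show ?thesis .
qed

lemma exp_Lp_mono_restrict: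
  assumes "p > 0" "\<And>u. u \<in> S \<Longrightarrow> u \<in> T \<Longrightarrow> F u \<le> G u" "\<And>u. u \<in> S \<Longrightarrow> u \<notin> T \<Longrightarrow> F u = 0"
  shows "exp_Lp p F S \<le> exp_Lp p G T"
  unfolding exp_Lp_def
proof (intro ennreal_powr_mono nn_integral_mono)
  fix u
  show "ennreal (exp (- u)) * ennreal_powr (F u) p * indicator S u \<le>
      ennreal (exp (- u)) * ennreal_powr (G u) p * indicator T u"
    using assms by (auto simp: indicator_def intro!: mult_left_mono ennreal_powr_mono)
qed (use assms in auto)

lemma one_plus_powr_le_exp:
  fixes s c q :: real
  assumes c: "c > 0" and q: "q > 0" and s: "s \<ge> 0"
  shows "(1 + s) powr c \<le> (1 + c * q) powr c * exp (s / q)"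
proof -
  define v where "v = s / (c * q)"
  have v: "v \<ge> 0"
    using assms by (simp add: v_def)
  have "1 + s = 1 + c * q * v"
    using assms by (simp add: v_def)
  also have "\<dots> \<le> (1 + c * q) * (1 + v)"
    using assms v by (simp add: algebra_simps)
  also have "\<dots> \<le> (1 + c * q) * exp v"
    using assms by (intro mult_left_mono exp_ge_add_one_self) auto
  finally have "(1 + s) powr c \<le> ((1 + c * q) * exp v) powr c"
    using assms by (intro powr_mono2) auto
  also have "\<dots> = (1 + c * q) powr c * exp (s / q)"
    using assms by (simp only: powr_mult) (simp add: powr_def v_def)
  finally show ?thesis .
qed

lemma nn_integral_exp_decay:
  fixes x q :: real
  assumes q: "q > 0"
  shows "(\<integral>\<^sup>+z\<in>{x..}. ennreal (exp (- ((z - x) / q))) \<partial>lborel) = ennreal q"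
proof -
  have "filterlim (\<lambda>z. (z - x) / q) at_top at_top"
    unfolding filterlim_at_top
  proof
    fix Z
    show "\<forall>\<^sub>F z in at_top. Z \<le> (z - x) / q"
      using eventually_ge_at_top[of "Z * q + x"] by eventually_elim (use q in \<open>simp add: field_simps\<close>)
  qed
  then have "((\<lambda>z. - q * exp (- ((z - x) / q))) \<longlongrightarrow> - q * 0) at_top"
    by (intro tendsto_mult tendsto_const filterlim_compose[OF exp_at_bot])
      (simp add: filterlim_uminus_at_top)
  then have "(\<integral>\<^sup>+z\<in>{x..}. ennreal (exp (- ((z - x) / q))) \<partial>lborel) = ennreal (- q * 0 - (- q * exp (- ((x - x) / q))))"
    using q by (intro nn_integral_FTC_atLeast) (auto intro!: derivative_eq_intros simp: field_simps)
  then show ?thesis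
    by simp
qed

lemma nn_integral_powr_exp_tail_le:
  assumes p: "p > 0" and c: "c > 0" and x: "x \<ge> 0"
  shows "(\<integral>\<^sup>+z\<in>{x..}. ennreal ((1 + z) powr (c - 1) * exp (- (z / p))) \<partial>lborel) \<le>
    ennreal ((1 + x) powr c * exp (- (x / p)) * (2 * p * (1 + c * (2 * p)) powr c))"
proof -
  let ?L = "(1 + c * (2 * p)) powr c"
  let ?K = "(1 + x) powr c * exp (- (x / p)) * ?L"
  have "(\<integral>\<^sup>+z\<in>{x..}. ennreal ((1 + z) powr (c - 1) * exp (- (z / p))) \<partial>lborel) \<le>
      (\<integral>\<^sup>+z. ennreal ?K * (ennreal (exp (- ((z - x) / (2 * p)))) * indicator {x..} z) \<partial>lborel)"
  proof (rule nn_integral_mono)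
    fix z
    show "ennreal ((1 + z) powr (c - 1) * exp (- (z / p))) * indicator {x..} z \<le>
        ennreal ?K * (ennreal (exp (- ((z - x) / (2 * p)))) * indicator {x..} z)"
    proof (cases "z \<in> {x..}")
      case True
      then have z: "z \<ge> x"
        by simp
      have "(1 + z) powr (c - 1) \<le> (1 + z) powr c"
        using x z by (intro powr_mono) auto
      also have "\<dots> \<le> ((1 + x) * (1 + (z - x))) powr c"
        using x z c by (intro powr_mono2) (auto simp: algebra_simps mult_left_mono)
      also have "\<dots> = (1 + x) powr c * (1 + (z - x)) powr c"
        by (rule powr_mult)
      also have "\<dots> \<le> (1 + x) powr c * (?L * exp ((z - x) / (2 * p)))"
        using c p z by (intro mult_left_mono one_plus_powr_le_exp) auto
      finally have "(1 + z) powr (c - 1) * exp (- (z / p)) \<le>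
          (1 + x) powr c * (?L * exp ((z - x) / (2 * p))) * exp (- (z / p))"
        by (intro mult_right_mono) auto
      also have "\<dots> = (1 + x) powr c * ?L * (exp ((z - x) / (2 * p)) * exp (- (z / p)))"
        by (simp only: ac_simps)
      also have "exp ((z - x) / (2 * p)) * exp (- (z / p)) = exp (- (x / p)) * exp (- ((z - x) / (2 * p)))"
        using p by (simp add: exp_add[symmetric] field_simps)
      finally have "(1 + z) powr (c - 1) * exp (- (z / p)) \<le> ?K * exp (- ((z - x) / (2 * p)))"
        by (simp only: ac_simps)
      then show ?thesis
        using True by (simp add: ennreal_mult[symmetric] ennreal_leI)
    qed simp
  qed
  also have "\<dots> = ennreal ?K * ennreal (2 * p)"
    using p by (subst nn_integral_cmult) (auto simp: nn_integral_exp_decay)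
  also have "\<dots> = ennreal ((1 + x) powr c * exp (- (x / p)) * (2 * p * ?L))"
    using p by (subst ennreal_mult[symmetric]) (auto simp: ac_simps)
  finally show ?thesis .
qed

text \<open>
  Here \<open>G\<close> is the rearrangement of a truncation at the level \<open>r\<close>.
  Below \<open>x\<close> it is compared with \<open>F\<close>, above \<open>x\<close> with the
  constant \<open>r\<close>, whose content of \<open>(z, \<infinity>)\<close> decays
  exponentially in \<open>z\<close>.
\<close>

lemma full_int_truncated_le:
  assumes p: "p \<ge> 1" and c: "c > 0" and x: "x \<ge> 0" and r: "r \<ge> 0"
    and F[measurable]: "F \<in> borel_measurable borel"
    and G[measurable]: "G \<in> borel_measurable borel"
    and GF: "\<And>u. G u \<le> F u" and Gr: "\<And>u. G u \<le> ennreal r"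
  shows "full_int p c G \<le> head_int p c F x +
    ennreal ((1 / c + 2 * p * (1 + c * (2 * p)) powr c) * ((1 + x) powr c * exp (- (x / p)))) * ennreal r"
proof -
  have [measurable]: "(\<lambda>z. exp_Lp p F {z<..<x}) \<in> borel_measurable borel"
    using p by (intro exp_Lp_interval_measurable) auto
  let ?w = "\<lambda>z. ennreal ((1 + z) powr (c - 1))"
  let ?e = "ennreal (exp (- (x / p)))"
  let ?g = "\<lambda>z. ennreal ((1 + z) powr (c - 1) * exp (- (z / p)))"
  have tail: "exp_Lp p G {z..} \<le> ennreal (exp (- (z / p))) * ennreal r" for z
  proof -
    have "exp_Lp p G {z..} \<le> exp_Lp p (\<lambda>_. ennreal r) {z..}"
      using p Gr by (intro exp_Lp_mono) auto
    also have "\<dots> \<le> ennreal r * ennreal (exp (- (z / p)))"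
      using p by (intro exp_Lp_const_le) auto
    finally show ?thesis
      by (simp add: mult.commute)
  qed
  have "full_int p c G \<le> (\<integral>\<^sup>+z. (?w z * exp_Lp p F {z<..<x} * indicator {0<..<x} z +
      (?w z * indicator {0<..<x} z) * (?e * ennreal r)) + (?g z * indicator {x..} z) * ennreal r \<partial>lborel)"
    unfolding full_int_def
  proof (rule nn_integral_mono)
    fix z
    consider "z \<le> 0" | "0 < z" "z < x" | "0 < z" "x \<le> z"
      by linarith
    then show "?w z * exp_Lp p G {z<..} * indicator {0<..} z \<le>
      (?w z * exp_Lp p F {z<..<x} * indicator {0<..<x} z +
      (?w z * indicator {0<..<x} z) * (?e * ennreal r)) + (?g z * indicator {x..} z) * ennreal r"
    proof cases
      case 2
      have "exp_Lp p G {z<..} \<le> exp_Lp p G {z<..<x} + exp_Lp p G {x..}"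
        using p by (intro exp_Lp_Un) auto
      also have "\<dots> \<le> exp_Lp p F {z<..<x} + ?e * ennreal r"
        using p GF by (intro add_mono tail exp_Lp_mono) auto
      finally have "?w z * exp_Lp p G {z<..} \<le> ?w z * (exp_Lp p F {z<..<x} + ?e * ennreal r)"
        by (intro mult_left_mono) auto
      then show ?thesis
        using 2 by (simp add: distrib_left)
    next
      case 3
      have "exp_Lp p G {z<..} \<le> exp_Lp p G {z..}"
        using p by (intro exp_Lp_mono) auto
      also have "\<dots> \<le> ennreal (exp (- (z / p))) * ennreal r"
        by (rule tail)
      finally have "?w z * exp_Lp p G {z<..} \<le> ?w z * (ennreal (exp (- (z / p))) * ennreal r)"
        by (intro mult_left_mono) auto
      then show ?thesis
        using 3 by (simp add: ennreal_mult mult.assoc)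
    qed simp
  qed
  also have "\<dots> = (head_int p c F x + (\<integral>\<^sup>+z\<in>{0<..<x}. ?w z \<partial>lborel) * (?e * ennreal r)) +
      (\<integral>\<^sup>+z\<in>{x..}. ?g z \<partial>lborel) * ennreal r"
    unfolding head_int_def
    by (subst nn_integral_add, measurable)
      (subst nn_integral_add, measurable, simp add: nn_integral_multc)
  also have "\<dots> \<le> (head_int p c F x + ennreal ((1 + x) powr c / c) * (?e * ennreal r)) +
      ennreal ((1 + x) powr c * exp (- (x / p)) * (2 * p * (1 + c * (2 * p)) powr c)) * ennreal r"
    using p c x
    by (intro add_mono mult_right_mono nn_integral_one_plus_powr_le nn_integral_powr_exp_tail_le) auto
  also have "\<dots> = head_int p c F x + (ennreal ((1 + x) powr c / c * exp (- (x / p))) +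
      ennreal ((1 + x) powr c * exp (- (x / p)) * (2 * p * (1 + c * (2 * p)) powr c))) * ennreal r"
  proof -
    have "ennreal ((1 + x) powr c / c) * ?e = ennreal ((1 + x) powr c / c * exp (- (x / p)))"
      using c by (intro ennreal_mult[symmetric]) auto
    then show ?thesis
      by (simp only: mult.assoc[symmetric] distrib_right add.assoc)
  qed
  also have "ennreal ((1 + x) powr c / c * exp (- (x / p))) +
      ennreal ((1 + x) powr c * exp (- (x / p)) * (2 * p * (1 + c * (2 * p)) powr c)) =
      ennreal ((1 / c + 2 * p * (1 + c * (2 * p)) powr c) * ((1 + x) powr c * exp (- (x / p))))"
  proof -
    have "(1 / c + K) * (A * E) = A / c * E + A * E * K" for A E K :: real
      by (simp add: algebra_simps)
    then show ?thesis
      using p c by (simp only:) (intro ennreal_plus[symmetric], auto)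
  qed
  finally show ?thesis .
qed

text \<open>
  Truncation of the absolute value at the level \<open>r\<close>. Scaling by a real factor keeps
  the phase, so that real and complex scalars are treated alike.
\<close>

lemma truncation:
  fixes f :: "'a \<Rightarrow> 'k::{real_normed_field, second_countable_topology}"
  assumes [measurable]: "f \<in> borel_measurable M" and r: "r \<ge> 0"
  obtains f0 f1 where "f0 \<in> borel_measurable M" "f1 \<in> borel_measurable M"
    "\<And>y. f y = f0 y + f1 y" "\<And>y. norm (f0 y) \<le> norm (f y)" "\<And>y. norm (f1 y) \<le> norm (f y)"
    "\<And>y. norm (f1 y) \<le> r" "\<And>y. norm (f y) \<le> r \<Longrightarrow> f0 y = 0"
proof -
  \<comment> \<open>At zeros of \<open>f\<close> the quotient is \<open>0\<close> by convention; there both parts vanish.\<close>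
  define k where "k y = min 1 (r / norm (f y))" for y
  have k: "0 \<le> k y" "k y \<le> 1" for y
    using r by (auto simp: k_def)
  show thesis
  proof (rule that)
    show "(\<lambda>y. (1 - k y) *\<^sub>R f y) \<in> borel_measurable M" "(\<lambda>y. k y *\<^sub>R f y) \<in> borel_measurable M"
      unfolding k_def by measurable
    fix y
    show "f y = (1 - k y) *\<^sub>R f y + k y *\<^sub>R f y"
      by (simp add: scaleR_left_diff_distrib)
    show "norm ((1 - k y) *\<^sub>R f y) \<le> norm (f y)" "norm (k y *\<^sub>R f y) \<le> norm (f y)"
      using k[of y] by (auto intro!: mult_left_le_one_le)
    show "norm (k y *\<^sub>R f y) \<le> r"
    proof (cases "f y = 0")
      case False
      then have "k y * norm (f y) \<le> r / norm (f y) * norm (f y)"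
        by (intro mult_right_mono) (auto simp: k_def)
      then show ?thesis
        using k[of y] False by simp
    qed (use r in simp)
    show "(1 - k y) *\<^sub>R f y = 0" if "norm (f y) \<le> r"
      using that by (cases "f y = 0") (auto simp: k_def min_def field_simps)
  qed
qed

lemma K_functional_mono: "mono (\<lambda>t. K_functional M grand small t f)"
  unfolding K_functional_def
proof (rule monoI, rule Inf_mono)
  fix s t :: real and y
  assume st: "s \<le> t" and "y \<in> {grand f0 + ennreal t * small f1 |f0 f1.
    f0 \<in> fun_space M grand \<and> f1 \<in> fun_space M small \<and> (AE x in M. f x = f0 x + f1 x)}"
  then obtain f0 f1 where f: "y = grand f0 + ennreal t * small f1"
    "f0 \<in> fun_space M grand" "f1 \<in> fun_space M small" "AE x in M. f x = f0 x + f1 x"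
    by blast
  show "\<exists>y'\<in>{grand f0 + ennreal s * small f1 |f0 f1.
      f0 \<in> fun_space M grand \<and> f1 \<in> fun_space M small \<and> (AE x in M. f x = f0 x + f1 x)}. y' \<le> y"
  proof (intro bexI)
    show "grand f0 + ennreal s * small f1 \<le> y"
      unfolding f using st by (intro add_left_mono mult_right_mono ennreal_leI) auto
  qed (use f in blast)
qed

context
  fixes M :: "'a measure" and p \<alpha> \<beta> a c :: real
    and grand small :: "('a \<Rightarrow> 'k::{real_normed_field, second_countable_topology}) \<Rightarrow> ennreal"
  assumes M: "finite_measure M" and p: "p > 1" and a: "a > 0" and c: "c > 0"
    and grand: "\<And>f. grand f = tail_sup p a (log_rearr M f) 0"
    and small: "\<And>f. small f = full_int p c (log_rearr M f)"
begin

text \<open>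
  Every decomposition of \<open>f\<close> is compared term by term through
  \<open>rearrangement_add_le\<close>.
\<close>

lemma K_functional_ge:
  obtains C where "C > 0"
    "\<And>f x. f \<in> borel_measurable M \<Longrightarrow> x \<ge> 0 \<Longrightarrow>
      tail_sup p a (log_rearr M f) x + ennreal ((1 + x) powr (- (a + c))) * head_int p c (log_rearr M f) x \<le>
      ennreal C * K_functional M grand small ((1 + x) powr (- (a + c))) f"
proof -
  define L where "L = 2 powr (\<bar>c - 1\<bar> + 1) * exp (1 / p)"
  define C where "C = 4 * 4 powr a + 4 * L + 4 * 4 powr a / c + 4"
  have L: "L > 0"
    by (simp add: L_def)
  have C: "C > 0" "4 * 4 powr a + 4 * 4 powr a / c \<le> C" "4 * L + 4 \<le> C"
    using L c by (auto simp: C_def intro!: add_pos_pos add_nonneg_nonneg)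
  show ?thesis
  proof (rule that[OF C(1)])
    fix f :: "'a \<Rightarrow> 'k" and x :: real
    assume f[measurable]: "f \<in> borel_measurable M" and x: "x \<ge> 0"
    define t where "t = (1 + x) powr (- (a + c))"
    let ?F = "log_rearr M f"
    let ?lhs = "tail_sup p a ?F x + ennreal t * head_int p c ?F x"
    have "ennreal (inverse C) * ?lhs \<le> K_functional M grand small t f"
      unfolding K_functional_def
    proof (rule Inf_greatest, clarify)
      fix f0 f1 :: "'a \<Rightarrow> 'k"
      assume f0: "f0 \<in> fun_space M grand" and f1: "f1 \<in> fun_space M small"
        and sum: "AE x in M. f x = f0 x + f1 x"
      have split: "?F u \<le> log_rearr M f0 (u + ln 2) + log_rearr M f1 (u + ln 2)" for u
      proof -
        have "exp (- (u + ln 2)) = exp (- u) / 2"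
          by (simp add: exp_diff)
        then show ?thesis
          unfolding log_rearr_def using f0 f1 sum
          by (simp only:) (intro rearrangement_add_le, auto simp: fun_space_def)
      qed
      have p1: "p \<ge> 1"
        using p by simp
      have "ennreal t * head_int p c ?F x \<le>
          ennreal t * (ennreal (4 * 4 powr a / c * (1 + x) powr (a + c)) * grand f0 + 4 * small f1)"
        unfolding grand small using p1 a c x split
        by (intro mult_left_mono head_int_split_le log_rearr_mono) auto
      also have "\<dots> = ennreal (t * (4 * 4 powr a / c * (1 + x) powr (a + c))) * grand f0 + 4 * (ennreal t * small f1)"
        using c by (subst ennreal_mult) (auto simp: t_def distrib_left ac_simps)
      also have "t * (4 * 4 powr a / c * (1 + x) powr (a + c)) = 4 * 4 powr a / c * (t * (1 + x) powr (a + c))"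
        by (simp only: ac_simps)
      also have "t * (1 + x) powr (a + c) = 1"
        using x by (simp add: t_def powr_add[symmetric])
      finally have D: "ennreal t * head_int p c ?F x \<le>
          ennreal (4 * 4 powr a / c) * grand f0 + 4 * (ennreal t * small f1)"
        by simp
      have A: "tail_sup p a ?F x \<le> ennreal (4 * 4 powr a) * grand f0 + ennreal (4 * L) * (ennreal t * small f1)"
        unfolding grand small L_def t_def using p1 a c x split
        by (intro tail_sup_split_le log_rearr_mono) auto
      have "?lhs \<le> (ennreal (4 * 4 powr a) * grand f0 + ennreal (4 * L) * (ennreal t * small f1)) +
          (ennreal (4 * 4 powr a / c) * grand f0 + 4 * (ennreal t * small f1))"
        by (intro add_mono A D)
      also have "\<dots> = (ennreal (4 * 4 powr a) + ennreal (4 * 4 powr a / c)) * grand f0 +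
          (ennreal (4 * L) + 4) * (ennreal t * small f1)"
        by (simp add: distrib_left distrib_right ac_simps)
      also have "\<dots> \<le> ennreal C * grand f0 + ennreal C * (ennreal t * small f1)"
      proof (intro add_mono mult_right_mono)
        show "ennreal (4 * 4 powr a) + ennreal (4 * 4 powr a / c) \<le> ennreal C"
          using C(2) c by (subst ennreal_plus[symmetric]) (auto intro: ennreal_leI simp del: ennreal_plus)
        have "ennreal (4 * L) + ennreal 4 \<le> ennreal C"
          using C(3) L by (subst ennreal_plus[symmetric]) (auto intro: ennreal_leI simp del: ennreal_numeral ennreal_plus)
        then show "ennreal (4 * L) + 4 \<le> ennreal C"
          by simp
      qed auto
      finally have "ennreal (inverse C) * ?lhs \<le>
          ennreal (inverse C) * (ennreal C * grand f0 + ennreal C * (ennreal t * small f1))"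
        by (intro mult_left_mono) auto
      also have "\<dots> = (ennreal (inverse C) * ennreal C) * (grand f0 + ennreal t * small f1)"
        by (simp only: distrib_left mult.assoc)
      also have "ennreal (inverse C) * ennreal C = 1"
        using C(1) by (subst ennreal_mult[symmetric]) auto
      finally show "ennreal (inverse C) * ?lhs \<le> grand f0 + ennreal t * small f1"
        by simp
    qed
    then have "ennreal C * (ennreal (inverse C) * ?lhs) \<le> ennreal C * K_functional M grand small t f"
      by (intro mult_left_mono) auto
    moreover have "ennreal C * ennreal (inverse C) = 1"
      using C(1) by (subst ennreal_mult[symmetric]) auto
    ultimately show "?lhs \<le> ennreal C * K_functional M grand small t f"
      by (simp add: mult.assoc[symmetric])
  qed
qed

text \<open>
  The decomposition truncates \<open>f\<close> at the level \<open>r = F x\<close>. The tall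
  part \<open>f\<^sub>0\<close> vanishes off a set of measure at most \<open>e^(-x)\<close>, so
  its rearrangement lives on \<open>u > x\<close>; the flat part \<open>f\<^sub>1\<close> is
  bounded by \<open>r\<close>, and the contribution of \<open>r\<close> to its small norm is
  absorbed by the supremum (\<open>tail_sup_ge_value\<close>).
\<close>

lemma K_functional_le:
  obtains C where "C > 0"
    "\<And>f x. f \<in> borel_measurable M \<Longrightarrow> x \<ge> 0 \<Longrightarrow>
      K_functional M grand small ((1 + x) powr (- (a + c))) f \<le>
      ennreal C * (tail_sup p a (log_rearr M f) x +
        ennreal ((1 + x) powr (- (a + c))) * head_int p c (log_rearr M f) x)"
proof -
  define L where "L = 1 / c + 2 * p * (1 + c * (2 * p)) powr c"
  define C where "C = 1 + L * (exp (1 / p) * 4 powr a)"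
  have L: "L > 0"
    using c p by (auto simp: L_def intro!: add_pos_nonneg)
  have C: "C > 0" "C \<ge> 1"
    using L by (auto simp: C_def intro!: add_pos_pos)
  show ?thesis
  proof (rule that[OF C(1)])
    fix f :: "'a \<Rightarrow> 'k" and x :: real
    assume f[measurable]: "f \<in> borel_measurable M" and x: "x \<ge> 0"
    define t where "t = (1 + x) powr (- (a + c))"
    let ?F = "log_rearr M f"
    let ?A = "tail_sup p a ?F x" and ?D = "head_int p c ?F x"
    interpret finite_measure M by (rule M)
    obtain r where r: "r \<ge> 0" "?F x = ennreal r"
      using rearrangement_finite[OF f, of "exp (- x)"] by (cases "?F x") (auto simp: log_rearr_def)
    obtain f0 f1 where f01[measurable]: "f0 \<in> borel_measurable M" "f1 \<in> borel_measurable M"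
      and sum: "\<And>y. f y = f0 y + f1 y"
      and norm0: "\<And>y. norm (f0 y) \<le> norm (f y)" and norm1: "\<And>y. norm (f1 y) \<le> norm (f y)"
      and norm1r: "\<And>y. norm (f1 y) \<le> r" and zero0: "\<And>y. norm (f y) \<le> r \<Longrightarrow> f0 y = 0"
      using truncation[OF f r(1)] by blast
    have F0_le: "log_rearr M f0 u \<le> ?F u" and F1_le: "log_rearr M f1 u \<le> ?F u" for u
      unfolding log_rearr_def by (intro rearrangement_mono f norm0 norm1)+
    have F1_r: "log_rearr M f1 u \<le> ennreal r" for u
    proof -
      have "{y \<in> space M. norm (f1 y) > r} = {}"
        using norm1r by (auto simp: not_less)
      then have "emeasure M {y \<in> space M. norm (f1 y) > r} = 0"
        by (simp only: emeasure_empty)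
      then show ?thesis
        unfolding log_rearr_def using r(1) by (intro rearrangement_le) simp_all
    qed
    have F0_zero: "log_rearr M f0 u = 0" if "u \<le> x" for u
    proof -
      have "emeasure M {y \<in> space M. norm (f0 y) > 0} \<le> emeasure M {y \<in> space M. norm (f y) > r}"
        using zero0 by (intro emeasure_mono) (auto simp: not_less[symmetric])
      also have "\<dots> \<le> ennreal (exp (- x))"
        using f r unfolding log_rearr_def by (rule emeasure_above_rearrangement)
      also have "\<dots> \<le> ennreal (exp (- u))"
        using that by (intro ennreal_leI) simp
      finally have "log_rearr M f0 u \<le> ennreal 0"
        unfolding log_rearr_def by (intro rearrangement_le) simp_all
      then show ?thesis
        by simp
    qed
    have grand_f0: "grand f0 \<le> ?A"
      unfolding grand tail_sup_def
    proof (intro esssup_AE_mono AE_half_line_I borel_measurable_half_line)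
      note [measurable] = exp_Lp_interval_measurable(1)[OF less_trans[OF zero_less_one p]]
      show "(\<lambda>z. indicator {0<..} z * (ennreal ((1 + z) powr (- a)) * exp_Lp p (log_rearr M f0) {0<..<z}))
          \<in> borel_measurable borel"
        using p by measurable
      fix z :: real assume z: "z > 0"
      show "indicator {0<..} z * (ennreal ((1 + z) powr (- a)) * exp_Lp p (log_rearr M f0) {0<..<z}) \<le>
          indicator {x<..} z * (ennreal ((1 + z) powr (- a)) * exp_Lp p ?F {x<..<z})"
      proof (cases "x < z")
        case True
        have "exp_Lp p (log_rearr M f0) {0<..<z} \<le> exp_Lp p ?F {x<..<z}"
          using p F0_le F0_zero by (intro exp_Lp_mono_restrict) auto
        then show ?thesis
          using True z by (auto intro!: mult_left_mono)
      next
        case False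
        have "exp_Lp p (log_rearr M f0) {0<..<z} \<le> exp_Lp p ?F {}"
          using p F0_zero False by (intro exp_Lp_mono_restrict) auto
        then show ?thesis
          by simp
      qed
    qed
    have small_f1: "ennreal t * small f1 \<le> ennreal t * ?D + ennreal (L * (exp (1 / p) * 4 powr a)) * ?A"
    proof -
      let ?q = "(1 + x) powr c * exp (- (x / p))"
      have "ennreal t * small f1 \<le> ennreal t * (?D + ennreal (L * ?q) * ennreal r)"
        unfolding small L_def using p c x r F1_le F1_r
        by (intro mult_left_mono full_int_truncated_le) auto
      also have "\<dots> = ennreal t * ?D + ennreal (t * (L * ?q)) * ennreal r"
        using L by (simp add: distrib_left ennreal_mult t_def mult.assoc)
      also have "t * (L * ?q) = L * (exp (- (x / p)) * (t * (1 + x) powr c))"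
        by (simp only: ac_simps)
      also have "t * (1 + x) powr c = (1 + x) powr (- a)"
        by (simp add: t_def powr_add[symmetric])
      also have "ennreal (L * (exp (- (x / p)) * (1 + x) powr (- a))) * ennreal r =
          ennreal L * (?F x * ennreal (exp (- (x / p)) * (1 + x) powr (- a)))"
        using L r by (simp add: ennreal_mult ac_simps)
      also have "\<dots> \<le> ennreal L * (ennreal (exp (1 / p) * 4 powr a) * ?A)"
        using p a x by (intro mult_left_mono tail_sup_ge_value log_rearr_mono) auto
      also have "\<dots> = ennreal (L * (exp (1 / p) * 4 powr a)) * ?A"
        using L by (simp add: ennreal_mult mult.assoc)
      finally show ?thesis
        by (simp add: add_left_mono)
    qed
    have total: "grand f0 + ennreal t * small f1 \<le> ennreal C * (?A + ennreal t * ?D)"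
    proof -
      have "grand f0 + ennreal t * small f1 \<le>
          ?A + (ennreal t * ?D + ennreal (L * (exp (1 / p) * 4 powr a)) * ?A)"
        by (intro add_mono grand_f0 small_f1)
      also have "\<dots> = (1 + ennreal (L * (exp (1 / p) * 4 powr a))) * ?A + 1 * (ennreal t * ?D)"
        by (simp only: distrib_right mult_1_left add.assoc add.commute add.left_commute)
      also have "1 + ennreal (L * (exp (1 / p) * 4 powr a)) = ennreal C"
        using L unfolding C_def by (subst ennreal_plus) auto
      also have "ennreal C * ?A + 1 * (ennreal t * ?D) \<le> ennreal C * ?A + ennreal C * (ennreal t * ?D)"
        using C(2) by (intro add_left_mono mult_right_mono) (auto simp: ennreal_1[symmetric] intro!: ennreal_leI simp del: ennreal_1)
      finally show ?thesis
        by (simp add: distrib_left)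
    qed
    show "K_functional M grand small t f \<le> ennreal C * (?A + ennreal t * ?D)"
    proof (cases "?A + ennreal t * ?D < \<infinity>")
      case True
      then have fin: "ennreal C * (?A + ennreal t * ?D) < \<infinity>"
        by (simp add: ennreal_mult_less_top)
      then have "grand f0 + ennreal t * small f1 < \<infinity>"
        using total by (rule le_less_trans[rotated])
      moreover have "t > 0"
        using x by (simp add: t_def)
      ultimately have "grand f0 < \<infinity>" "small f1 < \<infinity>"
        by (auto simp: ennreal_mult_less_top ennreal_add_eq_top less_top)
      then have "K_functional M grand small t f \<le> grand f0 + ennreal t * small f1"
        unfolding K_functional_def using sum f01
        by (intro Inf_lower CollectI exI[of _ f0] exI[of _ f1]) (simp add: fun_space_def)
      then show ?thesis
        using total by (rule order_trans)
    next
      case False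
      then have top: "?A + ennreal t * ?D = top"
        by (metis infinity_ennreal_def less_top)
      show ?thesis
        unfolding top using C by (simp add: ennreal_mult_top)
    qed
  qed
qed

end

section \<open>Domination of quasi-norms\<close>

definition dominated ::
    "'a measure \<Rightarrow> (('a \<Rightarrow> 'k::{real_normed_field, second_countable_topology}) \<Rightarrow> ennreal) \<Rightarrow>
      (('a \<Rightarrow> 'k) \<Rightarrow> ennreal) \<Rightarrow> bool" where
  "dominated M N1 N2 \<longleftrightarrow> (\<exists>C::real. C > 0 \<and> (\<forall>f\<in>borel_measurable M. N1 f \<le> ennreal C * N2 f))"

lemma dominatedI:
  assumes "C > 0" "\<And>f. f \<in> borel_measurable M \<Longrightarrow> N1 f \<le> ennreal C * N2 f"
  shows "dominated M N1 N2"
  using assms by (auto simp: dominated_def)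

lemma dominated_le:
  assumes "\<And>f. f \<in> borel_measurable M \<Longrightarrow> N1 f \<le> N2 f"
  shows "dominated M N1 N2"
  using assms by (intro dominatedI[of 1]) auto

lemma dominated_trans [trans]:
  fixes N1 N2 N3 :: "('a \<Rightarrow> 'k::{real_normed_field, second_countable_topology}) \<Rightarrow> ennreal"
  assumes "dominated M N1 N2" "dominated M N2 N3"
  shows "dominated M N1 N3"
proof -
  obtain C D where C: "C > 0" "\<And>f. f \<in> borel_measurable M \<Longrightarrow> N1 f \<le> ennreal C * N2 f"
    and D: "D > 0" "\<And>f. f \<in> borel_measurable M \<Longrightarrow> N2 f \<le> ennreal D * N3 f"
    using assms by (auto simp: dominated_def)
  show ?thesis
  proof (rule dominatedI)
    fix f :: "'a \<Rightarrow> 'k" assume f: "f \<in> borel_measurable M"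
    have "N1 f \<le> ennreal C * N2 f"
      using f by (rule C)
    also have "\<dots> \<le> ennreal C * (ennreal D * N3 f)"
      using f by (intro mult_left_mono D) auto
    finally show "N1 f \<le> ennreal (C * D) * N3 f"
      using C D by (simp add: ennreal_mult mult.assoc)
  qed (use C D in auto)
qed

lemma dominated_add:
  fixes N1 N2 N :: "('a \<Rightarrow> 'k::{real_normed_field, second_countable_topology}) \<Rightarrow> ennreal"
  assumes "dominated M N1 N" "dominated M N2 N"
  shows "dominated M (\<lambda>f. N1 f + N2 f) N"
proof -
  obtain C D where C: "C > 0" "\<And>f. f \<in> borel_measurable M \<Longrightarrow> N1 f \<le> ennreal C * N f"
    and D: "D > 0" "\<And>f. f \<in> borel_measurable M \<Longrightarrow> N2 f \<le> ennreal D * N f"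
    using assms by (auto simp: dominated_def)
  show ?thesis
  proof (rule dominatedI)
    fix f :: "'a \<Rightarrow> 'k" assume f: "f \<in> borel_measurable M"
    have "N1 f + N2 f \<le> ennreal C * N f + ennreal D * N f"
      using f by (intro add_mono C D)
    then show "N1 f + N2 f \<le> ennreal (C + D) * N f"
      using C D by (simp add: distrib_right)
  qed (use C D in auto)
qed

lemma dominated_inter_norm:
  assumes "dominated M N1 N" "dominated M N2 N"
  shows "dominated M (inter_norm N1 N2) N"
proof -
  have "dominated M (inter_norm N1 N2) (\<lambda>f. N1 f + N2 f)"
    by (rule dominated_le) (auto simp: inter_norm_def)
  also have "dominated M \<dots> N"
    using assms by (rule dominated_add)
  finally show ?thesis .
qed

lemma dominated_inter_norm1: "dominated M N1 (inter_norm N1 N2)"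
  and dominated_inter_norm2: "dominated M N2 (inter_norm N1 N2)"
  by (rule dominated_le, simp add: inter_norm_def)+

text \<open>
  The interpolation norm is infinite off the larger space of the couple; \<open>fin\<close> says
  that the expression \<open>raw\<close> is infinite there as well, so that it may replace the
  interpolation norm.
\<close>

lemma same_space_interpolation:
  fixes raw X N0 N1 :: "('a \<Rightarrow> 'k::{real_normed_field, second_countable_topology}) \<Rightarrow> ennreal"
  assumes raw: "\<And>f. raw f = tilde_norm E 0 1 (\<lambda>t. ennreal (t powr (- \<eta>) * b t) * K_functional M N0 N1 t f)"
    and fin: "\<And>f. f \<in> borel_measurable M \<Longrightarrow> raw f < \<infinity> \<Longrightarrow> N0 f < \<infinity>"
    and dom: "dominated M raw X" "dominated M X raw"
  shows "same_space M (interpolation_norm M N0 N1 \<eta> b E) X"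
proof -
  have eq: "interpolation_norm M N0 N1 \<eta> b E f = raw f" if f: "f \<in> borel_measurable M" for f
  proof (cases "N0 f < \<infinity>")
    case True
    then show ?thesis
      using f by (simp add: interpolation_norm_def fun_space_def raw)
  next
    case False
    then have "\<not> raw f < \<infinity>"
      using fin f by blast
    then show ?thesis
      using False by (simp add: interpolation_norm_def fun_space_def less_top[symmetric])
  qed
  obtain C D where C: "C > 0" "\<And>f. f \<in> borel_measurable M \<Longrightarrow> raw f \<le> ennreal C * X f"
    and D: "D > 0" "\<And>f. f \<in> borel_measurable M \<Longrightarrow> X f \<le> ennreal D * raw f"
    using dom by (auto simp: dominated_def)
  have "raw f < \<infinity> \<longleftrightarrow> X f < \<infinity>" if "f \<in> borel_measurable M" for f
  proof
    assume "raw f < \<infinity>"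
    then show "X f < \<infinity>"
      by (intro le_less_trans[OF D(2)[OF that]]) (simp add: ennreal_mult_less_top)
  next
    assume "X f < \<infinity>"
    then show "raw f < \<infinity>"
      by (intro le_less_trans[OF C(2)[OF that]]) (simp add: ennreal_mult_less_top)
  qed
  then have "fun_space M (interpolation_norm M N0 N1 \<eta> b E) = fun_space M X"
    unfolding fun_space_def using eq by auto
  moreover have "raw f \<le> ennreal (max C D) * X f \<and> X f \<le> ennreal (max C D) * raw f"
    if "f \<in> borel_measurable M" for f
  proof
    show "raw f \<le> ennreal (max C D) * X f"
      by (rule order_trans[OF C(2)[OF that]]) (intro mult_right_mono ennreal_leI, auto)
    show "X f \<le> ennreal (max C D) * raw f"
      by (rule order_trans[OF D(2)[OF that]]) (intro mult_right_mono ennreal_leI, auto)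
  qed
  ultimately show ?thesis
    unfolding same_space_def using C(1) eq
    by (intro conjI exI[of _ "max C D"]) (auto simp: fun_space_def)
qed

text \<open>
  The content of \<open>(0, x]\<close> is at most \<open>F x\<close>, which is finite if the
  supremum beyond \<open>x\<close> is.
\<close>

lemma grand_finite_of_tail_sup:
  assumes p: "p \<ge> 1" and a: "a > 0" and x: "x \<ge> 0" and F: "mono F" and fin: "tail_sup p a F x < \<infinity>"
  shows "tail_sup p a F 0 < \<infinity>"
proof -
  have [measurable]: "F \<in> borel_measurable borel"
    using F by (rule borel_measurable_mono_ennreal)
  have "tail_sup p a F 0 \<le> exp_Lp p F {0<..x} + ennreal (2 powr a) * tail_sup p a F x"
  proof (rule tail_sup_le)
    fix z :: real assume z: "0 < z"
    have "(1 + z) powr (- a) \<le> 1 powr (- a)"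
      using z a by (intro powr_mono2') auto
    then have w: "ennreal ((1 + z) powr (- a)) \<le> 1"
      by simp
    have "exp_Lp p F {0<..<z} \<le> exp_Lp p F {0<..x} + exp_Lp p F {x<..<z}"
      using p by (intro exp_Lp_Un) auto
    then have "ennreal ((1 + z) powr (- a)) * exp_Lp p F {0<..<z} \<le>
        ennreal ((1 + z) powr (- a)) * (exp_Lp p F {0<..x} + exp_Lp p F {x<..<z})"
      by (intro mult_left_mono) auto
    also have "\<dots> \<le> 1 * exp_Lp p F {0<..x} + ennreal ((1 + z) powr (- a)) * exp_Lp p F {x<..<z}"
      unfolding distrib_left using w by (intro add_mono mult_right_mono) auto
    also have "\<dots> \<le> 1 * exp_Lp p F {0<..x} + ennreal (2 powr a) * tail_sup p a F x"
    proof (intro add_left_mono)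
      show "ennreal ((1 + z) powr (- a)) * exp_Lp p F {x<..<z} \<le> ennreal (2 powr a) * tail_sup p a F x"
        using p a x by (cases "x < z") (auto intro!: tail_sup_ge)
    qed
    finally show "ennreal ((1 + z) powr (- a)) * exp_Lp p F {0<..<z} \<le>
      exp_Lp p F {0<..x} + ennreal (2 powr a) * tail_sup p a F x"
      by simp
  qed (use p in auto)
  also have "\<dots> < \<infinity>"
  proof -
    have "exp_Lp p F {0<..x} < \<infinity>"
      by (rule le_less_trans[OF exp_Lp_head_le_tail_sup[OF p a F x]])
        (use fin in \<open>simp add: ennreal_mult_less_top\<close>)
    then show ?thesis
      using fin by (simp add: ennreal_mult_less_top)
  qed
  finally show ?thesis .
qed

lemma double_exp_measurable:
  assumes p: "p > 0"
  shows "(\<lambda>y. ennreal (exp (- (a * y))) * exp_Lp p F {0<..<exp y - 1}) \<in> borel_measurable half_line"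
    and "(\<lambda>y. ennreal (exp (- (a * y))) * exp_Lp p F {exp y - 1<..}) \<in> borel_measurable half_line"
    and "(\<lambda>y. exp_Lp p F {exp y - 1<..}) \<in> borel_measurable half_line"
    and "(\<lambda>y. tail_sup p a F (exp y - 1)) \<in> borel_measurable half_line"
    and "(\<lambda>y. ennreal (exp (- (r * y))) * head_int p c F (exp y - 1)) \<in> borel_measurable half_line"
proof -
  note [measurable] = exp_Lp_interval_measurable[OF p]
    borel_measurable_antimono_ennreal[OF tail_sup_antimono[OF p]]
    borel_measurable_mono_ennreal[OF head_int_mono[OF p]]
  show "(\<lambda>y. ennreal (exp (- (a * y))) * exp_Lp p F {0<..<exp y - 1}) \<in> borel_measurable half_line"
    "(\<lambda>y. ennreal (exp (- (a * y))) * exp_Lp p F {exp y - 1<..}) \<in> borel_measurable half_line"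
    "(\<lambda>y. exp_Lp p F {exp y - 1<..}) \<in> borel_measurable half_line"
    "(\<lambda>y. tail_sup p a F (exp y - 1)) \<in> borel_measurable half_line"
    "(\<lambda>y. ennreal (exp (- (r * y))) * head_int p c F (exp y - 1)) \<in> borel_measurable half_line"
    by (rule borel_measurable_half_line; measurable)+
qed

context ri_function_norm
begin

lemma norm_cong_half_line:
  assumes g: "g \<in> borel_measurable half_line" and eq: "\<And>u. u > 0 \<Longrightarrow> f u = g u"
  shows "\<rho> f = \<rho> g"
proof -
  have "f \<in> borel_measurable half_line"
    using g by (subst measurable_cong[where g = g]) (auto simp: eq)
  then show ?thesis
    using g eq by (intro norm_cong) auto
qed

context
  fixes M :: "'a measure" and p a c \<eta> :: real and b :: "real \<Rightarrow> real"
    and grand small :: "('a \<Rightarrow> 'k::{real_normed_field, second_countable_topology}) \<Rightarrow> ennreal"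
  assumes M: "finite_measure M" and p: "p > 1" and a: "a > 0" and c: "c > 0"
    and b: "slowly_varying b"
    and grand: "\<And>f. grand f = tail_sup p a (log_rearr M f) 0"
    and small: "\<And>f. small f = full_int p c (log_rearr M f)"
begin

abbreviation (input) "\<gamma> \<equiv> a + c"
abbreviation (input) "\<theta> \<equiv> \<eta> * (a + c)"

abbreviation (input) tail_sup_at :: "('a \<Rightarrow> 'k) \<Rightarrow> real \<Rightarrow> ennreal" where
  "tail_sup_at f y \<equiv> tail_sup p a (log_rearr M f) (exp y - 1)"
abbreviation (input) head_int_at :: "('a \<Rightarrow> 'k) \<Rightarrow> real \<Rightarrow> ennreal" where
  "head_int_at f y \<equiv> ennreal (exp (- (\<gamma> * y))) * head_int p c (log_rearr M f) (exp y - 1)"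
abbreviation (input) head_at :: "('a \<Rightarrow> 'k) \<Rightarrow> real \<Rightarrow> ennreal" where
  "head_at f y \<equiv> ennreal (exp (- (a * y))) * exp_Lp p (log_rearr M f) {0<..<exp y - 1}"
abbreviation (input) tail_at :: "('a \<Rightarrow> 'k) \<Rightarrow> real \<Rightarrow> ennreal" where
  "tail_at f y \<equiv> ennreal (exp (- (a * y))) * exp_Lp p (log_rearr M f) {exp y - 1<..}"
abbreviation (input) weighted_tail_at :: "('a \<Rightarrow> 'k) \<Rightarrow> real \<Rightarrow> ennreal" where
  "weighted_tail_at f y \<equiv> exp_Lp p (\<lambda>u. ennreal ((1 + u) powr (- a)) * log_rearr M f u) {exp y - 1<..}"
abbreviation (input) block_at :: "('a \<Rightarrow> 'k) \<Rightarrow> real \<Rightarrow> ennreal" where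
  "block_at f \<equiv> block_norm p a (log_rearr M f)"

abbreviation (input) weighted_norm :: "(('a \<Rightarrow> 'k) \<Rightarrow> real \<Rightarrow> ennreal) \<Rightarrow> ('a \<Rightarrow> 'k) \<Rightarrow> ennreal" where
  "weighted_norm G f \<equiv> \<rho> (\<lambda>y. log_weight \<theta> \<gamma> b y * G f y)"

abbreviation (input) raw_norm :: "('a \<Rightarrow> 'k) \<Rightarrow> ennreal" where
  "raw_norm f \<equiv> tilde_norm \<rho> 0 1 (\<lambda>t. ennreal (t powr (- \<eta>) * b t) * K_functional M grand small t f)"

lemma gamma_pos: "\<gamma> > 0"
  using a c by simp

lemma log_weight_borel [measurable]: "log_weight t \<gamma> b \<in> borel_measurable half_line"
  using b gamma_pos by (rule log_weight_measurable)

lemma p_pos: "p > 0" and p_ge_1: "p \<ge> 1"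
  using p by simp_all

lemma head_at_measurable [measurable]: "head_at f \<in> borel_measurable half_line"
  and tail_at_measurable [measurable]: "tail_at f \<in> borel_measurable half_line"
  and weighted_tail_at_measurable [measurable]: "weighted_tail_at f \<in> borel_measurable half_line"
  and tail_sup_at_measurable [measurable]: "tail_sup_at f \<in> borel_measurable half_line"
  and head_int_at_measurable [measurable]: "head_int_at f \<in> borel_measurable half_line"
  and block_at_measurable [measurable]: "block_at f \<in> borel_measurable half_line"
  by (intro double_exp_measurable p_pos block_norm_measurable log_rearr_measurable)+

lemma dominated_pointwise:
  assumes [measurable]: "\<And>f. G f \<in> borel_measurable half_line" "\<And>f. H f \<in> borel_measurable half_line"
    and C: "C > 0" and le: "\<And>f y. f \<in> borel_measurable M \<Longrightarrow> y > 0 \<Longrightarrow> G f y \<le> ennreal C * H f y"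
  shows "dominated M (weighted_norm G) (weighted_norm H)"
proof (rule dominatedI[OF C])
  fix f :: "'a \<Rightarrow> 'k" assume f: "f \<in> borel_measurable M"
  have "weighted_norm G f \<le> \<rho> (\<lambda>y. ennreal C * (log_weight \<theta> \<gamma> b y * H f y))"
  proof (rule norm_le)
    fix y :: real assume "y > 0"
    then have "log_weight \<theta> \<gamma> b y * G f y \<le> log_weight \<theta> \<gamma> b y * (ennreal C * H f y)"
      using f by (intro mult_left_mono le) auto
    then show "log_weight \<theta> \<gamma> b y * G f y \<le> ennreal C * (log_weight \<theta> \<gamma> b y * H f y)"
      by (simp add: ac_simps)
  qed measurable
  also have "\<dots> = ennreal C * weighted_norm H f"
    using C by (intro norm_scale) auto
  finally show "weighted_norm G f \<le> ennreal C * weighted_norm H f" .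
qed

lemma dominated_forward:
  assumes "\<And>f. G f \<in> borel_measurable half_line" "\<And>f. H f \<in> borel_measurable half_line"
    and "s < \<theta>" "K \<ge> 0"
    and le: "\<And>f y. f \<in> borel_measurable M \<Longrightarrow> y > 0 \<Longrightarrow>
      G f y \<le> (\<Sum>k. ennreal (K * exp (s * real k)) * H f (y + real k))"
  shows "dominated M (weighted_norm G) (weighted_norm H)"
proof (rule norm_weighted_forward[OF b gamma_pos assms(3,4)])
  fix C :: real
  assume C: "C > 0" and norm_le: "\<And>G P. G \<in> borel_measurable half_line \<Longrightarrow> P \<in> borel_measurable half_line \<Longrightarrow>
      (\<And>y. y > 0 \<Longrightarrow> G y \<le> (\<Sum>k. ennreal (K * exp (s * real k)) * P (y + real k))) \<Longrightarrow>
      \<rho> (\<lambda>y. log_weight \<theta> \<gamma> b y * G y) \<le> ennreal C * \<rho> (\<lambda>y. log_weight \<theta> \<gamma> b y * P y)"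
  show ?thesis
    by (rule dominatedI[OF C], rule norm_le[OF assms(1,2)], rule le)
qed

lemma dominated_backward:
  assumes "\<And>f. G f \<in> borel_measurable half_line" "\<And>f. H f \<in> borel_measurable half_line"
    and "\<theta> < s" "K \<ge> 0"
    and le: "\<And>f y. f \<in> borel_measurable M \<Longrightarrow> y > 0 \<Longrightarrow>
      G f y \<le> (\<Sum>k. ennreal (K * exp (- s * real k)) * (if real k < y then H f (y - real k) else 0))"
  shows "dominated M (weighted_norm G) (weighted_norm H)"
proof (rule norm_weighted_backward[OF b gamma_pos assms(3,4)])
  fix C :: real
  assume C: "C > 0" and norm_le: "\<And>G P. G \<in> borel_measurable half_line \<Longrightarrow> P \<in> borel_measurable half_line \<Longrightarrow>
      (\<And>y. y > 0 \<Longrightarrow> G y \<le> (\<Sum>k. ennreal (K * exp (- s * real k)) * (if real k < y then P (y - real k) else 0))) \<Longrightarrow>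
      \<rho> (\<lambda>y. log_weight \<theta> \<gamma> b y * G y) \<le> ennreal C * \<rho> (\<lambda>y. log_weight \<theta> \<gamma> b y * P y)"
  show ?thesis
    by (rule dominatedI[OF C], rule norm_le[OF assms(1,2)], rule le)
qed

lemma tail_sup_dominated_block:
  assumes "0 < \<theta>"
  shows "dominated M (weighted_norm tail_sup_at) (weighted_norm block_at)"
  by (rule dominated_forward[where s = 0 and K = "exp a", OF tail_sup_at_measurable block_at_measurable assms])
    (simp, rule tail_sup_le_blocks[OF p_ge_1 a log_rearr_mono])

lemma weighted_tail_dominated_block:
  assumes "0 < \<theta>"
  shows "dominated M (weighted_norm weighted_tail_at) (weighted_norm block_at)"
  by (rule dominated_forward[where s = 0 and K = "exp a", OF weighted_tail_at_measurable block_at_measurable assms])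
    (simp, rule weighted_tail_le_blocks[OF p_ge_1 a log_rearr_mono])

lemma tail_dominated_block:
  assumes "a < \<theta>"
  shows "dominated M (weighted_norm tail_at) (weighted_norm block_at)"
  by (rule dominated_forward[where s = a and K = 1, OF tail_at_measurable block_at_measurable assms])
    (simp, rule tail_norm_le_blocks[OF p_ge_1 a log_rearr_mono])

lemma head_dominated_block:
  assumes "\<theta> < a"
  shows "dominated M (weighted_norm head_at) (weighted_norm block_at)"
  by (rule dominated_backward[where s = a and K = 1, OF head_at_measurable block_at_measurable assms])
    (simp, rule head_norm_le_blocks[OF p_ge_1 a log_rearr_mono])

lemma head_int_dominated_block:
  assumes "\<theta> < \<gamma>"
  shows "dominated M (weighted_norm head_int_at) (weighted_norm block_at)"
  by (rule dominated_backward[where s = "a + c" and K = "exp c / c",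
        OF head_int_at_measurable block_at_measurable assms])
    (use c in simp, rule head_int_le_blocks[OF p_ge_1 a log_rearr_mono c])

text \<open>
  The first two terms of the sum in \<open>block_norm_le_shifted_tail_sup\<close> suffice for
  the bound, so its rate of decay can be any number above \<open>\<theta>\<close>.
\<close>

lemma block_dominated_tail_sup: "dominated M (weighted_norm block_at) (weighted_norm tail_sup_at)"
proof (rule dominated_backward[OF block_at_measurable tail_sup_at_measurable])
  show "\<theta> < \<theta> + 1"
    by simp
  show "block_at f y \<le> (\<Sum>k. ennreal ((exp (exp 1 / p) * (4 * exp 1) powr a + (2 * exp 2) powr a +
      2 powr a * exp (a + (\<theta> + 1))) * exp (- (\<theta> + 1) * real k)) *
      (if real k < y then tail_sup_at f (y - real k) else 0))" if "y > 0" for f y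
    by (rule block_norm_le_shifted_tail_sup[OF p_ge_1 a log_rearr_mono that])
qed auto

text \<open>
  A single translate bounds the block; it is the term \<open>k = 1\<close> of a sum of the shape
  required by \<open>dominated_forward\<close>, at a rate below \<open>\<theta>\<close>.
\<close>

lemma block_dominated_head: "dominated M (weighted_norm block_at) (weighted_norm head_at)"
proof (rule dominated_forward[OF block_at_measurable head_at_measurable])
  show "\<theta> - 1 < \<theta>"
    by simp
  fix f :: "'a \<Rightarrow> 'k" and y :: real
  let ?t = "\<lambda>k. ennreal (exp a * exp (- (\<theta> - 1)) * exp ((\<theta> - 1) * real k)) * head_at f (y + real k)"
  have "exp (- (\<theta> - 1)) * exp (\<theta> - 1) = 1"
    by (simp add: exp_add[symmetric])
  then have const: "exp a = exp a * exp (- (\<theta> - 1)) * exp ((\<theta> - 1) * real 1)"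
    by (simp add: mult.assoc)
  have "block_at f y \<le> ennreal (exp a) * head_at f (y + real 1)"
    using block_norm_le_head_norm[OF p_ge_1 a log_rearr_mono, of M f y] by simp
  also have "\<dots> = ?t 1"
    by (rule arg_cong[where f = "\<lambda>r. ennreal r * head_at f (y + real 1)", OF const])
  also have "\<dots> \<le> (\<Sum>k. ?t k)"
    using sum_le_suminf[of ?t "{1}"] by simp
  finally show "block_at f y \<le> (\<Sum>k. ?t k)" .
qed auto

lemma tail_sup_dominated_tail: "dominated M (weighted_norm tail_sup_at) (weighted_norm tail_at)"
proof (rule dominated_pointwise[where C = 1])
  fix f :: "'a \<Rightarrow> 'k" and y :: real assume "y > 0"
  then show "tail_sup_at f y \<le> ennreal 1 * tail_at f y"
    using tail_sup_le_tail_norm[OF p_ge_1 a log_rearr_mono, of "exp y - 1" M f] by (simp add: powr_def)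
qed (auto intro: tail_sup_at_measurable tail_at_measurable)

lemma tail_sup_dominated_weighted_tail:
  "dominated M (weighted_norm tail_sup_at) (weighted_norm weighted_tail_at)"
proof (rule dominated_pointwise[where C = 1])
  fix f :: "'a \<Rightarrow> 'k" and y :: real assume "y > 0"
  then show "tail_sup_at f y \<le> ennreal 1 * weighted_tail_at f y"
    using tail_sup_le_weighted_tail[OF p_ge_1 a log_rearr_mono, of "exp y - 1" M f] by simp
qed (auto intro: tail_sup_at_measurable weighted_tail_at_measurable)

lemma head_int_dominated_head: "dominated M (weighted_norm head_int_at) (weighted_norm head_at)"
proof (rule dominated_pointwise[where C = "1 / c"])
  fix f :: "'a \<Rightarrow> 'k" and y :: real assume "y > 0"
  then show "head_int_at f y \<le> ennreal (1 / c) * head_at f y"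
    by (rule head_int_le_head_norm[OF p_ge_1 a log_rearr_mono c])
qed (use c in \<open>auto intro: head_int_at_measurable head_at_measurable\<close>)

abbreviation (input) K_at :: "('a \<Rightarrow> 'k) \<Rightarrow> real \<Rightarrow> ennreal" where
  "K_at f y \<equiv> K_functional M grand small (exp (- (\<gamma> * y))) f"

lemma K_at_measurable [measurable]: "(\<lambda>y. K_functional M grand small (exp (- (r * y))) f) \<in> borel_measurable half_line"
proof -
  note [measurable] = borel_measurable_mono_ennreal[OF K_functional_mono[of M grand small f]]
  show ?thesis
    by (rule borel_measurable_half_line) measurable
qed

lemma exp_scale: "(1 + (exp y - 1)) powr (- \<gamma>) = exp (- (\<gamma> * y))" for y :: real
  by (simp add: powr_def algebra_simps)

lemma K_dominated: "dominated M (weighted_norm K_at) (\<lambda>f. weighted_norm tail_sup_at f + weighted_norm head_int_at f)"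
proof -
  obtain C where C: "C > 0"
    "\<And>f x. f \<in> borel_measurable M \<Longrightarrow> x \<ge> 0 \<Longrightarrow>
      K_functional M grand small ((1 + x) powr (- \<gamma>)) f \<le>
      ennreal C * (tail_sup p a (log_rearr M f) x +
        ennreal ((1 + x) powr (- \<gamma>)) * head_int p c (log_rearr M f) x)"
    using K_functional_le[OF M p a c, of grand small] grand small by blast
  have "dominated M (weighted_norm K_at) (weighted_norm (\<lambda>f y. tail_sup_at f y + head_int_at f y))"
  proof (rule dominated_pointwise[OF _ _ C(1)])
    fix f :: "'a \<Rightarrow> 'k" and y :: real assume "f \<in> borel_measurable M" "y > 0"
    then show "K_at f y \<le> ennreal C * (tail_sup_at f y + head_int_at f y)"
      using C(2)[of f "exp y - 1"] unfolding exp_scale by simp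
  qed (intro K_at_measurable borel_measurable_add tail_sup_at_measurable head_int_at_measurable)+
  also have "dominated M \<dots> (\<lambda>f. weighted_norm tail_sup_at f + weighted_norm head_int_at f)"
  proof (rule dominated_le)
    fix f :: "'a \<Rightarrow> 'k"
    have "\<rho> (\<lambda>y. log_weight \<theta> \<gamma> b y * tail_sup_at f y + log_weight \<theta> \<gamma> b y * head_int_at f y) \<le>
        weighted_norm tail_sup_at f + weighted_norm head_int_at f"
      by (intro norm_triangle borel_measurable_times_ennreal log_weight_borel
          tail_sup_at_measurable head_int_at_measurable)
    then show "\<rho> (\<lambda>y. log_weight \<theta> \<gamma> b y * (tail_sup_at f y + head_int_at f y)) \<le>
        weighted_norm tail_sup_at f + weighted_norm head_int_at f"
      by (simp only: distrib_left[of "log_weight t g b y" for t g b y])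
  qed
  finally show ?thesis .
qed

lemma K_dominates:
  "dominated M (weighted_norm tail_sup_at) (weighted_norm K_at)" (is ?A)
  "dominated M (weighted_norm head_int_at) (weighted_norm K_at)" (is ?D)
proof -
  obtain C where C: "C > 0"
    "\<And>f x. f \<in> borel_measurable M \<Longrightarrow> x \<ge> 0 \<Longrightarrow>
      tail_sup p a (log_rearr M f) x + ennreal ((1 + x) powr (- \<gamma>)) * head_int p c (log_rearr M f) x \<le>
      ennreal C * K_functional M grand small ((1 + x) powr (- \<gamma>)) f"
    using K_functional_ge[OF M p a c, of grand small] grand small by blast
  have le: "tail_sup_at f y + head_int_at f y \<le> ennreal C * K_at f y"
    if "f \<in> borel_measurable M" "y > 0" for f y
    using C(2)[of f "exp y - 1"] that unfolding exp_scale by simp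
  show ?A
    by (rule dominated_pointwise[OF tail_sup_at_measurable K_at_measurable C(1)])
      (rule order_trans[OF _ le], auto)
  show ?D
    by (rule dominated_pointwise[OF head_int_at_measurable K_at_measurable C(1)])
      (rule order_trans[OF _ le], auto)
qed

lemma raw_norm_eq: "raw_norm f = \<rho> (\<lambda>v. log_weight \<eta> 1 b v * K_functional M grand small (exp (- (1 * v))) f)"
proof -
  note [measurable] = log_weight_measurable[OF b zero_less_one]
  show ?thesis
    unfolding tilde_norm_def
  proof (rule norm_cong_half_line)
    fix u :: real assume "u > 0"
    then show "indicator {0<..<1} (exp (- u)) * (ennreal (exp (- u) powr (- \<eta>) * b (exp (- u))) *
        K_functional M grand small (exp (- u)) f) =
      log_weight \<eta> 1 b u * K_functional M grand small (exp (- (1 * u))) f"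
      by (simp add: log_weight_def powr_def)
  qed measurable
qed

lemma log_weight_dilate: "log_weight \<eta> 1 b (\<gamma> * y) = log_weight \<theta> \<gamma> b y"
  by (simp add: log_weight_def mult.assoc)

text \<open>
  The interpolation norm uses the parameter \<open>e^(-v)\<close>, the formula for the
  K-functional the parameter \<open>e^(-\<gamma>y)\<close>; the two are related by the dilation
  \<open>v = \<gamma>y\<close> and its inverse.
\<close>

lemma raw_norm_equiv_K:
  "dominated M (weighted_norm K_at) raw_norm" "dominated M raw_norm (weighted_norm K_at)"
proof -
  note [measurable] = log_weight_measurable[OF b zero_less_one]
  let ?g = "\<lambda>f v. log_weight \<eta> 1 b v * K_functional M grand small (exp (- (1 * v))) f"
  have g[measurable]: "?g f \<in> borel_measurable half_line" for f
    by measurable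
  have dilate: "?g f (\<gamma> * y) = log_weight \<theta> \<gamma> b y * K_at f y" for f y
    by (simp only: log_weight_dilate mult_1)
  obtain C where C: "C > 0"
    "\<And>h :: real \<Rightarrow> ennreal. h \<in> borel_measurable half_line \<Longrightarrow> \<rho> (\<lambda>u. h (\<gamma> * u)) \<le> ennreal C * \<rho> h"
    using norm_dilation[OF gamma_pos] by blast
  show "dominated M (weighted_norm K_at) raw_norm"
    using C(2)[OF g] unfolding raw_norm_eq dilate by (intro dominatedI[OF C(1)])
  have "inverse \<gamma> > 0"
    using gamma_pos by simp
  from norm_dilation[OF this] obtain D where D: "D > 0"
    "\<And>h :: real \<Rightarrow> ennreal. h \<in> borel_measurable half_line \<Longrightarrow> \<rho> (\<lambda>u. h (inverse \<gamma> * u)) \<le> ennreal D * \<rho> h"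
    by blast
  show "dominated M raw_norm (weighted_norm K_at)"
  proof (rule dominatedI[OF D(1)])
    fix f :: "'a \<Rightarrow> 'k"
    have "\<rho> (\<lambda>u. (\<lambda>y. ?g f (\<gamma> * y)) (inverse \<gamma> * u)) \<le> ennreal D * \<rho> (\<lambda>y. ?g f (\<gamma> * y))"
      by (rule D(2)) (rule dilation_measurable[OF g gamma_pos])
    moreover have "\<gamma> * (inverse \<gamma> * u) = u" for u
      using gamma_pos by simp
    ultimately show "raw_norm f \<le> ennreal D * weighted_norm K_at f"
      unfolding raw_norm_eq dilate[symmetric] by simp
  qed
qed

lemma raw_dominates_block: "dominated M (weighted_norm block_at) raw_norm"
  by (rule dominated_trans[OF block_dominated_tail_sup dominated_trans[OF K_dominates(1) raw_norm_equiv_K(1)]])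

lemma raw_dominatedI:
  assumes "dominated M (weighted_norm tail_sup_at) X" "dominated M (weighted_norm head_int_at) X"
  shows "dominated M raw_norm X"
  by (rule dominated_trans[OF raw_norm_equiv_K(2) dominated_trans[OF K_dominated dominated_add[OF assms]]])

text \<open>
  A finite interpolation norm makes the K-functional finite at some point.
\<close>

lemma grand_finite:
  assumes f: "f \<in> borel_measurable M" and fin: "raw_norm f < \<infinity>"
  shows "grand f < \<infinity>"
proof -
  note [measurable] = log_weight_measurable[OF b zero_less_one]
  have "AE v in half_line. log_weight \<eta> 1 b v * K_functional M grand small (exp (- (1 * v))) f < \<infinity>"
    using fin unfolding raw_norm_eq by (intro norm_finite_AE) measurable
  then obtain v where v: "v > 0" "log_weight \<eta> 1 b v * K_functional M grand small (exp (- (1 * v))) f < \<infinity>"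
    using AE_half_line_ex[OF _ order_refl zero_less_one] by meson
  have "b (exp (- v)) > 0"
    using b v(1) by (auto simp: slowly_varying_def)
  then have "log_weight \<eta> 1 b v > 0"
    by (simp add: log_weight_def)
  then have K: "K_functional M grand small (exp (- v)) f < \<infinity>"
    using v(2) by (auto simp: ennreal_mult_less_top)
  define x where "x = exp (v / \<gamma>) - 1"
  have x: "x \<ge> 0"
    using v gamma_pos by (simp add: x_def)
  have "(1 + x) powr (- \<gamma>) = exp (- v)"
  proof -
    have "\<gamma> * (v / \<gamma>) = v"
      using gamma_pos by simp
    then show ?thesis
      by (simp only: x_def exp_scale)
  qed
  moreover obtain C where C: "C > 0"
    "\<And>f x. f \<in> borel_measurable M \<Longrightarrow> x \<ge> 0 \<Longrightarrow>
      tail_sup p a (log_rearr M f) x + ennreal ((1 + x) powr (- \<gamma>)) * head_int p c (log_rearr M f) x \<le>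
      ennreal C * K_functional M grand small ((1 + x) powr (- \<gamma>)) f"
    using K_functional_ge[OF M p a c, of grand small] grand small by blast
  ultimately have "tail_sup p a (log_rearr M f) x + ennreal (exp (- v)) * head_int p c (log_rearr M f) x \<le>
      ennreal C * K_functional M grand small (exp (- v)) f"
    using C(2)[OF f x] by simp
  also have "\<dots> < \<infinity>"
    using K by (simp add: ennreal_mult_less_top)
  finally have "tail_sup p a (log_rearr M f) x < \<infinity>"
    by (simp add: less_top)
  then show ?thesis
    unfolding grand by (rule grand_finite_of_tail_sup[OF p_ge_1 a x log_rearr_mono])
qed

lemma interpolation_same_spaceI:
  assumes "dominated M (weighted_norm tail_sup_at) X" "dominated M (weighted_norm head_int_at) X"
    and "dominated M X raw_norm"
  shows "same_space M (interpolation_norm M grand small \<eta> b \<rho>) X"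
  using same_space_interpolation[OF refl grand_finite raw_dominatedI[OF assms(1,2)] assms(3)] .

text \<open>
  In the following lemmas the target norms \<open>X\<close> that are not themselves part of the
  K-functional are bounded through the blocks, \<open>X \<lesssim> P \<lesssim> A \<lesssim>
  K\<close>. The opposite bound consists of separate estimates of the two parts \<open>A\<close>
  and \<open>D\<close> of the K-functional by the target norm.
\<close>

lemma interpolation_low:
  assumes "0 < \<theta>" "\<theta> < a"
  shows "same_space M (interpolation_norm M grand small \<eta> b \<rho>) (weighted_norm head_at)"
proof (rule interpolation_same_spaceI)
  show "dominated M (weighted_norm tail_sup_at) (weighted_norm head_at)"
    using tail_sup_dominated_block[OF assms(1)] block_dominated_head by (rule dominated_trans)
  show "dominated M (weighted_norm head_int_at) (weighted_norm head_at)"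
    by (rule head_int_dominated_head)
  show "dominated M (weighted_norm head_at) raw_norm"
    using head_dominated_block[OF assms(2)] raw_dominates_block by (rule dominated_trans)
qed

lemma interpolation_high:
  assumes "a < \<theta>" "\<theta> < \<gamma>"
  shows "same_space M (interpolation_norm M grand small \<eta> b \<rho>) (weighted_norm tail_at)"
proof (rule interpolation_same_spaceI)
  show *: "dominated M (weighted_norm tail_sup_at) (weighted_norm tail_at)"
    by (rule tail_sup_dominated_tail)
  show "dominated M (weighted_norm head_int_at) (weighted_norm tail_at)"
    by (rule dominated_trans[OF head_int_dominated_block[OF assms(2)]
          dominated_trans[OF block_dominated_tail_sup *]])
  show "dominated M (weighted_norm tail_at) raw_norm"
    using tail_dominated_block[OF assms(1)] raw_dominates_block by (rule dominated_trans)
qed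

lemma interpolation_critical:
  assumes "0 < \<theta>" "\<theta> < \<gamma>"
  shows "same_space M (interpolation_norm M grand small \<eta> b \<rho>) (weighted_norm weighted_tail_at)"
proof (rule interpolation_same_spaceI)
  show *: "dominated M (weighted_norm tail_sup_at) (weighted_norm weighted_tail_at)"
    by (rule tail_sup_dominated_weighted_tail)
  show "dominated M (weighted_norm head_int_at) (weighted_norm weighted_tail_at)"
    by (rule dominated_trans[OF head_int_dominated_block[OF assms(2)]
          dominated_trans[OF block_dominated_tail_sup *]])
  show "dominated M (weighted_norm weighted_tail_at) raw_norm"
    using weighted_tail_dominated_block[OF assms(1)] raw_dominates_block by (rule dominated_trans)
qed

lemma interpolation_lower_limit:
  assumes "\<theta> < a"
  shows "same_space M (interpolation_norm M grand small \<eta> b \<rho>)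
    (inter_norm (weighted_norm head_at) (weighted_norm tail_sup_at))"
proof (rule interpolation_same_spaceI)
  show "dominated M (weighted_norm tail_sup_at) (inter_norm (weighted_norm head_at) (weighted_norm tail_sup_at))"
    by (rule dominated_inter_norm2)
  show "dominated M (weighted_norm head_int_at) (inter_norm (weighted_norm head_at) (weighted_norm tail_sup_at))"
    using head_int_dominated_head dominated_inter_norm1 by (rule dominated_trans)
  show "dominated M (inter_norm (weighted_norm head_at) (weighted_norm tail_sup_at)) raw_norm"
    by (rule dominated_inter_norm[OF dominated_trans[OF head_dominated_block[OF assms] raw_dominates_block]
          dominated_trans[OF K_dominates(1) raw_norm_equiv_K(1)]])
qed

lemma interpolation_upper_limit:
  assumes "a < \<theta>"
  shows "same_space M (interpolation_norm M grand small \<eta> b \<rho>)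
    (inter_norm (weighted_norm tail_at) (weighted_norm head_int_at))"
proof (rule interpolation_same_spaceI)
  show "dominated M (weighted_norm tail_sup_at) (inter_norm (weighted_norm tail_at) (weighted_norm head_int_at))"
    using tail_sup_dominated_tail dominated_inter_norm1 by (rule dominated_trans)
  show "dominated M (weighted_norm head_int_at) (inter_norm (weighted_norm tail_at) (weighted_norm head_int_at))"
    by (rule dominated_inter_norm2)
  show "dominated M (inter_norm (weighted_norm tail_at) (weighted_norm head_int_at)) raw_norm"
    by (rule dominated_inter_norm[OF dominated_trans[OF tail_dominated_block[OF assms] raw_dominates_block]
          dominated_trans[OF K_dominates(2) raw_norm_equiv_K(1)]])
qed

end

end

section \<open>The interpolation spaces\<close>

text \<open>
  The argument \<open>e^(-x)\<close> with \<open>x = e^y - 1\<close> is the form in which the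
  formulas of the previous sections apply.
\<close>

lemma hat_norm_eq: "hat_norm E g = E (\<lambda>y. g (exp (- (exp y - 1))))"
  by (simp add: hat_norm_def)

lemma ell_double_exp: "y > 0 \<Longrightarrow> ell (exp (- (exp y - 1))) = exp y"
  using ell_exp[of "exp y - 1"] by simp

context
  fixes p \<alpha> \<beta> :: real
  assumes p: "p > 1"
begin

lemma phi_exponent: "(\<beta> - \<alpha>) / p - \<beta> = - (\<alpha> / p + \<beta> / conjugate_exponent p)"
  using p by (simp add: conjugate_exponent_def field_simps)

lemma phi_double_exp:
  assumes "y > 0"
  shows "phi p \<alpha> \<beta> (exp (- (exp y - 1))) = exp (- ((\<alpha> / p + \<beta> / conjugate_exponent p) * y))"
  unfolding phi_def phi_exponent ell_double_exp[OF assms] 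
  by (simp add: powr_def distrib_right left_diff_distrib)

lemma B_weight_double_exp:
  assumes "y > 0"
  shows "ennreal (B_weight p \<alpha> \<beta> b \<eta> (exp (- (exp y - 1)))) =
    log_weight (\<eta> * (\<alpha> / p + \<beta> / conjugate_exponent p)) (\<alpha> / p + \<beta> / conjugate_exponent p) b y *
    ennreal (exp (- (\<alpha> / p * y)))"
proof -
  let ?c = "\<beta> / conjugate_exponent p"
  let ?g = "\<alpha> / p + ?c"
  have "- (\<alpha> * (1 - \<eta>) / p) + \<beta> * \<eta> / conjugate_exponent p = \<eta> * ?g + - (\<alpha> / p)"
    using p by (simp add: field_simps)
  then have "B_weight p \<alpha> \<beta> b \<eta> (exp (- (exp y - 1))) =
      exp y powr (\<eta> * ?g + - (\<alpha> / p)) * b (exp (- (?g * y)))"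
    using phi_double_exp[OF assms] unfolding phi_def B_weight_def ell_double_exp[OF assms] by simp
  also have "exp y powr (\<eta> * ?g + - (\<alpha> / p)) = exp (- (\<alpha> / p * y)) * exp (\<eta> * ?g * y)"
    by (simp only: powr_add) (simp add: powr_def)
  finally show ?thesis
    unfolding log_weight_def by (simp add: ennreal_mult' ac_simps)
qed

lemma B_sharp_weight_double_exp:
  assumes "y > 0"
  shows "ennreal (B_sharp_weight p \<alpha> \<beta> b \<eta> (exp (- (exp y - 1)))) =
    log_weight (\<eta> * (\<alpha> / p + \<beta> / conjugate_exponent p)) (\<alpha> / p + \<beta> / conjugate_exponent p) b y"
proof -
  have "(\<alpha> - \<beta>) / p + \<beta> = \<alpha> / p + \<beta> / conjugate_exponent p"
    using phi_exponent by (simp add: diff_divide_distrib)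
  then show ?thesis
    using phi_double_exp[OF assms]
    unfolding phi_def B_sharp_weight_def ell_double_exp[OF assms] log_weight_def
    by (simp add: powr_def)
qed

lemma phi_weight_double_exp:
  assumes "y > 0"
  shows "ennreal ((b \<circ> phi p \<alpha> \<beta>) (exp (- (exp y - 1)))) =
    log_weight (0 * (\<alpha> / p + \<beta> / conjugate_exponent p)) (\<alpha> / p + \<beta> / conjugate_exponent p) b y"
  using phi_double_exp[OF assms] by (simp add: log_weight_def)

lemma phi_weight_double_exp':
  assumes "y > 0"
  shows "ennreal ((b \<circ> phi p \<alpha> \<beta>) (exp (- (exp y - 1)))) =
    log_weight (1 * (\<alpha> / p + \<beta> / conjugate_exponent p)) (\<alpha> / p + \<beta> / conjugate_exponent p) b y *
    ennreal (exp (- ((\<alpha> / p + \<beta> / conjugate_exponent p) * y)))"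
proof -
  let ?g = "\<alpha> / p + \<beta> / conjugate_exponent p"
  have "exp (?g * y) * r * exp (- (?g * y)) = r" for r
    by (simp add: exp_minus)
  then have cancel: "exp (?g * y) * b (exp (- (?g * y))) * exp (- (?g * y)) = b (exp (- (?g * y)))" .
  show ?thesis
    unfolding log_weight_def mult_1 o_apply phi_double_exp[OF assms]
    by (subst ennreal_mult''[symmetric]) (simp_all only: cancel exp_ge_zero)
qed

end

context ri_function_norm
begin

context
  fixes M :: "'a measure" and p \<alpha> \<beta> a c \<eta> :: real and b :: "real \<Rightarrow> real"
    and f :: "'a \<Rightarrow> 'k::{real_normed_field, second_countable_topology}"
  assumes p: "p > 1" and \<alpha>: "\<alpha> > 0" and \<beta>: "\<beta> > 0" and b: "slowly_varying b"
    and a: "a = \<alpha> / p" and c: "c = \<beta> / conjugate_exponent p"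
begin

lemma a_pos: "a > 0" and c_pos: "c > 0"
  using p \<alpha> \<beta> by (auto simp: a c conjugate_exponent_def)

lemmas measurable_at =
  log_weight_measurable[OF b add_pos_pos[OF a_pos c_pos]]

lemma R_norm_eq:
  "R_norm M p (B_weight p \<alpha> \<beta> b \<eta>) \<rho> (\<lambda>_. 1) (Lp_norm p) f =
    \<rho> (\<lambda>y. log_weight (\<eta> * (a + c)) (a + c) b y *
      (ennreal (exp (- (a * y))) * exp_Lp p (log_rearr M f) {0<..<exp y - 1}))"
  unfolding R_norm_def hat_norm_eq
proof (rule norm_cong_half_line)
  fix y :: real assume y: "y > 0"
  have "tilde_norm (Lp_norm p) (exp (- (exp y - 1))) 1 (weighted_rearr M p (\<lambda>_. 1) f) =
      exp_Lp p (log_rearr M f) {0<..<exp y - 1}"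
    using p tilde_Lp_between[of p 0 "exp y - 1" M f] by simp
  then show "ennreal (B_weight p \<alpha> \<beta> b \<eta> (exp (- (exp y - 1)))) *
      tilde_norm (Lp_norm p) (exp (- (exp y - 1))) 1 (weighted_rearr M p (\<lambda>_. 1) f) =
    log_weight (\<eta> * (a + c)) (a + c) b y *
      (ennreal (exp (- (a * y))) * exp_Lp p (log_rearr M f) {0<..<exp y - 1})"
    by (simp only: B_weight_double_exp[OF p y] a c mult.assoc)
qed (intro borel_measurable_times_ennreal measurable_at double_exp_measurable less_trans[OF zero_less_one p])

lemma L_norm_eq:
  "L_norm M p (B_weight p \<alpha> \<beta> b \<eta>) \<rho> (\<lambda>_. 1) (Lp_norm p) f =
    \<rho> (\<lambda>y. log_weight (\<eta> * (a + c)) (a + c) b y *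
      (ennreal (exp (- (a * y))) * exp_Lp p (log_rearr M f) {exp y - 1<..}))"
  unfolding L_norm_def hat_norm_eq
proof (rule norm_cong_half_line)
  fix y :: real assume y: "y > 0"
  then have "tilde_norm (Lp_norm p) 0 (exp (- (exp y - 1))) (weighted_rearr M p (\<lambda>_. 1) f) =
      exp_Lp p (log_rearr M f) {exp y - 1<..}"
    using p tilde_Lp_tail[of p "exp y - 1" "\<lambda>_. 1" M f] by simp
  then show "ennreal (B_weight p \<alpha> \<beta> b \<eta> (exp (- (exp y - 1)))) *
      tilde_norm (Lp_norm p) 0 (exp (- (exp y - 1))) (weighted_rearr M p (\<lambda>_. 1) f) =
    log_weight (\<eta> * (a + c)) (a + c) b y *
      (ennreal (exp (- (a * y))) * exp_Lp p (log_rearr M f) {exp y - 1<..})"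
    by (simp only: B_weight_double_exp[OF p y] a c mult.assoc)
qed (intro borel_measurable_times_ennreal measurable_at double_exp_measurable less_trans[OF zero_less_one p])

lemma L_sharp_norm_eq:
  "L_norm M p (B_sharp_weight p \<alpha> \<beta> b \<eta>) \<rho> (\<lambda>u. ell u powr (- \<alpha> / p)) (Lp_norm p) f =
    \<rho> (\<lambda>y. log_weight (\<eta> * (a + c)) (a + c) b y *
      exp_Lp p (\<lambda>u. ennreal ((1 + u) powr (- a)) * log_rearr M f u) {exp y - 1<..})"
  unfolding L_norm_def hat_norm_eq
proof (rule norm_cong_half_line)
  fix y :: real assume y: "y > 0"
  have "(\<lambda>u. ell u powr (- \<alpha> / p)) \<in> borel_measurable borel"
    unfolding ell_def by measurable
  then have "tilde_norm (Lp_norm p) 0 (exp (- (exp y - 1))) (weighted_rearr M p (\<lambda>u. ell u powr (- \<alpha> / p)) f) =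
      exp_Lp p (\<lambda>u. ennreal (ell (exp (- u)) powr (- \<alpha> / p)) * log_rearr M f u) {exp y - 1<..}"
    using p y by (intro tilde_Lp_tail) auto
  also have "\<dots> = exp_Lp p (\<lambda>u. ennreal ((1 + u) powr (- a)) * log_rearr M f u) {exp y - 1<..}"
  proof -
    have "ell (exp (- u)) powr (- \<alpha> / p) = (1 + u) powr (- a)" if "u \<in> {exp y - 1<..}" for u
    proof -
      have "u > 0"
        using that y by (auto intro: less_trans[of 0 "exp y - 1"])
      then show ?thesis
        by (simp add: ell_exp a)
    qed
    then show ?thesis
      using p by (intro antisym exp_Lp_mono) auto
  qed
  finally show "ennreal (B_sharp_weight p \<alpha> \<beta> b \<eta> (exp (- (exp y - 1)))) *
      tilde_norm (Lp_norm p) 0 (exp (- (exp y - 1))) (weighted_rearr M p (\<lambda>u. ell u powr (- \<alpha> / p)) f) =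
    log_weight (\<eta> * (a + c)) (a + c) b y *
      exp_Lp p (\<lambda>u. ennreal ((1 + u) powr (- a)) * log_rearr M f u) {exp y - 1<..}"
    by (simp only: B_sharp_weight_double_exp[OF p y] a c)
qed (intro borel_measurable_times_ennreal measurable_at double_exp_measurable less_trans[OF zero_less_one p])

lemma RL_norm_eq:
  "RL_norm M p (b \<circ> phi p \<alpha> \<beta>) \<rho> (\<lambda>u. ell u powr (- \<alpha> / p)) Linf_norm (\<lambda>_. 1) (Lp_norm p) f =
    \<rho> (\<lambda>y. log_weight (0 * (a + c)) (a + c) b y * tail_sup p a (log_rearr M f) (exp y - 1))"
  unfolding RL_norm_def hat_norm_eq
proof (rule norm_cong_half_line)
  fix y :: real assume y: "y > 0"
  then have "tilde_norm Linf_norm 0 (exp (- (exp y - 1))) (\<lambda>t. ennreal (ell t powr (- a)) *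
      tilde_norm (Lp_norm p) t (exp (- (exp y - 1))) (weighted_rearr M p (\<lambda>_. 1) f)) =
      tail_sup p a (log_rearr M f) (exp y - 1)"
    using p by (intro tilde_Linf_eq_tail_sup) auto
  moreover have "- \<alpha> / p = - a"
    by (simp add: a)
  ultimately show "ennreal ((b \<circ> phi p \<alpha> \<beta>) (exp (- (exp y - 1)))) *
      tilde_norm Linf_norm 0 (exp (- (exp y - 1))) (\<lambda>t. ennreal (ell t powr (- \<alpha> / p)) *
        tilde_norm (Lp_norm p) t (exp (- (exp y - 1))) (weighted_rearr M p (\<lambda>_. 1) f)) =
    log_weight (0 * (a + c)) (a + c) b y * tail_sup p a (log_rearr M f) (exp y - 1)"
    by (simp only: phi_weight_double_exp[OF p y] a c)
qed (intro borel_measurable_times_ennreal measurable_at double_exp_measurable less_trans[OF zero_less_one p])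

lemma LR_norm_eq:
  "LR_norm M p (b \<circ> phi p \<alpha> \<beta>) \<rho> (\<lambda>u. ell u powr (c - 1)) (Lp_norm 1) (\<lambda>_. 1) (Lp_norm p) f =
    \<rho> (\<lambda>y. log_weight (1 * (a + c)) (a + c) b y *
      (ennreal (exp (- ((a + c) * y))) * head_int p c (log_rearr M f) (exp y - 1)))"
  unfolding LR_norm_def hat_norm_eq
proof (rule norm_cong_half_line)
  fix y :: real assume y: "y > 0"
  then have "tilde_norm (Lp_norm 1) (exp (- (exp y - 1))) 1 (\<lambda>t. ennreal (ell t powr (c - 1)) *
      tilde_norm (Lp_norm p) (exp (- (exp y - 1))) t (weighted_rearr M p (\<lambda>_. 1) f)) =
      head_int p c (log_rearr M f) (exp y - 1)"
    using p by (intro tilde_L1_eq_head_int) auto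
  then show "ennreal ((b \<circ> phi p \<alpha> \<beta>) (exp (- (exp y - 1)))) *
      tilde_norm (Lp_norm 1) (exp (- (exp y - 1))) 1 (\<lambda>t. ennreal (ell t powr (c - 1)) *
        tilde_norm (Lp_norm p) (exp (- (exp y - 1))) t (weighted_rearr M p (\<lambda>_. 1) f)) =
    log_weight (1 * (a + c)) (a + c) b y *
      (ennreal (exp (- ((a + c) * y))) * head_int p c (log_rearr M f) (exp y - 1))"
    by (simp only: phi_weight_double_exp'[OF p y] a c mult.assoc)
qed (intro borel_measurable_times_ennreal measurable_at double_exp_measurable less_trans[OF zero_less_one p])

end

end

theorem corollary6p5:
  fixes M :: "'a measure"
    and E :: "(real \<Rightarrow> ennreal) \<Rightarrow> ennreal"
    and b :: "real \<Rightarrow> real"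
    and p p' \<alpha> \<beta> \<eta> :: real
    and grand small :: "('a \<Rightarrow> 'k::{real_normed_field, second_countable_topology}) \<Rightarrow> ennreal"
  assumes "prob_space M"
    and "ri_function_norm E"
    and "slowly_varying b"
    and "1 < p" and "1 / p + 1 / p' = 1"
    and "\<alpha> > 0" and "\<beta> > 0"
    and "grand = grand_norm M p \<alpha>"
    and "small = small_norm M p \<beta>"
  shows
    "(0 < \<eta> \<and> \<eta> < \<alpha> / (\<alpha> - \<beta> + p * \<beta>) \<longrightarrow>
        same_space M (interpolation_norm M grand small \<eta> b E)
          (R_norm M p (B_weight p \<alpha> \<beta> b \<eta>) E (\<lambda>_. 1) (Lp_norm p)))
   \<and> (\<alpha> / (\<alpha> - \<beta> + p * \<beta>) < \<eta> \<and> \<eta> < 1 \<longrightarrow>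
        same_space M (interpolation_norm M grand small \<eta> b E)
          (L_norm M p (B_weight p \<alpha> \<beta> b \<eta>) E (\<lambda>_. 1) (Lp_norm p)))
   \<and> (\<eta> = \<alpha> / (\<alpha> - \<beta> + p * \<beta>) \<longrightarrow>
        same_space M (interpolation_norm M grand small \<eta> b E)
          (L_norm M p (B_sharp_weight p \<alpha> \<beta> b \<eta>) E (\<lambda>u. ell u powr (- \<alpha> / p)) (Lp_norm p)))
   \<and> same_space M (interpolation_norm M grand small 0 b E)
        (inter_norm
          (R_norm M p (B_weight p \<alpha> \<beta> b 0) E (\<lambda>_. 1) (Lp_norm p))
          (RL_norm M p (b \<circ> phi p \<alpha> \<beta>) E (\<lambda>u. ell u powr (- \<alpha> / p)) Linf_norm
            (\<lambda>_. 1) (Lp_norm p)))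
   \<and> (tilde_norm E 0 1 (\<lambda>t. ennreal (b t)) < \<infinity> \<longrightarrow>
        same_space M (interpolation_norm M grand small 1 b E)
          (inter_norm
            (L_norm M p (B_weight p \<alpha> \<beta> b 1) E (\<lambda>_. 1) (Lp_norm p))
            (LR_norm M p (b \<circ> phi p \<alpha> \<beta>) E (\<lambda>u. ell u powr (\<beta> / p' - 1)) (Lp_norm 1)
              (\<lambda>_. 1) (Lp_norm p))))"
proof -
  interpret ri_function_norm E
    by (rule assms)
  define a where "a = \<alpha> / p"
  define c where "c = \<beta> / conjugate_exponent p"
  have p: "p > 1" and b: "slowly_varying b" and \<alpha>: "\<alpha> > 0" and \<beta>: "\<beta> > 0"
    by fact+
  have M: "finite_measure M"
    using assms(1) by (simp add: prob_space_def)
  have a: "a > 0" and c: "c > 0"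
    using p \<alpha> \<beta> by (auto simp: a_def c_def conjugate_exponent_def)
  have p': "\<beta> / p' = c"
  proof -
    have "p' \<noteq> 0"
      using assms(4,5) by auto
    then have "p' = conjugate_exponent p"
      using assms(4,5) by (simp add: conjugate_exponent_def field_simps)
    then show ?thesis
      by (simp add: c_def)
  qed
  have grand: "grand f = tail_sup p a (log_rearr M f) 0" for f
    using p by (simp add: assms(8) a_def grand_norm_eq)
  have small: "small f = full_int p c (log_rearr M f)" for f
    using p by (simp add: assms(9) c_def small_norm_eq)
  have critical: "\<alpha> / (\<alpha> - \<beta> + p * \<beta>) = a / (a + c)"
  proof -
    have "\<alpha> - \<beta> + p * \<beta> = p * (a + c)"
      using p by (simp add: a_def c_def conjugate_exponent_def field_simps)
    then show ?thesis
      using p by (simp add: a_def)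
  qed
  have less_critical: "\<eta> < a / (a + c) \<longleftrightarrow> \<eta> * (a + c) < a"
    and critical_less: "a / (a + c) < \<eta> \<longleftrightarrow> a < \<eta> * (a + c)"
    using a c by (simp_all add: pos_less_divide_eq pos_divide_less_eq)
  note norms = R_norm_eq[OF p \<alpha> \<beta> b a_def c_def, abs_def] L_norm_eq[OF p \<alpha> \<beta> b a_def c_def, abs_def]
    L_sharp_norm_eq[OF p \<alpha> \<beta> b a_def c_def, abs_def] RL_norm_eq[OF p \<alpha> \<beta> b a_def c_def, abs_def]
    LR_norm_eq[OF p \<alpha> \<beta> b a_def c_def, abs_def]
  note spaces = M p a c b grand small
  have "0 < \<eta> \<Longrightarrow> 0 < \<eta> * (a + c)" "\<eta> < 1 \<Longrightarrow> \<eta> * (a + c) < a + c"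
    "\<eta> = a / (a + c) \<Longrightarrow> \<eta> * (a + c) = a" "0 * (a + c) < a" "a < 1 * (a + c)"
    using a c by auto
  then show ?thesis
    unfolding p' norms critical less_critical critical_less
    by (intro conjI impI interpolation_low[OF spaces] interpolation_high[OF spaces]
        interpolation_critical[OF spaces] interpolation_lower_limit[OF spaces]
        interpolation_upper_limit[OF spaces]) (use a c in simp_all)
qed

end
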